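(* If $L:M\to CH^2_1(-4)$ is a minimal flat slant surface in the Lorentzian complex hyperbolic plane $CH^2_1(-4)$, then $L$ is Lagrangian. Moreover, it is congruent to $\pi\circ\tilde L$, where $$\tilde L(x,y)=\frac1{\sqrt3}\Big(\sqrt2\,e^{-\frac{\mathrm i}{2a}(x+a^2y)}\cosh\big(\tfrac{\sqrt3}{2a}(x-a^2y)\big),\;e^{\mathrm i(ay+\frac xa)},\;\sqrt2\,e^{-\frac{\mathrm i}{2a}(x+a^2y)}\sinh\big(\tfrac{\sqrt3}{2a}(x-a^2y)\big)\Big),$$ $a$ is a nonzero real number and $\pi:H^5_2(-1)\to CH^2_1(-4)$ is the Hopf fibration.
   Context: $\mathbf C^3_2$ is $\mathbf C^3$ with the metric $\mathrm{Re}\,b$, where $b(z,w)=-\bar z_1w_1-\bar z_2w_2+\bar z_3w_3$. $H^5_2(-1)=\{z\in\mathbf C^3_2: b(z,z)=-1\}$, with the induced pseudo-Riemannian metric (constant sectional curvature $-1$). $CH^2_1(-4)$ is the set of complex lines $z\cdot\mathbf C^*$ with $z\in H^5_2(-1)$, with its natural complex structure and the unique pseudo-Riemannian metric of complex index one making the Hopf fibration $\pi:H^5_2(-1)\to CH^2_1(-4)$, $z\mapsto z\cdot\mathbf C^*$, a (pseudo-)Riemannian submersion; it is a Lorentzian complex space form of constant holomorphic sectional curvature $-4$. A Lorentzian surface is an immersed real surface whose induced metric has signature $(1,1)$; it is minimal if its mean curvature vector $H=\frac12\operatorname{trace}h$ ($h$ the second fundamental form) vanishes identically, and flat if the induced metric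 is flat. On a Lorentzian surface take a local tangent frame $\{e_1,e_2\}$ with $\langle e_1,e_1\rangle=\langle e_2,e_2\rangle=0$, $\langle e_1,e_2\rangle=-1$; writing $PX$ for the tangential component of $JX$ ($J$ the complex structure), one has $Pe_1=(\sinh\alpha)e_1$, $Pe_2=-(\sinh\alpha)e_2$ for a function $\alpha$, the Wirtinger angle. A Lorentzian surface is slant if $\alpha$ is constant, and it is Lagrangian if and only if $\alpha=0$. Two surfaces are congruent if, up to reparametrization, they differ by a holomorphic isometry of the ambient space. *)

theory Defs
  imports "HOL-Analysis.Analysis"
begin

section \<open>Smooth maps between Euclidean spaces\<close>

abbreviation dd :: "('a::real_normed_vector \<Rightarrow> 'b::real_normed_vector) \<Rightarrow> 'a \<Rightarrow> 'a \<Rightarrow> 'b" where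
  "dd f x v \<equiv> frechet_derivative f (at x) v"

primrec Ck_on :: "nat \<Rightarrow> 'a::real_normed_vector set \<Rightarrow> ('a \<Rightarrow> 'b::real_normed_vector) \<Rightarrow> bool" where
  "Ck_on 0 S f \<longleftrightarrow> continuous_on S f"
| "Ck_on (Suc n) S f \<longleftrightarrow> (\<forall>x\<in>S. f differentiable (at x)) \<and> (\<forall>v. Ck_on n S (\<lambda>x. dd f x v))"

text \<open>Only used for open \<open>S\<close>.\<close>

definition smooth_on :: "'a::real_normed_vector set \<Rightarrow> ('a \<Rightarrow> 'b::real_normed_vector) \<Rightarrow> bool" where
  "smooth_on S f \<longleftrightarrow> (\<forall>n. Ck_on n S f)"


section \<open>Pseudo-Riemannian geometry in a coordinate domain\<close>

text \<open>
  A metric on an open subset of a Euclidean space is a function \<open>g\<close>, where \<open>g p u v\<close> is the inner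
  product of \<open>u\<close> and \<open>v\<close> at \<open>p\<close>. A vector of the Euclidean space is identified with the constant
  vector field; such fields commute. Hence the Koszul formula determines the covariant
  derivative \<open>christoffel g p u v\<close> of the constant field \<open>v\<close> in the direction \<open>u\<close>
  for the Levi-Civita connection.
\<close>

type_synonym 'a metric = "'a \<Rightarrow> 'a \<Rightarrow> 'a \<Rightarrow> real"

definition christoffel :: "'a::euclidean_space metric \<Rightarrow> 'a \<Rightarrow> 'a \<Rightarrow> 'a \<Rightarrow> 'a" where
  "christoffel g p u v = (THE w. \<forall>x.
     2 * g p w x = dd (\<lambda>q. g q v x) p u + dd (\<lambda>q. g q u x) p v - dd (\<lambda>q. g q u v) p x)"

definition curvature :: "'a::euclidean_space metric \<Rightarrow> 'a \<Rightarrow> 'a \<Rightarrow> 'a \<Rightarrow> 'a \<Rightarrow> 'a" where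
  "curvature g p u v w =
     dd (\<lambda>q. christoffel g q v w) p u - dd (\<lambda>q. christoffel g q u w) p v
     + christoffel g p u (christoffel g p v w) - christoffel g p v (christoffel g p u w)"

text \<open>In the following, \<open>f\<close> is an immersion (defined near \<open>x\<close>) into a domain with metric \<open>g\<close>.\<close>

definition pullback :: "'b metric \<Rightarrow> ('a::euclidean_space \<Rightarrow> 'b::euclidean_space) \<Rightarrow> 'a metric" where
  "pullback g f x u v = g (f x) (dd f x u) (dd f x v)"

definition normal_part ::
  "'b metric \<Rightarrow> ('a::euclidean_space \<Rightarrow> 'b::euclidean_space) \<Rightarrow> 'a \<Rightarrow> 'b \<Rightarrow> 'b" where
  "normal_part g f x X = (THE N. (\<forall>v. g (f x) N (dd f x v) = 0) \<and> X - N \<in> range (dd f x))"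

definition tangential_part ::
  "'b metric \<Rightarrow> ('a::euclidean_space \<Rightarrow> 'b::euclidean_space) \<Rightarrow> 'a \<Rightarrow> 'b \<Rightarrow> 'b" where
  "tangential_part g f x X = X - normal_part g f x X"

text \<open>The covariant derivative, in the direction \<open>u\<close>, of the field \<open>df(v)\<close> along \<open>f\<close>.\<close>

definition ambient_derivative ::
  "'b metric \<Rightarrow> ('a::euclidean_space \<Rightarrow> 'b::euclidean_space) \<Rightarrow> 'a \<Rightarrow> 'a \<Rightarrow> 'a \<Rightarrow> 'b" where
  "ambient_derivative g f x u v =
     dd (\<lambda>y. dd f y v) x u + christoffel g (f x) (dd f x u) (dd f x v)"

definition second_fundamental_form ::
  "'b metric \<Rightarrow> ('a::euclidean_space \<Rightarrow> 'b::euclidean_space) \<Rightarrow> 'a \<Rightarrow> 'a \<Rightarrow> 'a \<Rightarrow> 'b" where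
  "second_fundamental_form g f x u v = normal_part g f x (ambient_derivative g f x u v)"

definition gram_matrix :: "(real^2) metric \<Rightarrow> real^2 \<Rightarrow> real^2^2" where
  "gram_matrix g x = (\<chi> i j. g x (axis i 1) (axis j 1))"

definition mean_curvature_vector ::
  "'b metric \<Rightarrow> (real^2 \<Rightarrow> 'b::euclidean_space) \<Rightarrow> real^2 \<Rightarrow> 'b" where
  "mean_curvature_vector g f x = (1/2) *\<^sub>R
     (\<Sum>i\<in>UNIV. \<Sum>j\<in>UNIV. matrix_inv (gram_matrix (pullback g f) x) $ i $ j *\<^sub>R
        second_fundamental_form g f x (axis i 1) (axis j 1))"


section \<open>The Lorentzian complex hyperbolic plane\<close>

definition bform :: "complex^3 \<Rightarrow> complex^3 \<Rightarrow> complex" where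
  "bform z w = - cnj (z$1) * w$1 - cnj (z$2) * w$2 + cnj (z$3) * w$3"

definition H52 :: "(complex^3) set" where
  "H52 = {z. bform z z = -1}"

definition hopf :: "complex^3 \<Rightarrow> (complex^3) set" where
  "hopf z = {c *s z |c. c \<noteq> 0}"

definition CH21 :: "(complex^3) set set" where
  "CH21 = hopf ` H52"

text \<open>
  The manifold structure is given by the affine charts \<open>z \<cdot> \<complex>* \<mapsto> (z\<^bsub>k+1\<^esub> / z\<^sub>k, z\<^bsub>k+2\<^esub> / z\<^sub>k)\<close>
  for \<open>k = 1, 2, 3\<close>. The indices are elements of the type \<open>3\<close>, whose arithmetic is modulo 3.
\<close>

definition ch_dom :: "3 \<Rightarrow> (complex^3) set set" where
  "ch_dom k = {l \<in> CH21. \<forall>z\<in>l. z$k \<noteq> 0}"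

definition ch_lift :: "3 \<Rightarrow> complex^2 \<Rightarrow> complex^3" where
  "ch_lift k w = (\<chi> i. if i = k then 1 else if i = k + 1 then w$1 else w$2)"

definition ch_coord :: "3 \<Rightarrow> (complex^3) set \<Rightarrow> complex^2" where
  "ch_coord k l = (THE w. ch_lift k w \<in> l)"

text \<open>
  The tangent space of \<open>H52\<close> at \<open>z\<close> is \<open>{X. Re (bform z X) = 0}\<close>, and the fibre of the Hopf fibration
  has the direction \<open>\<i> z\<close>. As \<open>Re (bform (\<i> z) X) = Im (bform z X)\<close>, the horizontal space is the following.
\<close>

definition horizontal :: "complex^3 \<Rightarrow> (complex^3) set" where
  "horizontal z = {X. bform z X = 0}"

text \<open>
  The coordinate expression in chart \<open>k\<close> of the metric for which the Hopf fibration is a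
  pseudo-Riemannian submersion, i.e. for which its differential is isometric on horizontal
  spaces. The map \<open>\<lambda>y. ch_coord k (hopf y)\<close> is defined on an open subset of the complex
  3-space; its differential restricts to that of the Hopf fibration.
\<close>

definition ch_metric :: "3 \<Rightarrow> (complex^2) metric" where
  "ch_metric k w u v = (THE r. \<forall>z\<in>H52. \<forall>X\<in>horizontal z. \<forall>Y\<in>horizontal z.
     hopf z \<in> ch_dom k \<and> ch_coord k (hopf z) = w \<and>
     dd (\<lambda>y. ch_coord k (hopf y)) z X = u \<and> dd (\<lambda>y. ch_coord k (hopf y)) z Y = v
     \<longrightarrow> r = Re (bform X Y))"

lemma mod3: "(k::3) + 1 \<noteq> k" "k + 2 \<noteq> k" "k + 2 \<noteq> k + 1" "k+1 \<noteq> k+2"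
  using exhaust_3[of k] by auto

lemma ex3: "i = k \<or> i = k+1 \<or> i = (k::3)+2"
  using exhaust_3[of k] exhaust_3[of i] by auto

lemma bform_scale: "bform (c *s z) (d *s w) = cnj c * d * bform z w"
  by (simp add: bform_def algebra_simps)

lemma bform_lin: "bform z (c *s v + d *s w) = c * bform z v + d * bform z w"
  by (simp add: bform_def algebra_simps)

lemma bform_diff: "bform z (v - d *s w) = bform z v - d * bform z w"
  by (simp add: bform_def algebra_simps)

definition affine_coord :: "3 \<Rightarrow> complex^3 \<Rightarrow> complex^2" where
  "affine_coord k z = (\<chi> i. z $ (if i = 1 then k + 1 else k + 2) / z $ k)"

lemma lift_affine_coord:
  assumes "z$k \<noteq> 0"
  shows "ch_lift k (affine_coord k z) = (1 / z$k) *s z"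
  unfolding vec_eq_iff
proof
  fix i show "ch_lift k (affine_coord k z) $ i = ((1 / z$k) *s z) $ i"
    using ex3[of i k] mod3[of k] assms by (auto simp: ch_lift_def affine_coord_def)
qed

lemma lift_inj:
  assumes "ch_lift k w = ch_lift k w'"
  shows "w = w'"
proof -
  have "w$1 = ch_lift k w $ (k+1)" "w$2 = ch_lift k w $ (k+2)" for w
    using mod3[of k] by (auto simp: ch_lift_def)
  then show ?thesis using assms by (simp add: vec_eq_iff forall_2)
qed

lemma coord_hopf: assumes "z$k \<noteq> 0" shows "ch_coord k (hopf z) = affine_coord k z"
  unfolding ch_coord_def
proof (rule the_equality)
  show "ch_lift k (affine_coord k z) \<in> hopf z"
    using assms by (auto simp: lift_affine_coord hopf_def intro!: exI[of _ "1 / z$k"])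
  fix w assume "ch_lift k w \<in> hopf z"
  then obtain c where c: "ch_lift k w = c *s z" by (auto simp: hopf_def)
  have "ch_lift k w $ k = 1" by (simp add: ch_lift_def)
  then have "c * z$k = 1" using c by simp
  then have "c = 1 / z$k" using assms by (simp add: field_simps)
  then show "w = affine_coord k z" using c lift_affine_coord[OF assms] lift_inj by metis
qed

lemma affine_coord_deriv: assumes "z$k \<noteq> 0"
  shows "(affine_coord k has_derivative (\<lambda>X. \<chi> i. 
    (X $ (if i = 1 then k + 1 else k + 2) - affine_coord k z $ i * X$k) / z$k)) (at z)"
proof -
  have b: "bounded_linear (\<lambda>x::complex^3. x $ j)" for j by (rule bounded_linear_vec_nth)
  show ?thesis
    unfolding has_derivative_componentwise_within[of "affine_coord k"]
  proof
    fix e :: "complex^2" assume "e \<in> Basis"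
    then obtain i c where e: "e = axis i c" by (auto simp: Basis_vec_def)
    have *: "((\<lambda>y. y $ (if i = 1 then k + 1 else k + 2) / y $ k) has_derivative
       (\<lambda>X. (X $ (if i = 1 then k + 1 else k + 2) - affine_coord k z $ i * X$k) / z$k)) (at z)"
      apply (rule has_derivative_eq_rhs)
       apply (rule has_derivative_divide' bounded_linear.has_derivative[OF b] has_derivative_ident | fact)+
      using assms by (auto simp: fun_eq_iff affine_coord_def field_simps)
    show "((\<lambda>x. affine_coord k x \<bullet> e) has_derivative
          (\<lambda>x. (\<chi> i. (x $ (if i = 1 then k + 1 else k + 2) - affine_coord k z $ i * x $ k) / z $ k) \<bullet> e)) (at z)"
      unfolding e inner_axis using has_derivative_inner_left[OF *, of c] by (simp add: affine_coord_def)
  qed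
qed

lemma dd_coord: assumes "z$k \<noteq> 0"
  shows "dd (\<lambda>y. ch_coord k (hopf y)) z X = (\<chi> i. 
    (X $ (if i = 1 then k + 1 else k + 2) - affine_coord k z $ i * X$k) / z$k)"
proof -
  have "open {y::complex^3. y $ k \<noteq> 0}"
    by (intro open_Collect_neq continuous_intros)
  then have "((\<lambda>y. ch_coord k (hopf y)) has_derivative (\<lambda>X. \<chi> i. 
    (X $ (if i = 1 then k + 1 else k + 2) - affine_coord k z $ i * X$k) / z$k)) (at z)"
    using has_derivative_transform_within_open[OF affine_coord_deriv[OF assms], of "{y. y $ k \<noteq> 0}" "\<lambda>y. ch_coord k (hopf y)"] assms
    by (auto simp: coord_hopf)
  from fun_cong[OF frechet_derivative_at[OF this], of X] show ?thesis by (rule sym)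
qed

text \<open>
  For \<open>Z = ch_lift k w\<close>, the vector \<open>lifted k w u\<close> is the horizontal vector at \<open>Z\<close> over \<open>u\<close>. The next
  lemma shows that the description in \<open>ch_metric\<close> determines \<open>r\<close> uniquely in the range of each chart.
\<close>

definition lifted :: "3 \<Rightarrow> complex^2 \<Rightarrow> complex^2 \<Rightarrow> complex^3" where
  "lifted k w u = (let Z = ch_lift k w; U = ch_lift k u - axis k 1 in
     U - (bform Z U / bform Z Z) *s Z)"

lemma ch_metric_eq:
  assumes "Re (bform (ch_lift k w) (ch_lift k w)) < 0"
  shows "ch_metric k w u v = Re (bform (lifted k w u) (lifted k w v)) / - Re (bform (ch_lift k w) (ch_lift k w))"
proof -
  define Z where "Z = ch_lift k w"
  define n where "n = Re (bform Z Z)"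
  have n: "bform Z Z = of_real n" "n < 0" using assms
    by (auto simp: n_def Z_def bform_def complex_eq_iff)
  have Zk: "Z$k = 1" by (simp add: Z_def ch_lift_def)
  have hor: "bform Z (lifted k w u) = 0" for u
    using n by (simp add: lifted_def Let_def bform_diff flip: Z_def)
  have qcZ: "c \<noteq> 0 \<Longrightarrow> affine_coord k (c *s Z) = w" for c
    using mod3[of k] by (auto simp: affine_coord_def Z_def ch_lift_def vec_eq_iff forall_2)
  have zc: "z = z$k *s Z" if "z$k \<noteq> 0" "affine_coord k z = w" for z
    using lift_affine_coord[OF that(1)] that unfolding Z_def by (simp add: vec_eq_iff)
  define U where "U u = ch_lift k u - axis k 1" for u
  have Zc: "Z$(k+1) = w$1" "Z$(k+2) = w$2" using mod3[of k] by (auto simp: Z_def ch_lift_def)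
  have Uc: "U u $ k = 0" "U u $(k+1) = u$1" "U u $(k+2) = u$2" for u
    using mod3[of k] by (auto simp: U_def ch_lift_def axis_def)
  have horU: "lifted k w u = U u - (bform Z (U u) / bform Z Z) *s Z" for u
    by (simp add: lifted_def Let_def U_def Z_def)
  have dd1: "dd (\<lambda>y. ch_coord k (hopf y)) (c *s Z) (c *s lifted k w u) = u" if "c \<noteq> 0" for c u
    using that Zk by (subst dd_coord) (auto simp: qcZ vec_eq_iff forall_2 horU Zc Uc(2,3)
        Uc(1) Zc[simplified add.commute[of k]] Uc(2,3)[simplified add.commute[of k]] field_simps)
  have key: "X = c *s lifted k w u" if X: "bform (c *s Z) X = 0" "c \<noteq> 0" "dd (\<lambda>y. ch_coord k (hopf y)) (c *s Z) X = u" for c u X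
  proof -
    have 1: "X $ (k+1) = c * u$1 + w$1 * X$k" "X $ (k+2) = c * u$2 + w$2 * X$k"
      using X(3) Zk X(2) by (subst (asm) dd_coord; auto simp: qcZ vec_eq_iff forall_2 field_simps)+
    have 2: "X = c *s U u + (X$k) *s Z"
      unfolding vec_eq_iff
    proof
      fix i show "X $ i = (c *s U u + (X$k) *s Z) $ i"
        using ex3[of i k] 1 by (auto simp: Uc Zc Zk)
    qed
    have "bform Z X = 0" using X(1,2) bform_scale[of c Z 1 X] by simp
    then have "c * bform Z (U u) + X$k * bform Z Z = 0"
      using bform_lin 2 by metis
    then have "X$k = - c * bform Z (U u) / bform Z Z" using n
      by (simp add: field_simps eq_neg_iff_add_eq_0)
    with 2 have "X = c *s U u + (- c * bform Z (U u) / bform Z Z) *s Z" by metis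
    then show ?thesis by (simp add: horU vec_eq_iff algebra_simps)
  qed
  show ?thesis unfolding ch_metric_def
  proof (rule the_equality)
    show "\<forall>z\<in>H52. \<forall>X\<in>horizontal z. \<forall>Y\<in>horizontal z.
     hopf z \<in> ch_dom k \<and> ch_coord k (hopf z) = w \<and>
     dd (\<lambda>y. ch_coord k (hopf y)) z X = u \<and> dd (\<lambda>y. ch_coord k (hopf y)) z Y = v
     \<longrightarrow> Re (bform (lifted k w u) (lifted k w v)) / - Re (bform (ch_lift k w) (ch_lift k w)) = Re (bform X Y)"
    proof (intro ballI impI; elim conjE)
      fix z X Y assume z: "z \<in> H52" "X \<in> horizontal z" "Y \<in> horizontal z" "hopf z \<in> ch_dom k" "ch_coord k (hopf z) = w"
       "dd (\<lambda>y. ch_coord k (hopf y)) z X = u" "dd (\<lambda>y. ch_coord k (hopf y)) z Y = v"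
      have "z \<in> hopf z" unfolding hopf_def by (rule CollectI, rule exI[of _ 1]) simp
      then have zk: "z$k \<noteq> 0" using z(4) unfolding ch_dom_def by blast
      define c where "c = z$k"
      have c: "c \<noteq> 0" "z = c *s Z" using zc[of z] zk z(5) by (auto simp: coord_hopf c_def)
      have "X = c *s lifted k w u" "Y = c *s lifted k w v" using key c z by (auto simp: horizontal_def)
      then have "bform X Y = cnj c * c * bform (lifted k w u) (lifted k w v)" by (simp add: bform_scale)
      moreover have "cnj c * c * n = -1" using z(1) c n bform_scale[of c Z c Z] by (auto simp: H52_def)
      moreover then have "cnj c * c = of_real (1 / - n)" using n(2) by (simp add: field_simps eq_neg_iff_add_eq_0)
      ultimately show "Re (bform (lifted k w u) (lifted k w v)) / - Re (bform (ch_lift k w) (ch_lift k w)) = Re (bform X Y)"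
        by (simp add: n_def Z_def)
    qed
  next
    fix r assume r: "\<forall>z\<in>H52. \<forall>X\<in>horizontal z. \<forall>Y\<in>horizontal z.
     hopf z \<in> ch_dom k \<and> ch_coord k (hopf z) = w \<and>
     dd (\<lambda>y. ch_coord k (hopf y)) z X = u \<and> dd (\<lambda>y. ch_coord k (hopf y)) z Y = v
     \<longrightarrow> r = Re (bform X Y)"
    define c where "c = complex_of_real (1 / sqrt (-n))"
    have "(1 / sqrt (-n)) * (1 / sqrt (-n)) = 1 / - n" using n(2) by simp
    then have c: "c \<noteq> 0" "cnj c * c = of_real (1 / - n)" using n(2)
      unfolding c_def complex_cnj_complex_of_real of_real_mult[symmetric] by auto
    have H: "c *s Z \<in> H52" using c n by (auto simp: H52_def bform_scale)
    have "hopf (c *s Z) \<in> ch_dom k" 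
    proof -
      have "hopf (c *s Z) \<in> CH21" using H by (auto simp: CH21_def)
      then show ?thesis using c Zk by (auto simp: ch_dom_def hopf_def)
    qed
    moreover have "ch_coord k (hopf (c *s Z)) = w" using c Zk by (subst coord_hopf) (auto simp: qcZ)
    moreover have "c *s lifted k w u \<in> horizontal (c *s Z)" for u by (simp add: horizontal_def bform_scale hor)
    ultimately have "r = Re (bform (c *s lifted k w u) (c *s lifted k w v))"
      using dd1[OF c(1)] by (intro r[rule_format, OF H] conjI)
    then show "r = Re (bform (lifted k w u) (lifted k w v)) / - Re (bform (ch_lift k w) (ch_lift k w))"
      using c by (simp add: bform_scale n_def Z_def)
  qed
qed

text \<open>The charts are holomorphic, so the complex structure is multiplication by \<open>\<i>\<close> in each chart.\<close>

definition J :: "complex^2 \<Rightarrow> complex^2" where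
  "J v = \<i> *s v"

definition ch_map_dom :: "((complex^3) set \<Rightarrow> (complex^3) set) \<Rightarrow> 3 \<Rightarrow> 3 \<Rightarrow> (complex^2) set" where
  "ch_map_dom \<Phi> k l = {w. hopf (ch_lift k w) \<in> ch_dom k \<and> \<Phi> (hopf (ch_lift k w)) \<in> ch_dom l}"

definition ch_map_rep ::
  "((complex^3) set \<Rightarrow> (complex^3) set) \<Rightarrow> 3 \<Rightarrow> 3 \<Rightarrow> complex^2 \<Rightarrow> complex^2" where
  "ch_map_rep \<Phi> k l w = ch_coord l (\<Phi> (hopf (ch_lift k w)))"

definition ch_holomorphic :: "((complex^3) set \<Rightarrow> (complex^3) set) \<Rightarrow> bool" where
  "ch_holomorphic \<Phi> \<longleftrightarrow> \<Phi> ` CH21 \<subseteq> CH21 \<and>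
     (\<forall>k l. open (ch_map_dom \<Phi> k l) \<and> smooth_on (ch_map_dom \<Phi> k l) (ch_map_rep \<Phi> k l) \<and>
       (\<forall>w\<in>ch_map_dom \<Phi> k l. \<forall>u. dd (ch_map_rep \<Phi> k l) w (J u) = J (dd (ch_map_rep \<Phi> k l) w u)))"

definition holomorphic_isometry :: "((complex^3) set \<Rightarrow> (complex^3) set) \<Rightarrow> bool" where
  "holomorphic_isometry \<Phi> \<longleftrightarrow> bij_betw \<Phi> CH21 CH21 \<and>
     ch_holomorphic \<Phi> \<and> ch_holomorphic (inv_into CH21 \<Phi>) \<and>
     (\<forall>k l. \<forall>w\<in>ch_map_dom \<Phi> k l. \<forall>u v.
        pullback (ch_metric l) (ch_map_rep \<Phi> k l) w u v = ch_metric k w u v)"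


section \<open>Surfaces\<close>

text \<open>
  A chart is a pair of its domain and its coordinate map. The surface is the union of the chart
  domains, an open subset of a second countable Hausdorff space.
\<close>

type_synonym 'm atlas = "('m set \<times> ('m \<Rightarrow> real^2)) set"

definition smooth_atlas :: "'m::{t2_space,second_countable_topology} atlas \<Rightarrow> bool" where
  "smooth_atlas A \<longleftrightarrow>
     (\<forall>(U, \<phi>)\<in>A. open U \<and> open (\<phi> ` U) \<and> homeomorphism U (\<phi> ` U) \<phi> (inv_into U \<phi>)) \<and>
     (\<forall>(U, \<phi>)\<in>A. \<forall>(V, \<psi>)\<in>A. smooth_on (\<phi> ` (U \<inter> V)) (\<psi> \<circ> inv_into U \<phi>))"

definition carrier :: "'m atlas \<Rightarrow> 'm set" where
  "carrier A = (\<Union>c\<in>A. fst c)"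

text \<open>The coordinate expression of \<open>L\<close> in a chart \<open>c\<close> of the surface and the chart \<open>k\<close> of \<open>CH21\<close>.\<close>

definition rep_dom :: "('m \<Rightarrow> (complex^3) set) \<Rightarrow> 'm set \<times> ('m \<Rightarrow> real^2) \<Rightarrow> 3 \<Rightarrow> (real^2) set" where
  "rep_dom L c k = snd c ` {p \<in> fst c. L p \<in> ch_dom k}"

definition rep ::
  "('m \<Rightarrow> (complex^3) set) \<Rightarrow> 'm set \<times> ('m \<Rightarrow> real^2) \<Rightarrow> 3 \<Rightarrow> real^2 \<Rightarrow> complex^2" where
  "rep L c k x = ch_coord k (L (inv_into (fst c) (snd c) x))"

definition in_coordinates ::
  "'m atlas \<Rightarrow> ('m \<Rightarrow> (complex^3) set) \<Rightarrow>
     ((complex^2) metric \<Rightarrow> (real^2 \<Rightarrow> complex^2) \<Rightarrow> real^2 \<Rightarrow> bool) \<Rightarrow> bool" where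
  "in_coordinates A L P \<longleftrightarrow> (\<forall>c\<in>A. \<forall>k. \<forall>x\<in>rep_dom L c k. P (ch_metric k) (rep L c k) x)"

definition immersion :: "'m atlas \<Rightarrow> ('m \<Rightarrow> (complex^3) set) \<Rightarrow> bool" where
  "immersion A L \<longleftrightarrow> L ` carrier A \<subseteq> CH21 \<and>
     (\<forall>c\<in>A. \<forall>k. open (rep_dom L c k) \<and> smooth_on (rep_dom L c k) (rep L c k)) \<and>
     in_coordinates A L (\<lambda>g f x. inj (dd f x))"

definition lorentzian :: "'m atlas \<Rightarrow> ('m \<Rightarrow> (complex^3) set) \<Rightarrow> bool" where
  "lorentzian A L \<longleftrightarrow> in_coordinates A L (\<lambda>g f x. \<exists>u v.
     pullback g f x u u = -1 \<and> pullback g f x v v = 1 \<and> pullback g f x u v = 0)"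

definition minimal :: "'m atlas \<Rightarrow> ('m \<Rightarrow> (complex^3) set) \<Rightarrow> bool" where
  "minimal A L \<longleftrightarrow> in_coordinates A L (\<lambda>g f x. mean_curvature_vector g f x = 0)"

definition flat :: "'m atlas \<Rightarrow> ('m \<Rightarrow> (complex^3) set) \<Rightarrow> bool" where
  "flat A L \<longleftrightarrow> in_coordinates A L (\<lambda>g f x. \<forall>u v w. curvature (pullback g f) x u v w = 0)"

definition lagrangian :: "'m atlas \<Rightarrow> ('m \<Rightarrow> (complex^3) set) \<Rightarrow> bool" where
  "lagrangian A L \<longleftrightarrow> in_coordinates A L (\<lambda>g f x. \<forall>u v. g (f x) (J (dd f x u)) (dd f x v) = 0)"

text \<open>
  \<open>wirtinger_angle g f N e1 e2 \<alpha>\<close>: the fields \<open>e1\<close>, \<open>e2\<close> (in coordinates of the surface) are a null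
  frame on \<open>N\<close> with inner product \<open>-1\<close>, and the Wirtinger angle with respect to it is \<open>\<alpha>\<close>.
\<close>

definition wirtinger_angle ::
  "(complex^2) metric \<Rightarrow> (real^2 \<Rightarrow> complex^2) \<Rightarrow> (real^2) set \<Rightarrow>
     (real^2 \<Rightarrow> real^2) \<Rightarrow> (real^2 \<Rightarrow> real^2) \<Rightarrow> (real^2 \<Rightarrow> real) \<Rightarrow> bool" where
  "wirtinger_angle g f N e1 e2 \<alpha> \<longleftrightarrow> smooth_on N e1 \<and> smooth_on N e2 \<and>
     (\<forall>x\<in>N. pullback g f x (e1 x) (e1 x) = 0 \<and> pullback g f x (e2 x) (e2 x) = 0 \<and>
        pullback g f x (e1 x) (e2 x) = -1 \<and>
        tangential_part g f x (J (dd f x (e1 x))) = sinh (\<alpha> x) *\<^sub>R dd f x (e1 x) \<and>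
        tangential_part g f x (J (dd f x (e2 x))) = - sinh (\<alpha> x) *\<^sub>R dd f x (e2 x))"

text \<open>
  Interchanging \<open>e1\<close> and \<open>e2\<close> replaces \<open>\<alpha>\<close> by \<open>-\<alpha>\<close>, and there need not be a global frame.
  So the constant is required for a suitable local frame around each point.
\<close>

definition slant :: "'m atlas \<Rightarrow> ('m \<Rightarrow> (complex^3) set) \<Rightarrow> bool" where
  "slant A L \<longleftrightarrow> (\<exists>\<alpha>\<^sub>0. \<forall>c\<in>A. \<forall>k. \<forall>x\<in>rep_dom L c k.
     \<exists>N e1 e2. open N \<and> x \<in> N \<and> N \<subseteq> rep_dom L c k \<and>
       wirtinger_angle (ch_metric k) (rep L c k) N e1 e2 (\<lambda>_. \<alpha>\<^sub>0))"

text \<open>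
  Congruence of \<open>L\<close> with a surface \<open>F\<close> parametrized by the plane. A local reparametrization is a
  diffeomorphism \<open>\<psi>\<close> from an open part \<open>V\<close> of the surface onto an open subset of the plane, i.e.
  a chart compatible with the atlas. The isometry does not depend on \<open>V\<close>. Reparametrizations are
  local since the domain of \<open>L\<close> may be, say, an annulus wound around the image of \<open>F\<close>.
\<close>

definition congruent_to_parametrized ::
  "'m::{t2_space,second_countable_topology} atlas \<Rightarrow> ('m \<Rightarrow> (complex^3) set) \<Rightarrow>
     (real^2 \<Rightarrow> (complex^3) set) \<Rightarrow> bool" where
  "congruent_to_parametrized A L F \<longleftrightarrow> (\<exists>\<Phi>. holomorphic_isometry \<Phi> \<and>
     (\<forall>p\<in>carrier A. \<exists>V \<psi>. p \<in> V \<and> V \<subseteq> carrier A \<and> smooth_atlas (insert (V, \<psi>) A) \<and>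
        (\<forall>q\<in>V. L q = \<Phi> (F (\<psi> q)))))"

definition L_tilde :: "real \<Rightarrow> real^2 \<Rightarrow> complex^3" where
  "L_tilde a t = (let x = t$1; y = t$2 in (1 / sqrt 3) *\<^sub>R vector
     [complex_of_real (sqrt 2) * exp (- \<i> / (2 * a) * (x + a\<^sup>2 * y)) *
        complex_of_real (cosh (sqrt 3 / (2 * a) * (x - a\<^sup>2 * y))),
      exp (\<i> * (a * y + x / a)),
      complex_of_real (sqrt 2) * exp (- \<i> / (2 * a) * (x + a\<^sup>2 * y)) *
        complex_of_real (sinh (sqrt 3 / (2 * a) * (x - a\<^sup>2 * y)))])"

end

theory Submission
  imports Defs
begin

text \<open>The proof works with a lift \<open>Z\<close> of the surface to \<open>\<complex>\<^sup>3\<close> in a chart of the ambient space, and with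
  the horizontal lifts \<open>H1\<close>, \<open>H2\<close> of a null frame \<open>e1\<close>, \<open>e2\<close> of Wirtinger angle \<open>\<alpha>\<close>. Put \<open>s = sinh \<alpha>\<close>,
  \<open>n = bform Z Z\<close> and \<open>\<kappa> = -1 - \<i> s\<close>. Since \<open>\<alpha>\<close> is constant, \<open>Z\<close>, \<open>H1\<close>, \<open>H2\<close> is a frame of \<open>\<complex>\<^sup>3\<close> whose Gram
  matrix is \<open>n\<close> times a constant: the only nonzero entries are \<open>bform Z Z = n\<close>, \<open>bform H1 H2 = - n \<kappa>\<close> and its
  conjugate. Differentiating the Gram matrix and using minimality, that is \<open>h(e1, e2) = 0\<close>, one
  finds that the connection matrix of the frame has the form
    \<open>dZ = \<tau> Z + \<omega>1 H1 + \<omega>2 H2\<close>,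
    \<open>dH1 = cnj \<kappa> \<omega>2 Z + (w + \<tau>) H1 + B \<omega>1 H2\<close>,
    \<open>dH2 = \<kappa> \<omega>1 Z + C \<omega>2 H1 + (\<tau> - w) H2\<close>,
  where \<open>\<omega>1\<close>, \<open>\<omega>2\<close> is the dual coframe, the form \<open>w\<close> is real, and \<open>B \<kappa>\<close>, \<open>C cnj \<kappa>\<close> are imaginary
  (lemma \<open>dd_H_frame\<close>). The equality of mixed second derivatives of \<open>Z\<close>, \<open>H1\<close>, \<open>H2\<close> gives the
  structure equations. The first two say that \<open>w\<close> is the Levi-Civita connection form of the induced
  metric, so flatness is \<open>dw = 0\<close>. The equation for \<open>dw\<close> then becomes \<open>2 cnj \<kappa> - \<kappa> = B C\<close>. Here \<open>B C\<close> is real and the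
  imaginary part of the left hand side is \<open>3 s\<close>. So \<open>s = 0\<close>, the surface is Lagrangian, and
  \<open>B = \<i> \<beta>\<close>, \<open>C = \<i> / \<beta>\<close> for a real function \<open>\<beta>\<close> without zeros (lemma \<open>B_C\<close>).\<close>

text \<open>The remaining equations are \<open>d\<beta> = 3 \<beta> w\<close> and \<open>d\<tau> = 0\<close>. Scaling \<open>e1\<close> by the cube root \<open>\<nu>\<close> of \<open>1 / \<beta>\<close> and
  \<open>e2\<close> by \<open>1 / \<nu>\<close> makes \<open>\<beta> = 1\<close> and removes \<open>w\<close>. Then the dual coframe is \<open>dx\<close>, \<open>dy\<close> for coordinates \<open>x\<close>, \<open>y\<close>,
  and after multiplication of \<open>Z\<close> by a suitable function the lift satisfies
  \<open>Z\<^sub>x\<^sub>x = \<i> Z\<^sub>y\<close>, \<open>Z\<^sub>y\<^sub>y = \<i> Z\<^sub>x\<close>, \<open>Z\<^sub>x\<^sub>y = - Z\<close>. The map \<open>L_tilde 1\<close> satisfies the same equations and has the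
  same Gram matrix, so a constant unitary map takes one lift to the other (lemmas
  \<open>local_normal_form\<close> and \<open>normal_frame_congruent_model\<close>). The parameter \<open>a\<close> is
  inessential: \<open>L_tilde a\<close> at \<open>(x, y)\<close> is \<open>L_tilde 1\<close> at \<open>(x / a, a y)\<close>.\<close>

text \<open>Globally, two unitary maps that serve at a common point serve at the same points, because
  local symmetries of the model extend: a reparametrization of a piece of the model by a unitary
  map preserves the metric \<open>- 2 dx dy\<close> and the cubic form \<open>dx\<^sup>3 + dy\<^sup>3\<close> of the second fundamental form,
  so it is a translation, possibly followed by the exchange of \<open>x\<close> and \<open>y\<close>. By connectedness one
  unitary map serves everywhere.\<close>

section \<open>Differential calculus\<close>

lemma dd_eqI: "(f has_derivative f') (at x) \<Longrightarrow> dd f x v = f' v"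
  using frechet_derivative_at by metis

lemma has_derivative_dd: "f differentiable (at x) \<Longrightarrow> (f has_derivative dd f x) (at x)"
  by (simp add: frechet_derivative_works)

lemma linear_dd: "f differentiable (at x) \<Longrightarrow> linear (dd f x)"
  by (rule linear_frechet_derivative)

lemma has_derivative_cong_open:
  assumes "open S" "x \<in> S" "\<And>y. y \<in> S \<Longrightarrow> f y = g y"
  shows "(f has_derivative f') (at x) \<longleftrightarrow> (g has_derivative f') (at x)"
  using assms has_derivative_transform_within_open[of f f' x UNIV S g]
    has_derivative_transform_within_open[of g f' x UNIV S f] by auto

lemma dd_cong_open:
  assumes "open S" "x \<in> S" "\<And>y. y \<in> S \<Longrightarrow> f y = g y"
  shows "frechet_derivative f (at x) = frechet_derivative g (at x)"
  unfolding frechet_derivative_def using has_derivative_cong_open[OF assms] by presburger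

lemma differentiable_cong_open:
  assumes "open S" "x \<in> S" "\<And>y. y \<in> S \<Longrightarrow> f y = g y"
  shows "f differentiable (at x) \<longleftrightarrow> g differentiable (at x)"
  unfolding differentiable_def using has_derivative_cong_open[OF assms] by presburger

lemma Ck_on_cong:
  assumes "open S" "\<And>y. y \<in> S \<Longrightarrow> f y = g y"
  shows "Ck_on n S f \<longleftrightarrow> Ck_on n S g"
  using assms(2)
proof (induction n arbitrary: f g)
  case 0 then show ?case by (simp cong: continuous_on_cong)
next
  case (Suc n)
  have "Ck_on n S (\<lambda>x. dd f x v) \<longleftrightarrow> Ck_on n S (\<lambda>x. dd g x v)" for v
    using dd_cong_open[OF assms(1) _ Suc.prems] by (intro Suc.IH) simp
  moreover have "(\<forall>x\<in>S. f differentiable (at x)) \<longleftrightarrow> (\<forall>x\<in>S. g differentiable (at x))"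
    using differentiable_cong_open[OF assms(1) _ Suc.prems] by (intro ball_cong) auto
  ultimately show ?case by simp
qed

lemma Ck_on_subset: "Ck_on n S f \<Longrightarrow> T \<subseteq> S \<Longrightarrow> Ck_on n T f"
  by (induction n arbitrary: f) (auto intro: continuous_on_subset)

lemma Ck_on_SucD: "Ck_on (Suc n) S f \<Longrightarrow> Ck_on n S f"
proof (induction n arbitrary: f)
  case 0 then show ?case
    by (auto intro!: continuous_at_imp_continuous_on differentiable_imp_continuous_within)
next
  case (Suc n)
  then have "Ck_on (Suc n) S (\<lambda>x. dd f x v)" for v using Suc.prems by simp
  then have "Ck_on n S (\<lambda>x. dd f x v)" for v by (rule Suc.IH)
  then show ?case using Suc.prems by simp
qed

text \<open>The recursion for \<open>Ck_on\<close> refers to the derivative selected by \<open>dd\<close>. Any family of derivatives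
  on the open set may take its place.\<close>

lemma Ck_on_SucI:
  assumes "open S" "\<And>x. x \<in> S \<Longrightarrow> (f has_derivative f' x) (at x)" "\<And>v. Ck_on n S (\<lambda>x. f' x v)"
  shows "Ck_on (Suc n) S f"
proof -
  have "Ck_on n S (\<lambda>x. dd f x v) \<longleftrightarrow> Ck_on n S (\<lambda>x. f' x v)" for v
    using dd_eqI[OF assms(2)] by (intro Ck_on_cong assms) auto
  then show ?thesis using assms by (auto simp: differentiable_def)
qed

lemma Ck_on_const: "Ck_on n S (\<lambda>x. c)"
proof (induction n arbitrary: c)
  case (Suc n)
  have "dd (\<lambda>x::'a. c) x v = 0" for x v by (rule dd_eqI[OF has_derivative_const])
  then show ?case using Suc by auto
qed simp

lemma Ck_on_add:
  assumes "open S" "Ck_on n S f" "Ck_on n S g" shows "Ck_on n S (\<lambda>x. f x + g x)"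
  using assms(2,3)
proof (induction n arbitrary: f g)
  case 0 then show ?case by (auto intro: continuous_on_add)
next
  case (Suc n)
  then show ?case
    by (intro Ck_on_SucI[OF assms(1), of _ "\<lambda>x v. dd f x v + dd g x v"] has_derivative_add
        has_derivative_dd Suc.IH) auto
qed

lemma Ck_on_sum:
  assumes "open S" "\<And>i. i \<in> I \<Longrightarrow> Ck_on n S (f i)" shows "Ck_on n S (\<lambda>x. \<Sum>i\<in>I. f i x)"
  using assms(2) by (induction I rule: infinite_finite_induct) (auto intro: Ck_on_const Ck_on_add assms(1))

lemma Ck_on_linear:
  assumes "bounded_linear h" "open S" "Ck_on n S f" shows "Ck_on n S (\<lambda>x. h (f x))"
  using assms(3)
proof (induction n arbitrary: f)
  case 0 then show ?case using linear_continuous_on_compose assms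
    by (auto intro: bounded_linear.continuous_on)
next
  case (Suc n)
  then show ?case
    by (intro Ck_on_SucI[OF assms(2), of _ "\<lambda>x v. h (dd f x v)"] bounded_linear.has_derivative[OF assms(1)]
        has_derivative_dd Suc.IH) auto
qed

lemma Ck_on_bilinear:
  assumes "bounded_bilinear h" "open S" "Ck_on n S f" "Ck_on n S g"
  shows "Ck_on n S (\<lambda>x. h (f x) (g x))"
  using assms(3,4)
proof (induction n arbitrary: f g)
  case 0 then show ?case by (auto intro: bounded_bilinear.continuous_on[OF assms(1)])
next
  case (Suc n)
  then show ?case
    by (intro Ck_on_SucI[OF assms(2), of _ "\<lambda>x v. h (f x) (dd g x v) + h (dd f x v) (g x)"]
        bounded_bilinear.FDERIV[OF assms(1)] Ck_on_add assms(2)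
        has_derivative_dd Suc.IH) (auto dest: Ck_on_SucD simp del: Ck_on.simps, auto)
qed

lemma Ck_on_compose:
  fixes f :: "'a::real_normed_vector \<Rightarrow> 'b::euclidean_space" and g :: "'b \<Rightarrow> 'c::real_normed_vector"
  assumes "open S" "open T" "Ck_on n S f" "Ck_on n T g" "f ` S \<subseteq> T"
  shows "Ck_on n S (\<lambda>x. g (f x))"
  using assms(3,4)
proof (induction n arbitrary: g)
  case 0 then show ?case using assms(5) continuous_on_compose2[of T g S f] by simp
next
  case (Suc n)
  have d: "(g has_derivative dd g (f x)) (at (f x))" if "x \<in> S" for x
    using Suc.prems(2) assms(5) that by (intro has_derivative_dd) auto
  have "((\<lambda>x. g (f x)) has_derivative (\<lambda>v. \<Sum>b\<in>Basis. (dd f x v \<bullet> b) *\<^sub>R dd g (f x) b)) (at x)"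
    if "x \<in> S" for x
  proof -
    have "(f has_derivative dd f x) (at x)" using Suc.prems(1) that by (intro has_derivative_dd) auto
    from has_derivative_compose[OF this d[OF that]]
    have "((\<lambda>x. g (f x)) has_derivative (\<lambda>v. dd g (f x) (dd f x v))) (at x)" .
    moreover have "(\<lambda>v. dd g (f x) (dd f x v)) = (\<lambda>v. \<Sum>b\<in>Basis. (dd f x v \<bullet> b) *\<^sub>R dd g (f x) b)"
    proof
      fix v
      let ?w = "dd f x v"
      have "linear (dd g (f x))" using d[OF that] has_derivative_linear by blast
      then have "dd g (f x) (\<Sum>b\<in>Basis. (?w \<bullet> b) *\<^sub>R b) = (\<Sum>b\<in>Basis. (?w \<bullet> b) *\<^sub>R dd g (f x) b)"
        by (simp add: linear_sum linear_scale)
      then show "dd g (f x) ?w = (\<Sum>b\<in>Basis. (?w \<bullet> b) *\<^sub>R dd g (f x) b)"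
        by (simp only: euclidean_representation)
    qed
    ultimately show ?thesis by (rule has_derivative_eq_rhs)
  qed
  moreover have "Ck_on n S (\<lambda>x. \<Sum>b\<in>Basis. (dd f x v \<bullet> b) *\<^sub>R dd g (f x) b)" for v
  proof (intro Ck_on_sum Ck_on_bilinear[OF bounded_bilinear_scaleR] assms(1))
    fix b :: 'b
    show "Ck_on n S (\<lambda>x. dd f x v \<bullet> b)"
      using Suc.prems by (intro Ck_on_linear[OF bounded_linear_inner_left] assms(1)) simp
    show "Ck_on n S (\<lambda>x. dd g (f x) b)"
      using Suc.prems(2) by (intro Suc.IH[OF Ck_on_SucD[OF Suc.prems(1)], of "\<lambda>y. dd g y b"]) simp
  qed
  ultimately show ?case by (rule Ck_on_SucI[OF assms(1)])
qed

lemma smooth_on_differentiable: "smooth_on S f \<Longrightarrow> x \<in> S \<Longrightarrow> f differentiable (at x)"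
  unfolding smooth_on_def by (metis Ck_on.simps(2))

lemma smooth_on_has_derivative: "smooth_on S f \<Longrightarrow> x \<in> S \<Longrightarrow> (f has_derivative dd f x) (at x)"
  by (intro has_derivative_dd smooth_on_differentiable)

lemma smooth_on_dd: "smooth_on S f \<Longrightarrow> smooth_on S (\<lambda>x. dd f x v)"
  unfolding smooth_on_def by (metis Ck_on.simps(2))

lemma smooth_on_continuous: "smooth_on S f \<Longrightarrow> continuous_on S f"
  unfolding smooth_on_def by (metis Ck_on.simps(1))

lemma smooth_on_subset: "smooth_on S f \<Longrightarrow> T \<subseteq> S \<Longrightarrow> smooth_on T f"
  unfolding smooth_on_def using Ck_on_subset by blast

lemma smooth_on_cong:
  assumes "open S" "\<And>y. y \<in> S \<Longrightarrow> f y = g y" shows "smooth_on S f \<longleftrightarrow> smooth_on S g"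
  unfolding smooth_on_def using Ck_on_cong[OF assms(1), of f g] assms(2) by simp

lemma smooth_onI:
  assumes "open S" "\<And>x. x \<in> S \<Longrightarrow> (f has_derivative f' x) (at x)" "\<And>v. smooth_on S (\<lambda>x. f' x v)"
  shows "smooth_on S f"
  unfolding smooth_on_def
proof
  fix n show "Ck_on n S f"
    using Ck_on_SucI[OF assms(1,2), of n] assms(3) Ck_on_SucD unfolding smooth_on_def by blast
qed

lemma smooth_on_const: "smooth_on S (\<lambda>x. c)"
  by (simp add: smooth_on_def Ck_on_const)

lemma smooth_on_add: "open S \<Longrightarrow> smooth_on S f \<Longrightarrow> smooth_on S g \<Longrightarrow> smooth_on S (\<lambda>x. f x + g x)"
  by (simp add: smooth_on_def Ck_on_add)

lemma smooth_on_linear: "bounded_linear h \<Longrightarrow> open S \<Longrightarrow> smooth_on S f \<Longrightarrow> smooth_on S (\<lambda>x. h (f x))"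
  by (simp add: smooth_on_def Ck_on_linear)

lemma smooth_on_bilinear: "bounded_bilinear h \<Longrightarrow> open S \<Longrightarrow> smooth_on S f \<Longrightarrow> smooth_on S g \<Longrightarrow> smooth_on S (\<lambda>x. h (f x) (g x))"
  by (simp add: smooth_on_def Ck_on_bilinear)

lemma smooth_on_compose:
  fixes f :: "'a::real_normed_vector \<Rightarrow> 'b::euclidean_space" and g :: "'b \<Rightarrow> 'c::real_normed_vector"
  shows "open S \<Longrightarrow> open T \<Longrightarrow> smooth_on S f \<Longrightarrow> smooth_on T g \<Longrightarrow> f ` S \<subseteq> T \<Longrightarrow> smooth_on S (\<lambda>x. g (f x))"
  unfolding smooth_on_def using Ck_on_compose by blast

lemma smooth_on_id: "open S \<Longrightarrow> smooth_on S (\<lambda>x. x)"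
  by (rule smooth_onI[of _ _ "\<lambda>x v. v"]) (auto intro: smooth_on_const)

lemma smooth_on_minus: "open S \<Longrightarrow> smooth_on S f \<Longrightarrow> smooth_on S (\<lambda>x. - f x)"
  using smooth_on_linear[OF bounded_linear_minus[OF bounded_linear_ident]] by blast

lemma smooth_on_diff: "open S \<Longrightarrow> smooth_on S f \<Longrightarrow> smooth_on S g \<Longrightarrow> smooth_on S (\<lambda>x. f x - g x)"
  using smooth_on_add[of S f "\<lambda>x. - g x"] smooth_on_minus by fastforce

lemmas smooth_on_scaleR = smooth_on_bilinear[OF bounded_bilinear_scaleR]
lemmas smooth_on_mult = smooth_on_bilinear[OF bounded_bilinear_mult]

text \<open>The derivative of \<open>inverse\<close> is a polynomial in \<open>inverse\<close>, so each order of differentiability yields the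
  next. The cube root below is treated in the same way.\<close>

lemma smooth_on_inverse_function:
  "smooth_on (- {0}) (inverse :: 'a::{real_normed_field} \<Rightarrow> 'a)"
  unfolding smooth_on_def
proof
  fix n show "Ck_on n (- {0}) (inverse :: 'a \<Rightarrow> 'a)"
  proof (induction n)
    case 0 show ?case by (auto intro: continuous_on_inverse continuous_on_id)
  next
    case (Suc n)
    show ?case
    proof (rule Ck_on_SucI[of _ _ "\<lambda>x v. - (inverse x * v * inverse x)"])
      fix v :: 'a
      have "Ck_on n (- {0}) (\<lambda>x::'a. inverse x * v * inverse x)"
        by (intro Ck_on_bilinear[OF bounded_bilinear_mult] Suc Ck_on_const) auto
      then show "Ck_on n (- {0}) (\<lambda>x::'a. - (inverse x * v * inverse x))"
        by (intro Ck_on_linear[OF bounded_linear_minus[OF bounded_linear_ident]]) auto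
    qed (auto intro: has_derivative_inverse')
  qed
qed

lemma smooth_on_inverse:
  fixes f :: "'a::real_normed_vector \<Rightarrow> 'b::{real_normed_field,euclidean_space}"
  assumes "open S" "smooth_on S f" "\<And>x. x \<in> S \<Longrightarrow> f x \<noteq> 0"
  shows "smooth_on S (\<lambda>x. inverse (f x))"
  by (rule smooth_on_compose[OF assms(1) _ assms(2) smooth_on_inverse_function]) (use assms in auto)

lemma smooth_on_divide:
  fixes f :: "'a::real_normed_vector \<Rightarrow> 'b::{real_normed_field,euclidean_space}"
  assumes "open S" "smooth_on S f" "smooth_on S g" "\<And>x. x \<in> S \<Longrightarrow> g x \<noteq> 0"
  shows "smooth_on S (\<lambda>x. f x / g x)"
  using smooth_on_mult[OF assms(1,2) smooth_on_inverse[OF assms(1,3,4)]] by (simp add: divide_inverse)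

lemma smooth_on_cube_root_function: "smooth_on (- {0}) (root 3)"
  unfolding smooth_on_def
proof
  fix n show "Ck_on n (- {0}) (root 3)"
  proof (induction n)
    case 0 show ?case by (auto intro: continuous_on_real_root)
  next
    case (Suc n)
    show ?case
    proof (rule Ck_on_SucI[of _ _ "\<lambda>x v. inverse (3 * (root 3 x * root 3 x)) * v"])
      fix v :: real
      have "Ck_on n (- {0}) (\<lambda>x. 3 * (root 3 x * root 3 x))"
        by (intro Ck_on_bilinear[OF bounded_bilinear_mult] Suc Ck_on_const) auto
      moreover have "Ck_on n (- {0}) (inverse :: real \<Rightarrow> real)"
        using smooth_on_inverse_function[where 'a = real] by (simp add: smooth_on_def)
      ultimately have "Ck_on n (- {0}) (\<lambda>x. inverse (3 * (root 3 x * root 3 x)))"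
        by (rule Ck_on_compose[rotated 2]) auto
      then show "Ck_on n (- {0}) (\<lambda>x. inverse (3 * (root 3 x * root 3 x)) * v)"
        by (intro Ck_on_bilinear[OF bounded_bilinear_mult] Ck_on_const) auto
    next
      fix x :: real assume "x \<in> - {0}"
      then have "(root 3 has_field_derivative inverse (3 * (root 3 x * root 3 x))) (at x)"
        using DERIV_odd_real_root[of 3 x] by (simp add: power2_eq_square)
      then show "(root 3 has_derivative (\<lambda>v. inverse (3 * (root 3 x * root 3 x)) * v)) (at x)"
        unfolding has_field_derivative_def .
    qed auto
  qed
qed

text \<open>Regularity of an inverse map is bootstrapped: its derivative is a smooth function of the
  inverse map itself, so each order of differentiability yields the next.\<close>

lemma smooth_on_inverse_map:
  fixes g :: "'a::euclidean_space \<Rightarrow> 'b::euclidean_space"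
  assumes "open V" "open S" "g ` V \<subseteq> S" "\<And>b. b \<in> Basis \<Longrightarrow> smooth_on S (e b)"
    "\<And>y. y \<in> V \<Longrightarrow> (g has_derivative (\<lambda>v. \<Sum>b\<in>Basis. (v \<bullet> b) *\<^sub>R e b (g y))) (at y)"
  shows "smooth_on V g"
  unfolding smooth_on_def
proof
  fix n show "Ck_on n V g"
  proof (induction n)
    case 0
    show ?case using assms(5) by (auto intro!: continuous_at_imp_continuous_on has_derivative_continuous)
  next
    case (Suc n)
    show ?case
    proof (rule Ck_on_SucI[OF assms(1,5)])
      fix v
      show "Ck_on n V (\<lambda>x. \<Sum>b\<in>Basis. (v \<bullet> b) *\<^sub>R e b (g x))"
        using assms(4) unfolding smooth_on_def
        by (intro Ck_on_sum assms Ck_on_bilinear[OF bounded_bilinear_scaleR] Ck_on_const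
            Ck_on_compose[OF assms(1,2) Suc _ assms(3)]) auto
    qed
  qed
qed

section \<open>Second derivatives\<close>

text \<open>Two applications of the mean value theorem, one for each direction. The second difference is
  symmetric in \<open>u\<close> and \<open>v\<close>, which gives the symmetry of second derivatives in the limit.\<close>

lemma mixed_difference:
  fixes f :: "'a::real_normed_vector \<Rightarrow> real"
  assumes "smooth_on (ball x r) f" "h > 0" "h * (norm u + norm v) < r"
  shows "\<exists>s t. 0 < s \<and> s < h \<and> 0 < t \<and> t < h \<and>
    f (x + h *\<^sub>R u + h *\<^sub>R v) - f (x + h *\<^sub>R u) - f (x + h *\<^sub>R v) + f x =
    h * h * dd (\<lambda>y. dd f y u) (x + s *\<^sub>R u + t *\<^sub>R v) v"
proof -
  have B: "x + s *\<^sub>R u + t *\<^sub>R v \<in> ball x r" if "0 \<le> s" "s \<le> h" "0 \<le> t" "t \<le> h" for s t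
  proof -
    have "norm (s *\<^sub>R u + t *\<^sub>R v) \<le> s * norm u + t * norm v"
      using norm_triangle_ineq[of "s *\<^sub>R u" "t *\<^sub>R v"] that by simp
    also have "\<dots> \<le> h * norm u + h * norm v"
      using that by (intro add_mono mult_right_mono) auto
    finally have "norm (s *\<^sub>R u + t *\<^sub>R v) < r" using assms(3) by (simp add: algebra_simps)
    moreover have "dist x (x + s *\<^sub>R u + t *\<^sub>R v) = norm (s *\<^sub>R u + t *\<^sub>R v)"
      by (metis add.assoc add_diff_cancel_left' dist_commute dist_norm)
    ultimately show ?thesis by simp
  qed
  define \<phi> where "\<phi> s = f (x + s *\<^sub>R u + h *\<^sub>R v) - f (x + s *\<^sub>R u + 0 *\<^sub>R v)" for s
  have d: "((\<lambda>s. F (x + s *\<^sub>R u + t *\<^sub>R v)) has_real_derivative dd F (x + s *\<^sub>R u + t *\<^sub>R v) u) (at s)"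
    "((\<lambda>t. F (x + s *\<^sub>R u + t *\<^sub>R v)) has_real_derivative dd F (x + s *\<^sub>R u + t *\<^sub>R v) v) (at t)"
    if "smooth_on (ball x r) F" "0 \<le> s" "s \<le> h" "0 \<le> t" "t \<le> h" for F :: "'a \<Rightarrow> real" and s t
  proof -
    note D = smooth_on_has_derivative[OF that(1) B[OF that(2-)]]
    have "((\<lambda>s. F (x + s *\<^sub>R u + t *\<^sub>R v)) has_derivative (\<lambda>\<sigma>. dd F (x + s *\<^sub>R u + t *\<^sub>R v) (\<sigma> *\<^sub>R u))) (at s)"
      by (rule has_derivative_compose[of "\<lambda>s. x + s *\<^sub>R u + t *\<^sub>R v" _ s UNIV F, OF _ D]) (auto intro!: derivative_eq_intros)
    then show "((\<lambda>s. F (x + s *\<^sub>R u + t *\<^sub>R v)) has_real_derivative dd F (x + s *\<^sub>R u + t *\<^sub>R v) u) (at s)"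
      using linear_scale[OF has_derivative_linear[OF D]] by (simp add: has_field_derivative_def mult_commute_abs)
    have "((\<lambda>t. F (x + s *\<^sub>R u + t *\<^sub>R v)) has_derivative (\<lambda>\<sigma>. dd F (x + s *\<^sub>R u + t *\<^sub>R v) (\<sigma> *\<^sub>R v))) (at t)"
      by (rule has_derivative_compose[of "\<lambda>t. x + s *\<^sub>R u + t *\<^sub>R v" _ t UNIV F, OF _ D]) (auto intro!: derivative_eq_intros)
    then show "((\<lambda>t. F (x + s *\<^sub>R u + t *\<^sub>R v)) has_real_derivative dd F (x + s *\<^sub>R u + t *\<^sub>R v) v) (at t)"
      using linear_scale[OF has_derivative_linear[OF D]] by (simp add: has_field_derivative_def mult_commute_abs)
  qed
  have "(\<phi> has_real_derivative dd f (x + s *\<^sub>R u + h *\<^sub>R v) u - dd f (x + s *\<^sub>R u + 0 *\<^sub>R v) u) (at s)"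
    if "0 \<le> s" "s \<le> h" for s
    unfolding \<phi>_def using that assms by (intro DERIV_diff d) auto
  from MVT2[OF assms(2) this] obtain s where s: "0 < s" "s < h"
    "\<phi> h - \<phi> 0 = h * (dd f (x + s *\<^sub>R u + h *\<^sub>R v) u - dd f (x + s *\<^sub>R u + 0 *\<^sub>R v) u)" by auto
  have "((\<lambda>t. dd f (x + s *\<^sub>R u + t *\<^sub>R v) u) has_real_derivative
      dd (\<lambda>y. dd f y u) (x + s *\<^sub>R u + t *\<^sub>R v) v) (at t)" if "0 \<le> t" "t \<le> h" for t
    using s that assms by (intro d smooth_on_dd) auto
  from MVT2[OF assms(2) this] obtain t where t: "0 < t" "t < h"
    "dd f (x + s *\<^sub>R u + h *\<^sub>R v) u - dd f (x + s *\<^sub>R u + 0 *\<^sub>R v) u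
       = h * dd (\<lambda>y. dd f y u) (x + s *\<^sub>R u + t *\<^sub>R v) v" by auto
  show ?thesis using s t by (intro exI[of _ s] exI[of _ t]) (auto simp: \<phi>_def)
qed

lemma dd_commute_real:
  fixes f :: "'a::real_normed_vector \<Rightarrow> real"
  assumes S: "smooth_on S f" "open S" "x \<in> S"
  shows "dd (\<lambda>y. dd f y u) x v = dd (\<lambda>y. dd f y v) x u"
proof (rule ccontr)
  define p where "p y = dd (\<lambda>y. dd f y u) y v" for y
  define q where "q y = dd (\<lambda>y. dd f y v) y u" for y
  \<comment> \<open>By continuity both second derivatives stay apart near \<open>x\<close>, but somewhere near \<open>x\<close> they agree.\<close>
  assume "\<not> ?thesis"
  then have "p x \<noteq> q x" by (simp add: p_def q_def)
  define e where "e = \<bar>p x - q x\<bar> / 2"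
  have e: "e > 0" using \<open>p x \<noteq> q x\<close> by (simp add: e_def)
  have "continuous_on S p" "continuous_on S q"
    unfolding p_def q_def using S by (auto intro: smooth_on_continuous smooth_on_dd)
  then have "isCont p x" "isCont q x" using S by (auto simp: continuous_on_eq_continuous_at)
  then obtain r1 r2 where r: "r1 > 0" "r2 > 0" "\<And>y. dist y x < r1 \<Longrightarrow> dist (p y) (p x) < e"
    "\<And>y. dist y x < r2 \<Longrightarrow> dist (q y) (q x) < e"
    using e unfolding continuous_at_eps_delta by metis
  obtain r0 where r0: "r0 > 0" "ball x r0 \<subseteq> S" using S open_contains_ball by blast
  define r where "r = min r0 (min r1 r2)"
  have rpos: "r > 0" using r r0 by (simp add: r_def)
  have "ball x r \<subseteq> S" using subset_ball[of r r0 x] r0 by (auto simp: r_def)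
  then have sm: "smooth_on (ball x r) f" by (rule smooth_on_subset[OF S(1)])
  define h where "h = r / (norm u + norm v + 1)"
  have hp: "h > 0" using rpos by (simp add: h_def add_nonneg_pos)
  have "h * (norm u + norm v + 1) = r"
    using add_nonneg_pos[of "norm u + norm v" 1] by (simp add: h_def)
  then have hr: "h * (norm u + norm v) < r" "h * (norm v + norm u) < r"
    using hp by (auto simp: algebra_simps)
  from mixed_difference[OF sm hp hr(1)] obtain s t where st: "0 < s" "s < h" "0 < t" "t < h"
    "f (x + h *\<^sub>R u + h *\<^sub>R v) - f (x + h *\<^sub>R u) - f (x + h *\<^sub>R v) + f x = h * h * p (x + s *\<^sub>R u + t *\<^sub>R v)"
    unfolding p_def by blast
  from mixed_difference[OF sm hp hr(2)] obtain s' t' where st': "0 < s'" "s' < h" "0 < t'" "t' < h"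
    "f (x + h *\<^sub>R v + h *\<^sub>R u) - f (x + h *\<^sub>R v) - f (x + h *\<^sub>R u) + f x = h * h * q (x + s' *\<^sub>R v + t' *\<^sub>R u)"
    unfolding q_def by blast
  have near: "dist (x + a *\<^sub>R c + b *\<^sub>R d) x < r" if "0 < a" "a < h" "0 < b" "b < h" "h * (norm c + norm d) < r"
    for a b and c d :: 'a
  proof -
    have "norm (a *\<^sub>R c + b *\<^sub>R d) \<le> a * norm c + b * norm d"
      using norm_triangle_ineq[of "a *\<^sub>R c" "b *\<^sub>R d"] that by simp
    also have "\<dots> \<le> h * norm c + h * norm d"
      using that by (intro add_mono mult_right_mono) auto
    finally show ?thesis using that(5) by (simp add: dist_norm add.assoc algebra_simps)
  qed
  have "h * h * p (x + s *\<^sub>R u + t *\<^sub>R v) = h * h * q (x + s' *\<^sub>R v + t' *\<^sub>R u)"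
    using st(5) st'(5) by (simp add: algebra_simps)
  then have eq: "p (x + s *\<^sub>R u + t *\<^sub>R v) = q (x + s' *\<^sub>R v + t' *\<^sub>R u)" using hp by simp
  have "dist (p (x + s *\<^sub>R u + t *\<^sub>R v)) (p x) < e"
    using near[OF st(1-4) hr(1)] by (intro r) (simp add: r_def)
  moreover have "dist (q (x + s' *\<^sub>R v + t' *\<^sub>R u)) (q x) < e"
    using near[OF st'(1-4) hr(2)] by (intro r) (simp add: r_def)
  moreover have "\<bar>p x - q x\<bar> \<le> \<bar>a - p x\<bar> + \<bar>a - q x\<bar>" for a by linarith
  from this[of "p (x + s *\<^sub>R u + t *\<^sub>R v)"] have "2 * e \<le> dist (p (x + s *\<^sub>R u + t *\<^sub>R v)) (p x) +
      dist (q (x + s' *\<^sub>R v + t' *\<^sub>R u)) (q x)" unfolding eq dist_real_def e_def by simp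
  ultimately show False by linarith
qed

lemma dd_linear_comp: "bounded_linear h \<Longrightarrow> f differentiable (at x) \<Longrightarrow> dd (\<lambda>y. h (f y)) x v = h (dd f x v)"
  using dd_eqI[OF bounded_linear.has_derivative[OF _ has_derivative_dd]] by blast

lemma dd_commute:
  fixes f :: "'a::real_normed_vector \<Rightarrow> 'b::euclidean_space"
  assumes S: "smooth_on S f" "open S" "x \<in> S"
  shows "dd (\<lambda>y. dd f y u) x v = dd (\<lambda>y. dd f y v) x u"
proof (rule euclidean_eqI)
  fix b :: 'b
  have sm: "smooth_on S (\<lambda>y. f y \<bullet> b)" by (rule smooth_on_linear[OF bounded_linear_inner_left S(2,1)])
  have 1: "dd (\<lambda>y. f y \<bullet> b) y w = dd f y w \<bullet> b" if "y \<in> S" for y w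
    using that S by (intro dd_linear_comp[OF bounded_linear_inner_left] smooth_on_differentiable)
  have 2: "dd (\<lambda>y. dd f y w \<bullet> b) x w' = dd (\<lambda>y. dd f y w) x w' \<bullet> b" for w w'
    using S by (intro dd_linear_comp[OF bounded_linear_inner_left] smooth_on_differentiable smooth_on_dd)
  have 3: "frechet_derivative (\<lambda>y. dd f y w \<bullet> b) (at x) = frechet_derivative (\<lambda>y. dd (\<lambda>y. f y \<bullet> b) y w) (at x)" for w
    using S 1 by (intro dd_cong_open[of S]) auto
  show "dd (\<lambda>y. dd f y u) x v \<bullet> b = dd (\<lambda>y. dd f y v) x u \<bullet> b"
    unfolding 2[symmetric] 3 by (rule dd_commute_real[OF sm S(2,3)])
qed

section \<open>Potentials of closed one-forms\<close>

text \<open>The potential is the integral of the form along the segments from the centre of the ball. By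
  closedness the derivative of the integrand at \<open>x\<close> in the direction \<open>v\<close> is
  the derivative of \<open>t *\<^sub>R \<alpha> (c + t *\<^sub>R (x - c)) v\<close> with respect to \<open>t\<close>.\<close>

lemma closed_form_has_potential:
  fixes \<alpha> :: "'a::euclidean_space \<Rightarrow> 'a \<Rightarrow> 'b::euclidean_space"
  assumes lin: "\<And>x. x \<in> ball c r \<Longrightarrow> linear (\<alpha> x)"
    and sm: "\<And>v. smooth_on (ball c r) (\<lambda>x. \<alpha> x v)"
    and closed: "\<And>x u v. x \<in> ball c r \<Longrightarrow> dd (\<lambda>y. \<alpha> y v) x u = dd (\<lambda>y. \<alpha> y u) x v"
  shows "\<exists>F. \<forall>x\<in>ball c r. (F has_derivative \<alpha> x) (at x)"
proof -
  define \<gamma> where "\<gamma> x t = c + t *\<^sub>R (x - c)" for x and t :: real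
  have \<gamma>: "\<gamma> x t \<in> ball c r" if "x \<in> ball c r" "t \<in> cbox 0 1" for x t
  proof -
    have "dist c (\<gamma> x t) = t * dist c x" using that by (simp add: \<gamma>_def dist_norm norm_minus_commute)
    also have "\<dots> \<le> dist c x" using that by (intro mult_left_le_one_le) auto
    finally show ?thesis using that by simp
  qed
  have \<gamma>c: "continuous_on UNIV (\<lambda>(x, t). \<gamma> x t)" unfolding \<gamma>_def case_prod_beta by (intro continuous_intros)
  define f where "f x t = (\<Sum>b\<in>Basis. ((x - c) \<bullet> b) *\<^sub>R \<alpha> (\<gamma> x t) b)" for x t
  define f' where "f' x t v = (\<Sum>b\<in>Basis. ((x - c) \<bullet> b) *\<^sub>R (t *\<^sub>R dd (\<lambda>y. \<alpha> y b) (\<gamma> x t) v)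
       + (v \<bullet> b) *\<^sub>R \<alpha> (\<gamma> x t) b)" for x t v
  have ld: "linear (dd (\<lambda>y. \<alpha> y b) (\<gamma> x t))" if "x \<in> ball c r" "t \<in> cbox 0 1" for x t b
    by (intro linear_dd smooth_on_differentiable[OF sm] \<gamma> that)
  have fd: "((\<lambda>x. f x t) has_derivative f' x t) (at x)" if "x \<in> ball c r" "t \<in> cbox 0 1" for x t
  proof -
    have "((\<lambda>x. \<alpha> (\<gamma> x t) b) has_derivative (\<lambda>v. dd (\<lambda>y. \<alpha> y b) (\<gamma> x t) (t *\<^sub>R v))) (at x)" for b
      by (rule has_derivative_compose[of "\<lambda>x. \<gamma> x t" _ x UNIV "\<lambda>y. \<alpha> y b", OF _ smooth_on_has_derivative[OF sm \<gamma>[OF that]]])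
        (auto simp: \<gamma>_def intro!: derivative_eq_intros)
    then have "((\<lambda>x. f x t) has_derivative (\<lambda>v. \<Sum>b\<in>Basis. ((x - c) \<bullet> b) *\<^sub>R dd (\<lambda>y. \<alpha> y b) (\<gamma> x t) (t *\<^sub>R v)
       + (v \<bullet> b) *\<^sub>R \<alpha> (\<gamma> x t) b)) (at x)"
      unfolding f_def by (intro has_derivative_sum has_derivative_scaleR) (auto intro!: derivative_eq_intros)
    then show ?thesis unfolding f'_def using linear_scale[OF ld[OF that]] by simp
  qed
  have bl: "bounded_linear (f' x t)" if "x \<in> ball c r" "t \<in> cbox 0 1" for x t
    using fd[OF that] has_derivative_bounded_linear by blast
  have ca: "continuous_on (ball c r \<times> cbox 0 1) (\<lambda>(x, t). g (\<gamma> x t))" if "smooth_on (ball c r) g" for g :: "'a \<Rightarrow> 'b"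
    unfolding case_prod_beta
    by (rule continuous_on_compose2[OF smooth_on_continuous[OF that] continuous_on_subset[OF \<gamma>c[unfolded case_prod_beta]]]) (use \<gamma> in auto)
  have fi: "f x integrable_on cbox 0 1" if "x \<in> ball c r" for x
  proof (rule integrable_continuous, unfold f_def, intro continuous_intros)
    fix b
    show "continuous_on (cbox 0 1) (\<lambda>t. \<alpha> (\<gamma> x t) b)"
      by (rule continuous_on_compose2[OF smooth_on_continuous[OF sm]])
        (use \<gamma>[OF that] in \<open>auto simp: \<gamma>_def intro!: continuous_intros\<close>)
  qed
  define F where "F x = integral (cbox 0 1) (f x)" for x
  have "(F has_derivative \<alpha> x) (at x)" if x: "x \<in> ball c r" for x
  proof -
    have "continuous_on (ball c r \<times> cbox 0 1) (\<lambda>z. f' (fst z) (snd z) v)" for v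
      unfolding f'_def
      by (intro continuous_intros ca[OF sm, unfolded case_prod_beta] ca[OF smooth_on_dd[OF sm], unfolded case_prod_beta])
    then have "continuous_on (ball c r \<times> cbox 0 1) (\<lambda>z. blinfun_apply (Blinfun (f' (fst z) (snd z))) v)" for v
      by (rule continuous_on_eq) (use bl in \<open>auto simp: bounded_linear_Blinfun_apply\<close>)
    then have cB: "continuous_on (ball c r \<times> cbox 0 1) (\<lambda>(x, t). Blinfun (f' x t))"
      unfolding case_prod_beta by (intro continuous_on_blinfun_componentwise) auto
    then have 1: "(F has_derivative integral (cbox 0 1) (\<lambda>t. Blinfun (f' x t))) (at x within ball c r)"
      unfolding F_def
      using fd bl by (intro leibniz_rule[of "ball c r" 0 1 f "\<lambda>x t. Blinfun (f' x t)"] fi x)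
        (auto simp: bounded_linear_Blinfun_apply intro: has_derivative_at_withinI)
    have "continuous_on (cbox 0 1) (\<lambda>t. case (x, t) of (x, t) \<Rightarrow> Blinfun (f' x t))"
      by (rule continuous_on_compose2[OF cB continuous_on_Pair[OF continuous_on_const continuous_on_id]]) (use x in auto)
    then have ct: "continuous_on (cbox 0 1) (\<lambda>t. Blinfun (f' x t))" by simp
    have 2: "blinfun_apply (integral (cbox 0 1) (\<lambda>t. Blinfun (f' x t))) v = \<alpha> x v" for v
    proof -
      have "blinfun_apply (integral (cbox 0 1) (\<lambda>t. Blinfun (f' x t))) v = integral (cbox 0 1) (\<lambda>t. blinfun_apply (Blinfun (f' x t)) v)"
        by (rule blinfun_apply_integral) (rule integrable_continuous[OF ct])
      also have "\<dots> = integral (cbox 0 1) (\<lambda>t. f' x t v)"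
        by (rule integral_cong) (simp add: bounded_linear_Blinfun_apply[OF bl[OF x]])
      finally have 3: "blinfun_apply (integral (cbox 0 1) (\<lambda>t. Blinfun (f' x t))) v = integral (cbox 0 1) (\<lambda>t. f' x t v)" .
      have "((\<lambda>t. f' x t v) has_integral (1 *\<^sub>R \<alpha> (\<gamma> x 1) v - 0 *\<^sub>R \<alpha> (\<gamma> x 0) v)) {0..1}"
      proof (rule fundamental_theorem_of_calculus)
        fix t :: real assume t: "t \<in> {0..1}"
        then have t': "t \<in> cbox 0 1" by simp
        have "f' x t v = t *\<^sub>R (\<Sum>b\<in>Basis. ((x - c) \<bullet> b) *\<^sub>R dd (\<lambda>y. \<alpha> y b) (\<gamma> x t) v) + (\<Sum>b\<in>Basis. (v \<bullet> b) *\<^sub>R \<alpha> (\<gamma> x t) b)"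
          by (simp add: f'_def sum.distrib scaleR_sum_right mult.commute)
        also have "(\<Sum>b\<in>Basis. (v \<bullet> b) *\<^sub>R \<alpha> (\<gamma> x t) b) = \<alpha> (\<gamma> x t) (\<Sum>b\<in>Basis. (v \<bullet> b) *\<^sub>R b)"
          using lin[OF \<gamma>[OF x t']] by (simp add: linear_sum linear_scale)
        also have "(\<Sum>b\<in>Basis. ((x - c) \<bullet> b) *\<^sub>R dd (\<lambda>y. \<alpha> y b) (\<gamma> x t) v) =
          (\<Sum>b\<in>Basis. ((x - c) \<bullet> b) *\<^sub>R dd (\<lambda>y. \<alpha> y v) (\<gamma> x t) b)"
          using closed[OF \<gamma>[OF x t'], of _ v] by simp
        also have "\<dots> = dd (\<lambda>y. \<alpha> y v) (\<gamma> x t) (\<Sum>b\<in>Basis. ((x - c) \<bullet> b) *\<^sub>R b)"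
          using ld[OF x t'] by (simp add: linear_sum linear_scale)
        finally have eq: "f' x t v = t *\<^sub>R dd (\<lambda>y. \<alpha> y v) (\<gamma> x t) (x - c) + \<alpha> (\<gamma> x t) v"
          by (simp add: euclidean_representation)
        have "((\<lambda>t. \<alpha> (\<gamma> x t) v) has_derivative (\<lambda>s. dd (\<lambda>y. \<alpha> y v) (\<gamma> x t) (s *\<^sub>R (x - c)))) (at t)"
          by (rule has_derivative_compose[of "\<gamma> x" _ t UNIV "\<lambda>y. \<alpha> y v", OF _ smooth_on_has_derivative[OF sm \<gamma>[OF x t']]])
            (auto simp: \<gamma>_def[abs_def] intro!: derivative_eq_intros)
        then have "((\<lambda>t. \<alpha> (\<gamma> x t) v) has_vector_derivative dd (\<lambda>y. \<alpha> y v) (\<gamma> x t) (x - c)) (at t within {0..1})"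
          unfolding has_vector_derivative_def using linear_scale[OF ld[OF x t']]
          by (simp add: has_derivative_at_withinI)
        then show "((\<lambda>t. t *\<^sub>R \<alpha> (\<gamma> x t) v) has_vector_derivative f' x t v) (at t within {0..1})"
          unfolding eq by (auto intro!: derivative_eq_intros)
      qed simp
      then have "integral (cbox 0 1) (\<lambda>t. f' x t v) = \<alpha> x v"
        by (simp add: \<gamma>_def integral_unique)
      with 3 show ?thesis by simp
    qed
    have "(F has_derivative \<alpha> x) (at x within ball c r)"
      using 1 2 by (simp add: fun_eq_iff has_derivative_eq_rhs)
    then show ?thesis unfolding at_within_open[OF x open_ball] .
  qed
  then show ?thesis by blast
qed

section \<open>Rules for directional derivatives\<close>

lemma dd_const: "dd (\<lambda>x. c) x v = 0"
  by (rule dd_eqI[OF has_derivative_const])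

lemma dd_add: "f differentiable (at x) \<Longrightarrow> g differentiable (at x) \<Longrightarrow> dd (\<lambda>x. f x + g x) x v = dd f x v + dd g x v"
  using dd_eqI[OF has_derivative_add[OF has_derivative_dd has_derivative_dd]] by blast

lemma dd_diff: "f differentiable (at x) \<Longrightarrow> g differentiable (at x) \<Longrightarrow> dd (\<lambda>x. f x - g x) x v = dd f x v - dd g x v"
  using dd_eqI[OF has_derivative_diff[OF has_derivative_dd has_derivative_dd]] by blast

lemma dd_minus: "f differentiable (at x) \<Longrightarrow> dd (\<lambda>x. - f x) x v = - dd f x v"
  using dd_eqI[OF has_derivative_minus[OF has_derivative_dd]] by blast

lemma dd_bilinear:
  assumes "bounded_bilinear h" "f differentiable (at x)" "g differentiable (at x)"
  shows "dd (\<lambda>x. h (f x) (g x)) x v = h (f x) (dd g x v) + h (dd f x v) (g x)"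
  using dd_eqI[OF bounded_bilinear.FDERIV[OF assms(1) has_derivative_dd[OF assms(2)] has_derivative_dd[OF assms(3)]]] .

lemmas dd_mult = dd_bilinear[OF bounded_bilinear_mult]
lemmas dd_scaleR = dd_bilinear[OF bounded_bilinear_scaleR]

lemma dd_sum:
  assumes "\<And>i. i \<in> I \<Longrightarrow> f i differentiable (at x)"
  shows "dd (\<lambda>x. \<Sum>i\<in>I. f i x) x v = (\<Sum>i\<in>I. dd (f i) x v)"
  by (rule dd_eqI[OF has_derivative_sum[OF has_derivative_dd[OF assms]]])

lemma differentiable_bilinear:
  "bounded_bilinear h \<Longrightarrow> f differentiable (at x) \<Longrightarrow> g differentiable (at x) \<Longrightarrow> (\<lambda>x. h (f x) (g x)) differentiable (at x)"
  using bounded_bilinear.FDERIV unfolding differentiable_def by blast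

lemma form_eq_sum_Basis:
  fixes \<omega> :: "'a::euclidean_space \<Rightarrow> 'b::real_vector"
  assumes "linear \<omega>" shows "\<omega> v = (\<Sum>b\<in>Basis. (v \<bullet> b) *\<^sub>R \<omega> b)"
proof -
  have "\<omega> (\<Sum>b\<in>Basis. (v \<bullet> b) *\<^sub>R b) = (\<Sum>b\<in>Basis. (v \<bullet> b) *\<^sub>R \<omega> b)"
    using assms by (simp add: linear_sum linear_scale)
  then show ?thesis by (simp only: euclidean_representation)
qed

text \<open>Product rule for a one-form evaluated on a vector field. It expresses the derivative of a frame
  through that of the dual coframe.\<close>

lemma dd_form_apply:
  fixes \<omega> :: "'c::real_normed_vector \<Rightarrow> 'a::euclidean_space \<Rightarrow> 'b::real_normed_vector"
  assumes N: "open N" "x \<in> N" and lin: "\<And>q. q \<in> N \<Longrightarrow> linear (\<omega> q)"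
    and d: "\<And>v. (\<lambda>q. \<omega> q v) differentiable (at x)" "e differentiable (at x)"
  shows "dd (\<lambda>q. \<omega> q (e q)) x u = dd (\<lambda>q. \<omega> q (e x)) x u + \<omega> x (dd e x u)"
proof -
  have de: "(\<lambda>q. e q \<bullet> b) differentiable (at x)" "dd (\<lambda>q. e q \<bullet> b) x u = dd e x u \<bullet> b" for b
    using bounded_linear.has_derivative[OF bounded_linear_inner_left has_derivative_dd[OF d(2)], of b]
      dd_linear_comp[OF bounded_linear_inner_left d(2), of b u]
    by (auto simp: differentiable_def)
  have "dd (\<lambda>q. \<omega> q (e q)) x u = dd (\<lambda>q. \<Sum>b\<in>Basis. (e q \<bullet> b) *\<^sub>R \<omega> q b) x u"
    using form_eq_sum_Basis[OF lin] by (subst dd_cong_open[OF N]) auto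
  also have "\<dots> = (\<Sum>b\<in>Basis. dd (\<lambda>q. (e q \<bullet> b) *\<^sub>R \<omega> q b) x u)"
    by (rule dd_sum[OF differentiable_bilinear[OF bounded_bilinear_scaleR]]) (rule de d)+
  also have "\<dots> = (\<Sum>b\<in>Basis. (e x \<bullet> b) *\<^sub>R dd (\<lambda>q. \<omega> q b) x u + (dd e x u \<bullet> b) *\<^sub>R \<omega> x b)"
    by (rule sum.cong[OF refl]) (simp add: dd_scaleR de d)
  also have "\<dots> = (\<Sum>b\<in>Basis. (e x \<bullet> b) *\<^sub>R dd (\<lambda>q. \<omega> q b) x u) + \<omega> x (dd e x u)"
    using form_eq_sum_Basis[OF lin[OF N(2)], of "dd e x u"] by (simp add: sum.distrib)
  also have "(\<Sum>b\<in>Basis. (e x \<bullet> b) *\<^sub>R dd (\<lambda>q. \<omega> q b) x u) = dd (\<lambda>q. \<Sum>b\<in>Basis. (e x \<bullet> b) *\<^sub>R \<omega> q b) x u"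
    by (subst dd_sum) (auto simp: dd_scaleR dd_const d intro!: differentiable_bilinear[OF bounded_bilinear_scaleR])
  also have "\<dots> = dd (\<lambda>q. \<omega> q (e x)) x u"
    using form_eq_sum_Basis[OF lin, of _ "e x"] by (subst dd_cong_open[OF N]) auto
  finally show ?thesis .
qed

section \<open>Levi-Civita connection and second fundamental form\<close>

text \<open>The fundamental theorem of pseudo-Riemannian geometry: torsion-freeness and compatibility imply the
  Koszul formula. All Levi-Civita connections below are identified in this way.\<close>

lemma christoffel_eqI:
  fixes g :: "'a::euclidean_space metric"
  assumes lin: "\<And>x. linear (\<lambda>w. g p w x)" and sym: "\<And>u v. g p u v = g p v u"
    and nondegenerate: "\<And>w. (\<And>x. g p w x = 0) \<Longrightarrow> w = 0"
    and torsion_free: "\<And>u v. \<Gamma> u v = \<Gamma> v u"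
    and compatible: "\<And>u v w. dd (\<lambda>q. g q v w) p u = g p (\<Gamma> u v) w + g p v (\<Gamma> u w)"
  shows "christoffel g p u v = \<Gamma> u v"
  unfolding christoffel_def
proof (rule the_equality)
  have K: "dd (\<lambda>q. g q v x) p u + dd (\<lambda>q. g q u x) p v - dd (\<lambda>q. g q u v) p x = 2 * g p (\<Gamma> u v) x" for x
    unfolding compatible using torsion_free[of u v] torsion_free[of x u] torsion_free[of x v]
      sym[of v "\<Gamma> x u"] sym[of u "\<Gamma> x v"] sym[of v "\<Gamma> u x"] by simp
  then show "\<forall>x. 2 * g p (\<Gamma> u v) x = dd (\<lambda>q. g q v x) p u + dd (\<lambda>q. g q u x) p v - dd (\<lambda>q. g q u v) p x"
    by simp
  fix w
  assume w: "\<forall>x. 2 * g p w x = dd (\<lambda>q. g q v x) p u + dd (\<lambda>q. g q u x) p v - dd (\<lambda>q. g q u v) p x"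
  have "w - \<Gamma> u v = 0"
  proof (rule nondegenerate)
    fix x
    have "g p w x = g p (\<Gamma> u v) x" using w[rule_format, of x] K[of x] by linarith
    then show "g p (w - \<Gamma> u v) x = 0" using linear_diff[OF lin, of w "\<Gamma> u v" x] by linarith
  qed
  then show "w = \<Gamma> u v" by simp
qed

text \<open>With respect to a null frame with inner product \<open>-1\<close>, the tangential part of \<open>X\<close> has the component
  \<open>- g(X, e2)\<close> along \<open>e1\<close> and \<open>- g(X, e1)\<close> along \<open>e2\<close>.\<close>

lemma normal_part_null_frame:
  fixes g :: "'b::euclidean_space metric" and f :: "'a::euclidean_space \<Rightarrow> 'b" and x :: 'a
  defines "G \<equiv> g (f x)"
  assumes lin: "\<And>y. linear (\<lambda>z. G z y)" and sym: "\<And>y z. G y z = G z y"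
    and f: "linear (dd f x)" and e: "\<And>v. \<exists>s t. v = s *\<^sub>R e1 + t *\<^sub>R e2"
    and null: "G (dd f x e1) (dd f x e1) = 0" "G (dd f x e2) (dd f x e2) = 0" "G (dd f x e1) (dd f x e2) = -1"
  shows "normal_part g f x X = X + G X (dd f x e2) *\<^sub>R dd f x e1 + G X (dd f x e1) *\<^sub>R dd f x e2"
  unfolding normal_part_def G_def[symmetric]
proof (rule the_equality)
  define a1 a2 where "a1 = dd f x e1" and "a2 = dd f x e2"
  note null' = null[folded a1_def a2_def]
  have null'': "G a2 a1 = -1" using null' sym by metis
  note l = linear_add[OF lin] linear_diff[OF lin] linear_scale[OF lin]
  have lr: "G y (s *\<^sub>R u + t *\<^sub>R v) = s * G y u + t * G y v" for y s t u v
    by (simp add: sym[of y] l)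
  have fe: "\<exists>s t. dd f x v = s *\<^sub>R a1 + t *\<^sub>R a2" for v
  proof -
    obtain s t where v: "v = s *\<^sub>R e1 + t *\<^sub>R e2" using e by blast
    have "dd f x v = s *\<^sub>R a1 + t *\<^sub>R a2" unfolding v by (simp add: linear_add[OF f] linear_scale[OF f] a1_def a2_def)
    then show ?thesis by blast
  qed
  have ef: "s *\<^sub>R a1 + t *\<^sub>R a2 = dd f x (s *\<^sub>R e1 + t *\<^sub>R e2)" for s t
    using f by (simp add: a1_def a2_def linear_add linear_scale)
  have "G (X + G X a2 *\<^sub>R a1 + G X a1 *\<^sub>R a2) (dd f x v) = 0" for v
  proof -
    obtain s t where "dd f x v = s *\<^sub>R a1 + t *\<^sub>R a2" using fe by blast
    then show ?thesis by (simp add: lr l null' null'' algebra_simps)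
  qed
  moreover have "X - (X + G X a2 *\<^sub>R a1 + G X a1 *\<^sub>R a2) = dd f x ((- G X a2) *\<^sub>R e1 + (- G X a1) *\<^sub>R e2)"
    unfolding ef[symmetric] by simp
  ultimately show "(\<forall>v. G (X + G X (dd f x e2) *\<^sub>R dd f x e1 + G X (dd f x e1) *\<^sub>R dd f x e2) (dd f x v) = 0) \<and>
    X - (X + G X (dd f x e2) *\<^sub>R dd f x e1 + G X (dd f x e1) *\<^sub>R dd f x e2) \<in> range (dd f x)"
    unfolding a1_def a2_def by blast
  fix M assume M: "(\<forall>v. G M (dd f x v) = 0) \<and> X - M \<in> range (dd f x)"
  then obtain v where "X - M = dd f x v" by blast
  then obtain s t where st: "X - M = s *\<^sub>R a1 + t *\<^sub>R a2" using fe by metis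
  have "G M a1 = 0" "G M a2 = 0" using M by (auto simp: a1_def a2_def)
  then have "G (X - M) a1 = G X a1" "G (X - M) a2 = G X a2" by (simp_all add: l)
  then have "G X a1 = - t" "G X a2 = - s" unfolding st by (simp_all add: l null' null'')
  then have "M = X + G X a2 *\<^sub>R a1 + G X a1 *\<^sub>R a2" using st by (simp add: algebra_simps)
  then show "M = X + G X (dd f x e2) *\<^sub>R dd f x e1 + G X (dd f x e1) *\<^sub>R dd f x e2"
    unfolding a1_def a2_def .
qed

text \<open>The coframe dual to the frame \<open>a\<close>, \<open>b\<close> of the plane, by Cramer's rule. In this form it depends
  smoothly on the frame by inspection.\<close>

definition coframe1 :: "real^2 \<Rightarrow> real^2 \<Rightarrow> real^2 \<Rightarrow> real" where
  "coframe1 a b v = (v$1 * b$2 - v$2 * b$1) / (a$1 * b$2 - a$2 * b$1)"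

definition coframe2 :: "real^2 \<Rightarrow> real^2 \<Rightarrow> real^2 \<Rightarrow> real" where
  "coframe2 a b v = (a$1 * v$2 - a$2 * v$1) / (a$1 * b$2 - a$2 * b$1)"

lemma coframe_dual:
  assumes "a$1 * b$2 - a$2 * b$1 \<noteq> 0"
  shows "coframe1 a b a = 1" "coframe1 a b b = 0" "coframe2 a b a = 0" "coframe2 a b b = 1"
  using assms by (auto simp: coframe1_def coframe2_def)

lemma coframe_linear: "linear (coframe1 a b)" "linear (coframe2 a b)"
  by (rule linearI; simp add: coframe1_def coframe2_def algebra_simps add_divide_distrib[symmetric] diff_divide_distrib[symmetric])+

lemma coframe_expansion:
  assumes "a$1 * b$2 - a$2 * b$1 \<noteq> 0"
  shows "v = coframe1 a b v *\<^sub>R a + coframe2 a b v *\<^sub>R b"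
proof -
  define d where "d = a$1 * b$2 - a$2 * b$1"
  have "v$i = (v$1 * b$2 - v$2 * b$1) / d * a$i + (a$1 * v$2 - a$2 * v$1) / d * b$i" if "i = 1 \<or> i = 2" for i
  proof -
    have "d * v$i = (v$1 * b$2 - v$2 * b$1) * a$i + (a$1 * v$2 - a$2 * v$1) * b$i"
      using that by (auto simp: d_def algebra_simps)
    moreover have "d \<noteq> 0" using assms by (simp add: d_def)
    ultimately have "v$i = ((v$1 * b$2 - v$2 * b$1) * a$i + (a$1 * v$2 - a$2 * v$1) * b$i) / d"
      by (simp add: eq_divide_eq mult.commute)
    then show ?thesis by (simp add: add_divide_distrib)
  qed
  then show ?thesis
    unfolding vec_eq_iff coframe1_def coframe2_def d_def[symmetric] vector_add_component vector_scaleR_component real_scaleR_def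
    using exhaust_2 by blast
qed

lemma null_frame_det:
  fixes G :: "real^2 \<Rightarrow> real^2 \<Rightarrow> real"
  assumes lin: "\<And>y. linear (\<lambda>z. G z y)" and null: "G a a = 0" "G b b = 0" "G a b = -1" "G b a = -1"
  shows "a$1 * b$2 - a$2 * b$1 \<noteq> 0"
proof
  assume d: "a$1 * b$2 - a$2 * b$1 = 0"
  have 0: "a \<noteq> 0" using null(3) linear_0[OF lin[of b]] by auto
  have "(a$i) *\<^sub>R b - (b$i) *\<^sub>R a = 0" for i
    using d exhaust_2[of i] by (auto simp: vec_eq_iff forall_2 algebra_simps)
  then have "G ((a$i) *\<^sub>R b - (b$i) *\<^sub>R a) a = 0" for i using linear_0[OF lin[of a]] by simp
  then have "a$i = 0" for i by (simp add: linear_diff[OF lin] linear_scale[OF lin] null)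
  then show False using 0 by (simp add: vec_eq_iff)
qed

lemma vec2_expansion: "(v :: real^2) = v$1 *\<^sub>R axis 1 1 + v$2 *\<^sub>R axis 2 1"
  by (simp add: vec_eq_iff forall_2 axis_def)

text \<open>The inverse of the Gram matrix is \<open>- (a b\<^sup>T + b a\<^sup>T)\<close>, so only the mixed values of the second fundamental
  form enter its trace.\<close>

lemma mean_curvature_null_frame:
  fixes g :: "'b::euclidean_space metric" and f :: "real^2 \<Rightarrow> 'b" and x :: "real^2"
  defines "G \<equiv> pullback g f x" and "h \<equiv> second_fundamental_form g f x"
  assumes lin: "\<And>y. linear (\<lambda>z. G z y)" and sym: "\<And>y z. G y z = G z y"
    and null: "G a a = 0" "G b b = 0" "G a b = -1"
    and h: "\<And>u. linear (h u)" "\<And>v. linear (\<lambda>u. h u v)"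
  shows "mean_curvature_vector g f x = - (1/2) *\<^sub>R (h a b + h b a)"
proof -
  define M where "M = gram_matrix (pullback g f) x"
  define W :: "real^2^2" where "W = (\<chi> i j. - (a$i * b$j + b$i * a$j))"
  have null': "G b a = -1" using null sym by metis
  have d: "a$1 * b$2 - a$2 * b$1 \<noteq> 0" by (rule null_frame_det[of G, OF lin null null'])
  note l = linear_add[OF lin] linear_scale[OF lin]
  have lr: "G y (s *\<^sub>R u + t *\<^sub>R v) = s * G y u + t * G y v" for y s t u v
    by (simp add: sym[of y] l)
  have ex: "v$k = - (G v b * a$k + G v a * b$k)" for v k
  proof -
    obtain s t where st: "v = s *\<^sub>R a + t *\<^sub>R b" using coframe_expansion[OF d, of v] by blast
    show ?thesis unfolding st by (simp add: l null null')
  qed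
  have e: "G v u = u$1 * G v (axis 1 1) + u$2 * G v (axis 2 1)" for u v
    using lr vec2_expansion[of u] by metis
  have MW: "M ** W = mat 1"
  proof -
    have "(M ** W) $ i $ k = axis i 1 $ k" for i k
    proof -
      have "(M ** W) $ i $ k = (\<Sum>j\<in>UNIV. G (axis i 1) (axis j 1) * - (a$j * b$k + b$j * a$k))"
        by (simp add: matrix_matrix_mult_def M_def W_def gram_matrix_def G_def)
      also have "\<dots> = - (G (axis i 1) b * a$k + G (axis i 1) a * b$k)"
        unfolding sum_2 e[of "axis i 1" a] e[of "axis i 1" b] by (simp add: algebra_simps)
      also have "\<dots> = axis i 1 $ k" by (rule ex[symmetric])
      finally show ?thesis .
    qed
    then show ?thesis by (auto simp: vec_eq_iff mat_def axis_def)
  qed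
  then have WM: "W ** M = mat 1" using matrix_left_right_inverse by blast
  have "matrix_inv M = W"
    unfolding matrix_inv_def
  proof (rule some_equality)
    show "M ** W = mat 1 \<and> W ** M = mat 1" using MW WM ..
    fix V assume "M ** V = mat 1 \<and> V ** M = mat 1"
    then show "V = W" using MW by (metis matrix_mul_assoc matrix_mul_lid matrix_mul_rid)
  qed
  note hl = linear_add[OF h(1)] linear_scale[OF h(1)] linear_add[OF h(2)] linear_scale[OF h(2)]
  have he: "h u v = u$1 *\<^sub>R (v$1 *\<^sub>R h (axis 1 1) (axis 1 1) + v$2 *\<^sub>R h (axis 1 1) (axis 2 1)) +
      u$2 *\<^sub>R (v$1 *\<^sub>R h (axis 2 1) (axis 1 1) + v$2 *\<^sub>R h (axis 2 1) (axis 2 1))" for u v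
    by (subst vec2_expansion[of u], subst vec2_expansion[of v]) (simp add: hl algebra_simps)
  have "mean_curvature_vector g f x = (1/2) *\<^sub>R (\<Sum>i\<in>UNIV. \<Sum>j\<in>UNIV. W $ i $ j *\<^sub>R h (axis i 1) (axis j 1))"
    using \<open>matrix_inv M = W\<close> by (simp add: mean_curvature_vector_def M_def h_def)
  also have "(\<Sum>i\<in>UNIV. \<Sum>j\<in>UNIV. W $ i $ j *\<^sub>R h (axis i 1) (axis j 1)) = - (h a b + h b a)"
  proof -
    have D: "(- (s + t)) *\<^sub>R P = - (s *\<^sub>R P) - t *\<^sub>R P" for s t and P :: 'b by (simp add: algebra_simps)
    show ?thesis unfolding sum_2 he[of a b] he[of b a] W_def vec_lambda_beta D by (simp add: algebra_simps)
  qed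
  finally show ?thesis by (simp only: scaleR_minus_right scaleR_minus_left)
qed

section \<open>Flat metrics in a null frame\<close>

text \<open>For the dual coframe \<open>\<omega>1\<close>, \<open>\<omega>2\<close> of a null frame \<open>e1\<close>, \<open>e2\<close>, the Levi-Civita connection is
  \<open>\<nabla> e1 = w e1\<close>, \<open>\<nabla> e2 = - w e2\<close> for the one-form \<open>w\<close> determined by the first
  structure equations. The curvature applied to \<open>e1\<close> is the exterior derivative of \<open>w\<close> times \<open>e1\<close>.\<close>

lemma flat_connection_form_closed:
  fixes g :: "'a::euclidean_space metric" and \<omega>1 \<omega>2 w :: "'a \<Rightarrow> 'a \<Rightarrow> real"
  assumes N: "open N" "p \<in> N"
    and sm: "\<And>v. smooth_on N (\<lambda>q. \<omega>1 q v)" "\<And>v. smooth_on N (\<lambda>q. \<omega>2 q v)" "\<And>v. smooth_on N (\<lambda>q. w q v)"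
      "smooth_on N e1" "smooth_on N e2"
    and lin: "\<And>q. q \<in> N \<Longrightarrow> linear (\<omega>1 q)" "\<And>q. q \<in> N \<Longrightarrow> linear (\<omega>2 q)" "\<And>q. q \<in> N \<Longrightarrow> linear (w q)"
    and dual: "\<And>q. q \<in> N \<Longrightarrow> \<omega>1 q (e1 q) = 1 \<and> \<omega>1 q (e2 q) = 0 \<and> \<omega>2 q (e1 q) = 0 \<and> \<omega>2 q (e2 q) = 1"
      "\<And>q v. q \<in> N \<Longrightarrow> v = \<omega>1 q v *\<^sub>R e1 q + \<omega>2 q v *\<^sub>R e2 q"
    and g: "\<And>q u v. q \<in> N \<Longrightarrow> g q u v = - (\<omega>1 q u * \<omega>2 q v + \<omega>2 q u * \<omega>1 q v)"
    and tor1: "\<And>q u v. q \<in> N \<Longrightarrow> dd (\<lambda>y. \<omega>1 y v) q u - dd (\<lambda>y. \<omega>1 y u) q v = - (w q u * \<omega>1 q v - w q v * \<omega>1 q u)"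
    and tor2: "\<And>q u v. q \<in> N \<Longrightarrow> dd (\<lambda>y. \<omega>2 y v) q u - dd (\<lambda>y. \<omega>2 y u) q v = w q u * \<omega>2 q v - w q v * \<omega>2 q u"
    and flat: "\<And>u v z. curvature g p u v z = 0"
  shows "dd (\<lambda>q. w q v) p u = dd (\<lambda>q. w q u) p v"
proof -
  define \<Gamma> where "\<Gamma> q u v = (dd (\<lambda>y. \<omega>1 y v) q u + w q u * \<omega>1 q v) *\<^sub>R e1 q +
      (dd (\<lambda>y. \<omega>2 y v) q u - w q u * \<omega>2 q v) *\<^sub>R e2 q" for q u v
  note df = smooth_on_differentiable[OF sm(1)] smooth_on_differentiable[OF sm(2)] smooth_on_differentiable[OF sm(3)]
    smooth_on_differentiable[OF sm(4)] smooth_on_differentiable[OF sm(5)]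
  have om: "\<omega>1 q (\<Gamma> q u v) = dd (\<lambda>y. \<omega>1 y v) q u + w q u * \<omega>1 q v"
    "\<omega>2 q (\<Gamma> q u v) = dd (\<lambda>y. \<omega>2 y v) q u - w q u * \<omega>2 q v" if "q \<in> N" for q u v
    using dual(1)[OF that] by (simp_all add: \<Gamma>_def linear_add[OF lin(1)[OF that]] linear_add[OF lin(2)[OF that]]
        linear_scale[OF lin(1)[OF that]] linear_scale[OF lin(2)[OF that]])
  have chr: "christoffel g q u v = \<Gamma> q u v" if q: "q \<in> N" for q u v
  proof (rule christoffel_eqI)
    note l = linear_add[OF lin(1)[OF q]] linear_add[OF lin(2)[OF q]] linear_scale[OF lin(1)[OF q]] linear_scale[OF lin(2)[OF q]]
    show "linear (\<lambda>z. g q z y)" for y by (rule linearI) (simp_all add: g[OF q] l algebra_simps)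
    show "g q u v = g q v u" for u v by (simp add: g[OF q])
    show "z = 0" if "\<And>y. g q z y = 0" for z
    proof -
      have "\<omega>1 q z = 0" "\<omega>2 q z = 0" using that[of "e1 q"] that[of "e2 q"] dual(1)[OF q] by (auto simp: g[OF q])
      then show ?thesis using dual(2)[OF q, of z] by simp
    qed
    show "\<Gamma> q u v = \<Gamma> q v u" for u v
    proof -
      have "dd (\<lambda>y. \<omega>1 y v) q u + w q u * \<omega>1 q v = dd (\<lambda>y. \<omega>1 y u) q v + w q v * \<omega>1 q u"
        "dd (\<lambda>y. \<omega>2 y v) q u - w q u * \<omega>2 q v = dd (\<lambda>y. \<omega>2 y u) q v - w q v * \<omega>2 q u"
        using tor1[OF q, of v u] tor2[OF q, of v u] by linarith+
      then show ?thesis by (simp add: \<Gamma>_def)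
    qed
    fix u v z
    have "dd (\<lambda>y. g y v z) q u = dd (\<lambda>y. - (\<omega>1 y v * \<omega>2 y z + \<omega>2 y v * \<omega>1 y z)) q u"
      by (subst dd_cong_open[OF N(1) q]) (auto simp: g)
    also have "\<dots> = - (\<omega>1 q v * dd (\<lambda>y. \<omega>2 y z) q u + dd (\<lambda>y. \<omega>1 y v) q u * \<omega>2 q z +
        (\<omega>2 q v * dd (\<lambda>y. \<omega>1 y z) q u + dd (\<lambda>y. \<omega>2 y v) q u * \<omega>1 q z))"
      using q by (simp add: dd_minus dd_diff dd_mult df differentiable_bilinear[OF bounded_bilinear_mult] differentiable_minus algebra_simps)
    also have "\<dots> = g q (\<Gamma> q u v) z + g q v (\<Gamma> q u z)"
      by (simp add: g[OF q] om[OF q] algebra_simps)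
    finally show "dd (\<lambda>y. g y v z) q u = g q (\<Gamma> q u v) z + g q v (\<Gamma> q u z)" .
  qed
  define z where "z = e1 p"
  \<comment> \<open>The derivatives of the frame cancel in the \<open>e1\<close>-component, since those of \<open>\<omega>1 (e1) = 1\<close> and \<open>\<omega>1 (e2) = 0\<close> vanish.\<close>
  have A: "\<omega>1 p (dd (\<lambda>q. christoffel g q v z) p u + christoffel g p u (christoffel g p v z)) =
     dd (\<lambda>q. dd (\<lambda>y. \<omega>1 y z) q v) p u + dd (\<lambda>q. w q v) p u + w p v * dd (\<lambda>y. \<omega>1 y z) p u
       + w p u * dd (\<lambda>y. \<omega>1 y z) p v + w p u * w p v" for u v
  proof -
    note l = linear_add[OF lin(1)[OF N(2)]] linear_scale[OF lin(1)[OF N(2)]]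
    define c1 where "c1 q = dd (\<lambda>y. \<omega>1 y z) q v + w q v * \<omega>1 q z" for q
    define c2 where "c2 q = dd (\<lambda>y. \<omega>2 y z) q v - w q v * \<omega>2 q z" for q
    have sc: "smooth_on N c1" "smooth_on N c2"
      unfolding c1_def c2_def by (intro smooth_on_add smooth_on_diff smooth_on_mult smooth_on_dd sm N)+
    note dc = smooth_on_differentiable[OF sc(1) N(2)] smooth_on_differentiable[OF sc(2) N(2)]
    have "dd (\<lambda>q. christoffel g q v z) p u = dd (\<lambda>q. c1 q *\<^sub>R e1 q + c2 q *\<^sub>R e2 q) p u"
      by (subst dd_cong_open[OF N]) (auto simp: chr \<Gamma>_def c1_def c2_def)
    also have "\<dots> = c1 p *\<^sub>R dd e1 p u + dd c1 p u *\<^sub>R e1 p + (c2 p *\<^sub>R dd e2 p u + dd c2 p u *\<^sub>R e2 p)"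
      using N by (simp add: dd_add dd_scaleR df dc differentiable_bilinear[OF bounded_bilinear_scaleR])
    finally have 1: "\<omega>1 p (dd (\<lambda>q. christoffel g q v z) p u) = c1 p * \<omega>1 p (dd e1 p u) + dd c1 p u + c2 p * \<omega>1 p (dd e2 p u)"
      using dual(1)[OF N(2)] by (simp add: l)
    have apply_frame: "dd (\<lambda>q. \<omega>1 q (e p)) p u + \<omega>1 p (dd e p u) = 0"
      if "smooth_on N e" "\<And>q. q \<in> N \<Longrightarrow> \<omega>1 q (e q) = k" for e k
    proof -
      have "dd (\<lambda>q. \<omega>1 q (e q)) p u = dd (\<lambda>q. k) p u" using that by (subst dd_cong_open[OF N]) auto
      then show ?thesis
        using dd_form_apply[OF N lin(1) df(1)[OF N(2)] smooth_on_differentiable[OF that(1) N(2)]] by (simp add: dd_const)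
    qed
    have e1': "dd (\<lambda>q. \<omega>1 q (e1 p)) p u = - \<omega>1 p (dd e1 p u)"
      using apply_frame[OF sm(4), of 1] dual(1) by (simp add: add_eq_0_iff2)
    have e2': "dd (\<lambda>q. \<omega>1 q (e2 p)) p u = - \<omega>1 p (dd e2 p u)"
      using apply_frame[OF sm(5), of 0] dual(1) by (simp add: add_eq_0_iff2)
    have y: "christoffel g p v z = c1 p *\<^sub>R e1 p + c2 p *\<^sub>R e2 p"
      using N by (simp add: chr \<Gamma>_def c1_def c2_def)
    have "dd (\<lambda>q. \<omega>1 q (c1 p *\<^sub>R e1 p + c2 p *\<^sub>R e2 p)) p u =
        dd (\<lambda>q. c1 p * \<omega>1 q (e1 p) + c2 p * \<omega>1 q (e2 p)) p u"
      using lin(1) by (subst dd_cong_open[OF N]) (auto simp: linear_add linear_scale)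
    also have "\<dots> = c1 p * dd (\<lambda>q. \<omega>1 q (e1 p)) p u + c2 p * dd (\<lambda>q. \<omega>1 q (e2 p)) p u"
      using N by (simp add: dd_add dd_mult dd_const df differentiable_bilinear[OF bounded_bilinear_mult])
    finally have 2: "\<omega>1 p (christoffel g p u (christoffel g p v z)) =
      - c1 p * \<omega>1 p (dd e1 p u) - c2 p * \<omega>1 p (dd e2 p u) + w p u * c1 p"
      using dual(1)[OF N(2)] unfolding y using N by (simp add: chr om e1' e2' l)
    have 3: "dd c1 p u = dd (\<lambda>q. dd (\<lambda>y. \<omega>1 y z) q v) p u + (w p v * dd (\<lambda>y. \<omega>1 y z) p u + dd (\<lambda>q. w q v) p u * \<omega>1 p z)"
      unfolding c1_def using N
      by (simp add: dd_add dd_mult df smooth_on_differentiable[OF smooth_on_dd[OF sm(1)]] differentiable_bilinear[OF bounded_bilinear_mult])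
    have "\<omega>1 p z = 1" using dual(1)[OF N(2)] by (simp add: z_def)
    then show ?thesis unfolding l 1 2 3 by (simp add: c1_def algebra_simps)
  qed
  have "\<omega>1 p (curvature g p u v z) = 0" using linear_0[OF lin(1)[OF N(2)]] flat by simp
  moreover have "curvature g p u v z = (dd (\<lambda>q. christoffel g q v z) p u + christoffel g p u (christoffel g p v z)) -
     (dd (\<lambda>q. christoffel g q u z) p v + christoffel g p v (christoffel g p u z))"
    by (simp add: curvature_def)
  ultimately have "\<omega>1 p (dd (\<lambda>q. christoffel g q v z) p u + christoffel g p u (christoffel g p v z)) =
     \<omega>1 p (dd (\<lambda>q. christoffel g q u z) p v + christoffel g p v (christoffel g p u z))"
    using linear_diff[OF lin(1)[OF N(2)]] by simp
  then show ?thesis unfolding A using dd_commute[OF sm(1) N, of z u v] by simp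
qed

section \<open>The hermitian form and horizontal vectors\<close>

lemma bform_add_right: "bform z (v + w) = bform z v + bform z w"
  and bform_add_left: "bform (v + w) z = bform v z + bform w z"
  and bform_minus_right: "bform z (v - w) = bform z v - bform z w"
  and bform_minus_left: "bform (v - w) z = bform v z - bform w z"
  and bform_uminus_right: "bform z (- v) = - bform z v"
  and bform_uminus_left: "bform (- v) z = - bform v z"
  and bform_scale_right: "bform z (c *s v) = c * bform z v"
  and bform_scale_left: "bform (c *s v) z = cnj c * bform v z"
  and bform_zero: "bform z 0 = 0" "bform 0 z = 0"
  by (simp_all add: bform_def algebra_simps)

lemma scaleR_eq_smult: "r *\<^sub>R (v :: complex^'n) = complex_of_real r *s v"
  by (simp add: vec_eq_iff complex_eq_iff)

lemma bform_scaleR_right: "bform z (r *\<^sub>R v) = r * bform z v"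
  and bform_scaleR_left: "bform (r *\<^sub>R v) z = r * bform v z"
  by (simp_all add: scaleR_eq_smult bform_scale_right bform_scale_left)

lemmas bform_simps = bform_add_right bform_add_left bform_minus_right bform_minus_left bform_uminus_right
  bform_uminus_left bform_scale_right bform_scale_left bform_scaleR_right bform_scaleR_left bform_zero

lemma bform_cnj: "cnj (bform v w) = bform w v"
  by (simp add: bform_def mult.commute)

lemma bform_self_real: "bform z z = complex_of_real (Re (bform z z))"
  by (simp add: bform_def complex_eq_iff)

lemma bform_nondegenerate: assumes "\<And>w. bform v w = 0" shows "v = 0"
  using assms[of "axis 1 1"] assms[of "axis 2 1"] assms[of "axis 3 1"]
  by (simp add: bform_def axis_def vec_eq_iff forall_3)

lemma bounded_bilinear_bform: "bounded_bilinear bform"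
  unfolding bilinear_conv_bounded_bilinear[symmetric] bilinear_def
  by (intro conjI allI linearI) (simp_all only: bform_simps scaleR_conv_of_real[where 'a = complex])

lemmas has_derivative_bform = bounded_bilinear.FDERIV[OF bounded_bilinear_bform]
lemmas smooth_on_bform = smooth_on_bilinear[OF bounded_bilinear_bform]
lemmas dd_bform = dd_bilinear[OF bounded_bilinear_bform]

lemma bounded_bilinear_smult: "bounded_bilinear ((*s) :: complex \<Rightarrow> complex^'n \<Rightarrow> complex^'n)"
  unfolding bilinear_conv_bounded_bilinear[symmetric] bilinear_def
  by (intro conjI allI linearI)
    (simp_all add: vec_eq_iff algebra_simps)

lemmas smooth_on_smult = smooth_on_bilinear[OF bounded_bilinear_smult]
lemmas dd_smult = dd_bilinear[OF bounded_bilinear_smult]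

definition hor :: "complex^3 \<Rightarrow> complex^3 \<Rightarrow> complex^3" where
  "hor Z X = X - (bform Z X / bform Z Z) *s Z"

lemma hor_add: "hor Z (X + Y) = hor Z X + hor Z Y"
  and hor_smult: "hor Z (c *s X) = c *s hor Z X"
  by (simp_all add: hor_def bform_simps vec_eq_iff algebra_simps add_divide_distrib)

lemma hor_scaleR: "hor Z (r *\<^sub>R X) = r *\<^sub>R hor Z X"
  by (simp add: scaleR_eq_smult hor_smult)

lemma hor_diff: "hor Z (X - Y) = hor Z X - hor Z Y"
  by (simp add: hor_def bform_simps vec_eq_iff algebra_simps diff_divide_distrib)

lemma bform_hor: assumes "bform Z Z \<noteq> 0" shows "bform Z (hor Z X) = 0" "bform (hor Z X) Z = 0"
proof -
  show "bform Z (hor Z X) = 0" using assms by (simp add: hor_def bform_simps)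
  then show "bform (hor Z X) Z = 0" by (metis bform_cnj complex_cnj_zero)
qed

lemma bform_hor_hor:
  assumes "bform Z Z \<noteq> 0"
  shows "bform (hor Z X) (hor Z Y) = bform X Y - bform X Z * bform Z Y / bform Z Z"
proof -
  have "bform (hor Z X) (hor Z Y) = bform X (hor Z Y)"
    using bform_hor[OF assms] by (subst (1) hor_def) (simp add: bform_simps)
  then show ?thesis by (simp add: hor_def bform_simps)
qed

section \<open>The Kaehler metric in an affine chart\<close>

text \<open>The linear part of the affine map \<open>ch_lift k\<close>.\<close>

definition ch_lin :: "3 \<Rightarrow> complex^2 \<Rightarrow> complex^3" where
  "ch_lin k u = (\<chi> i. if i = k then 0 else if i = k + 1 then u$1 else u$2)"

lemma ch_lift_eq: "ch_lift k w = axis k 1 + ch_lin k w"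
  by (auto simp: ch_lift_def ch_lin_def axis_def vec_eq_iff)

lemma ch_lin_eq_diff: "ch_lift k u - axis k 1 = ch_lin k u"
  by (simp add: ch_lift_eq)

lemma ch_lin_add: "ch_lin k (u + v) = ch_lin k u + ch_lin k v"
  and ch_lin_smult: "ch_lin k (c *s u) = c *s ch_lin k u"
  and ch_lin_diff: "ch_lin k (u - v) = ch_lin k u - ch_lin k v"
  and ch_lin_comp: "ch_lin k u $ k = 0"
  by (auto simp: ch_lin_def vec_eq_iff)

lemma ch_lin_scaleR: "ch_lin k (r *\<^sub>R u) = r *\<^sub>R ch_lin k u"
  by (simp add: scaleR_eq_smult ch_lin_smult)

lemma bounded_linear_ch_lin: "bounded_linear (ch_lin k)"
  unfolding linear_conv_bounded_linear[symmetric] by (rule linearI) (simp_all add: ch_lin_add ch_lin_scaleR)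

lemma ch_lin_eq_0D: assumes "ch_lin k u = 0" shows "u = 0"
proof -
  have "ch_lin k u $ (k+1) = u$1" "ch_lin k u $ (k+2) = u$2" using mod3[of k] by (auto simp: ch_lin_def)
  then show ?thesis using assms by (simp add: vec_eq_iff forall_2)
qed

lemma ch_lin_surj: assumes "X $ k = 0" shows "\<exists>u. X = ch_lin k u"
proof
  have "X $ i = ch_lin k (vector [X $ (k+1), X $ (k+2)]) $ i" for i
    using ex3[of i k]
  proof (elim disjE)
    assume i: "i = k" show ?thesis unfolding i ch_lin_def by (simp only: vec_lambda_beta if_True refl assms)
  next
    assume i: "i = k + 1"
    have ne: "(k + 1 = k) = False" using mod3[of k] by blast
    show ?thesis unfolding i ch_lin_def by (simp only: ne vec_lambda_beta if_False if_True refl vector_2)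
  next
    assume i: "i = k + 2" 
    have ne: "(k + 2 = k) = False" "(k + 2 = k + 1) = False" using mod3[of k] by blast+
    show ?thesis unfolding i ch_lin_def by (simp only: ne vec_lambda_beta if_False vector_2)
  qed
  then show "X = ch_lin k (vector [X $ (k+1), X $ (k+2)])" unfolding vec_eq_iff by blast
qed

lemma ch_lift_comp: "ch_lift k w $ k = 1"
  by (simp add: ch_lift_def)

lemma has_derivative_ch_lift: "(ch_lift k has_derivative ch_lin k) (at w)"
  unfolding ch_lift_eq[abs_def] 
  using has_derivative_add[OF has_derivative_const bounded_linear.has_derivative[OF bounded_linear_ch_lin has_derivative_ident]]
  by simp

definition ch_range :: "3 \<Rightarrow> (complex^2) set" where
  "ch_range k = {w. Re (bform (ch_lift k w) (ch_lift k w)) < 0}"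

lemma open_ch_range: "open (ch_range k)"
proof -
  have "continuous_on UNIV (ch_lift k)"
    by (intro continuous_at_imp_continuous_on ballI has_derivative_continuous[OF has_derivative_ch_lift])
  then have "continuous_on UNIV (\<lambda>w. Re (bform (ch_lift k w) (ch_lift k w)))"
    by (intro continuous_on_Re bounded_bilinear.continuous_on[OF bounded_bilinear_bform])
  then show ?thesis unfolding ch_range_def by (intro open_Collect_less continuous_on_const)
qed

lemma lifted_eq_hor: "lifted k w u = hor (ch_lift k w) (ch_lin k u)"
  by (simp add: lifted_def hor_def Let_def ch_lin_eq_diff)

lemma lifted_add: "lifted k w (u + v) = lifted k w u + lifted k w v"
  and lifted_smult: "lifted k w (c *s u) = c *s lifted k w u"
  and lifted_scaleR: "lifted k w (r *\<^sub>R u) = r *\<^sub>R lifted k w u"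
  and lifted_diff: "lifted k w (u - v) = lifted k w u - lifted k w v"
  by (simp_all only: lifted_eq_hor ch_lin_add ch_lin_smult ch_lin_scaleR ch_lin_diff hor_add hor_smult hor_scaleR hor_diff)

text \<open>The hermitian metric. Its real part is the pseudo-Riemannian metric, and its imaginary part is
  the product of \<open>J u\<close> and \<open>v\<close>.\<close>

definition ch_herm :: "3 \<Rightarrow> complex^2 \<Rightarrow> complex^2 \<Rightarrow> complex^2 \<Rightarrow> complex" where
  "ch_herm k w u v = bform (lifted k w u) (lifted k w v) / - bform (ch_lift k w) (ch_lift k w)"

lemma ch_metric_eq_Re_herm: assumes "w \<in> ch_range k" shows "ch_metric k w u v = Re (ch_herm k w u v)"
proof -
  have "Re (bform (ch_lift k w) (ch_lift k w)) < 0" using assms by (simp add: ch_range_def)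
  note eq = ch_metric_eq[OF this, of u v]
  have "Re (X / - bform Z Z) = Re X / - Re (bform Z Z)" for X Z
  proof -
    have "X / - bform Z Z = X / complex_of_real (- Re (bform Z Z))" using bform_self_real[of Z] by simp
    then show ?thesis by (simp only: Re_divide_of_real)
  qed
  then show ?thesis unfolding eq ch_herm_def by simp
qed

lemma ch_herm_simps:
  "ch_herm k w (u + v) x = ch_herm k w u x + ch_herm k w v x"
  "ch_herm k w x (u + v) = ch_herm k w x u + ch_herm k w x v"
  "ch_herm k w (u - v) x = ch_herm k w u x - ch_herm k w v x"
  "ch_herm k w x (u - v) = ch_herm k w x u - ch_herm k w x v"
  "ch_herm k w (c *s u) x = cnj c * ch_herm k w u x"
  "ch_herm k w x (c *s u) = c * ch_herm k w x u"
  "ch_herm k w (r *\<^sub>R u) x = r * ch_herm k w u x"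
  "ch_herm k w x (r *\<^sub>R u) = r * ch_herm k w x u"
  unfolding ch_herm_def lifted_add lifted_diff lifted_smult lifted_scaleR bform_simps
  by (simp_all only: add_divide_distrib diff_divide_distrib times_divide_eq_right)

lemma ch_herm_cnj: "cnj (ch_herm k w u v) = ch_herm k w v u"
  by (simp add: ch_herm_def bform_cnj)

lemma ch_range_nonzero: "w \<in> ch_range k \<Longrightarrow> bform (ch_lift k w) (ch_lift k w) \<noteq> 0"
  by (auto simp: ch_range_def)

lemma ch_metric_linear: "w \<in> ch_range k \<Longrightarrow> linear (\<lambda>u. ch_metric k w u v)"
  by (rule linearI) (simp_all add: ch_metric_eq_Re_herm ch_herm_simps)

lemma ch_metric_sym: assumes "w \<in> ch_range k" shows "ch_metric k w u v = ch_metric k w v u"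
  using arg_cong[OF ch_herm_cnj[of k w u v], of Re] by (simp add: ch_metric_eq_Re_herm[OF assms])

text \<open>As the kernel of the metric is complex, a vector in it is orthogonal to all horizontal
  vectors, hence to everything.\<close>

lemma ch_metric_nondegenerate:
  assumes w: "w \<in> ch_range k" and 0: "\<And>v. ch_metric k w u v = 0"
  shows "u = 0"
proof -
  note n = ch_range_nonzero[OF w]
  have "ch_herm k w u v = 0" for v
    using 0[of v] 0[of "\<i> *s v"] by (simp add: ch_metric_eq_Re_herm[OF w] ch_herm_simps complex_eq_iff)
  then have *: "bform (lifted k w u) (lifted k w v) = 0" for v using n by (simp add: ch_herm_def)
  have Z: "bform (lifted k w u) (ch_lift k w) = 0" by (simp add: lifted_eq_hor bform_hor[OF n])
  have lin: "bform (lifted k w u) (ch_lin k v) = 0" for v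
  proof -
    have "ch_lin k v = lifted k w v + (bform (ch_lift k w) (ch_lin k v) / bform (ch_lift k w) (ch_lift k w)) *s ch_lift k w"
      by (simp add: lifted_eq_hor hor_def)
    then show ?thesis using * Z by (metis add_0 bform_add_right bform_scale_right mult_zero_right)
  qed
  have "bform (lifted k w u) X = 0" for X
  proof -
    have "(X - (X$k) *s ch_lift k w) $ k = 0" by (simp add: ch_lift_comp)
    then obtain v where "X - (X$k) *s ch_lift k w = ch_lin k v" using ch_lin_surj by blast
    then have "X = ch_lin k v + (X$k) *s ch_lift k w" by (simp add: algebra_simps)
    then show ?thesis using lin Z by (metis add_0 bform_add_right bform_scale_right mult_zero_right)
  qed
  then have "lifted k w u = 0" by (rule bform_nondegenerate)
  then obtain c where c: "ch_lin k u = c *s ch_lift k w"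
    by (auto simp: lifted_eq_hor hor_def)
  then have "ch_lin k u $ k = c" by (simp add: ch_lift_comp)
  then have "c = 0" by (simp only: ch_lin_comp)
  then have "ch_lin k u = 0" using c by (simp only: vector_smult_lzero)
  then show ?thesis by (rule ch_lin_eq_0D)
qed

text \<open>The Levi-Civita connection of a Kaehler metric is complex bilinear on holomorphic coordinate
  fields. For the potential \<open>- ln (- bform Z Z)\<close> it has the following form.\<close>

lemma christoffel_ch_metric:
  assumes w: "w \<in> ch_range k"
  defines "Z \<equiv> ch_lift k w"
  shows "christoffel (ch_metric k) w u v =
    - ((bform Z (ch_lin k u) / bform Z Z) *s v) - (bform Z (ch_lin k v) / bform Z Z) *s u"
proof (rule christoffel_eqI[where g = "ch_metric k" and p = w and \<Gamma> = "\<lambda>u v.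
    - ((bform Z (ch_lin k u) / bform Z Z) *s v) - (bform Z (ch_lin k v) / bform Z Z) *s u"])
  show "linear (\<lambda>u. ch_metric k w u v)" for v by (rule ch_metric_linear[OF w])
  show "ch_metric k w u v = ch_metric k w v u" for u v by (rule ch_metric_sym[OF w])
  show "u = 0" if "\<And>v. ch_metric k w u v = 0" for u by (rule ch_metric_nondegenerate[OF w that])
  define n where "n = bform Z Z"
  have n: "n \<noteq> 0" using ch_range_nonzero[OF w] by (simp add: n_def Z_def)
  have cn: "cnj n = n" by (simp add: n_def bform_cnj)
  have herm: "ch_herm k q u v = (bform (ch_lin k u) (ch_lin k v) -
      bform (ch_lin k u) (ch_lift k q) * bform (ch_lift k q) (ch_lin k v) / bform (ch_lift k q) (ch_lift k q)) /
      - bform (ch_lift k q) (ch_lift k q)" if "q \<in> ch_range k" for q u v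
    unfolding ch_herm_def lifted_eq_hor bform_hor_hor[OF ch_range_nonzero[OF that]] ..
  fix u v x
  let ?U = "ch_lin k u" and ?V = "ch_lin k v" and ?X = "ch_lin k x"
  let ?G = "\<lambda>u v. - ((bform Z (ch_lin k u) / bform Z Z) *s v) - (bform Z (ch_lin k v) / bform Z Z) *s u"
  show "?G u v = ?G v u" by simp
  have d: "((\<lambda>q. bform (ch_lift k q) (ch_lift k q)) has_derivative (\<lambda>u. bform Z (ch_lin k u) + bform (ch_lin k u) Z)) (at w)"
    "((\<lambda>q. bform ?V (ch_lift k q)) has_derivative (\<lambda>u. bform ?V (ch_lin k u))) (at w)"
    "((\<lambda>q. bform (ch_lift k q) ?X) has_derivative (\<lambda>u. bform (ch_lin k u) ?X)) (at w)"
    unfolding Z_def using has_derivative_bform[OF has_derivative_ch_lift has_derivative_ch_lift]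
      has_derivative_bform[OF has_derivative_const has_derivative_ch_lift]
      has_derivative_bform[OF has_derivative_ch_lift has_derivative_const] by (simp_all add: bform_simps)
  have "((\<lambda>q. (bform ?V ?X - bform ?V (ch_lift k q) * bform (ch_lift k q) ?X / bform (ch_lift k q) (ch_lift k q)) /
      - bform (ch_lift k q) (ch_lift k q)) has_derivative
     (\<lambda>u. ((bform ?V (ch_lin k u) * bform Z ?X + bform ?V Z * bform (ch_lin k u) ?X) / n
        - bform ?V Z * bform Z ?X * (bform Z (ch_lin k u) + bform (ch_lin k u) Z) / (n * n)) / n
        + (bform ?V ?X - bform ?V Z * bform Z ?X / n) * (bform Z (ch_lin k u) + bform (ch_lin k u) Z) / (n * n))) (at w)"
  proof -
    have "bform (ch_lift k w) (ch_lift k w) \<noteq> 0" using ch_range_nonzero[OF w] .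
    note 1 = has_derivative_divide'[OF has_derivative_mult[OF d(2,3)] d(1) this]
    have "- bform (ch_lift k w) (ch_lift k w) \<noteq> 0" using ch_range_nonzero[OF w] by simp
    note 2 = has_derivative_divide'[OF has_derivative_diff[OF has_derivative_const 1] has_derivative_minus[OF d(1)] this]
    show ?thesis
      by (rule has_derivative_eq_rhs[OF 2]) (use n in \<open>simp add: fun_eq_iff field_simps flip: Z_def n_def\<close>)
  qed
  then have "((\<lambda>q. ch_herm k q v x) has_derivative
     (\<lambda>u. ((bform ?V (ch_lin k u) * bform Z ?X + bform ?V Z * bform (ch_lin k u) ?X) / n
        - bform ?V Z * bform Z ?X * (bform Z (ch_lin k u) + bform (ch_lin k u) Z) / (n * n)) / n
        + (bform ?V ?X - bform ?V Z * bform Z ?X / n) * (bform Z (ch_lin k u) + bform (ch_lin k u) Z) / (n * n))) (at w)"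
    using herm by (subst has_derivative_cong_open[OF open_ch_range w]) auto
  from dd_eqI[OF bounded_linear.has_derivative[OF bounded_linear_Re this], of u]
  have "dd (\<lambda>q. Re (ch_herm k q v x)) w u = Re (((bform ?V ?U * bform Z ?X + bform ?V Z * bform ?U ?X) / n
        - bform ?V Z * bform Z ?X * (bform Z ?U + bform ?U Z) / (n * n)) / n
        + (bform ?V ?X - bform ?V Z * bform Z ?X / n) * (bform Z ?U + bform ?U Z) / (n * n))" .
  also have "((bform ?V ?U * bform Z ?X + bform ?V Z * bform ?U ?X) / n
        - bform ?V Z * bform Z ?X * (bform Z ?U + bform ?U Z) / (n * n)) / n
        + (bform ?V ?X - bform ?V Z * bform Z ?X / n) * (bform Z ?U + bform ?U Z) / (n * n)
     = ch_herm k w (?G u v) x + ch_herm k w v (?G u x)"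
  proof -
    \<comment> \<open>Both sides are rational functions of these products and of \<open>n\<close>.\<close>
    define p p' a a' c c' where "p = bform Z ?U" and "p' = bform ?U Z" and "a = bform Z ?V" and "a' = bform ?V Z"
      and "c = bform Z ?X" and "c' = bform ?X Z"
    have cnjs: "cnj p = p'" "cnj a = a'" by (simp_all add: p_def p'_def a_def a'_def bform_cnj)
    have G: "?G u v = (- (p / n)) *s v + (- (a / n)) *s u" "?G u x = (- (p / n)) *s x + (- (c / n)) *s u"
      by (simp_all add: p_def a_def c_def n_def vec_eq_iff)
    have H: "ch_herm k w (?G u v) x + ch_herm k w v (?G u x) =
        - (p' / n) * ch_herm k w v x - a' / n * ch_herm k w u x - p / n * ch_herm k w v x - c / n * ch_herm k w v u"
      unfolding G ch_herm_simps by (simp add: cnjs cn)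
    show ?thesis unfolding H unfolding herm[OF w] Z_def[symmetric] n_def[symmetric]
      unfolding p_def[symmetric] p'_def[symmetric] a_def[symmetric] a'_def[symmetric] c_def[symmetric]
      using n by (simp add: field_simps)
  qed
  also have "Re \<dots> = ch_metric k w (?G u v) x + ch_metric k w v (?G u x)"
    by (simp only: ch_metric_eq_Re_herm[OF w] plus_complex.sel)
  finally show "dd (\<lambda>q. ch_metric k q v x) w u = ch_metric k w (?G u v) x + ch_metric k w v (?G u x)"
    by (subst dd_cong_open[OF open_ch_range w, of _ "\<lambda>q. Re (ch_herm k q v x)"]) (auto simp: ch_metric_eq_Re_herm)
qed

section \<open>Minimal slant surfaces in terms of a lift\<close>

lemma smooth_on_form_apply:
  fixes \<omega> :: "'c::real_normed_vector \<Rightarrow> 'a::euclidean_space \<Rightarrow> 'b::real_normed_vector"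
  assumes N: "open N" and lin: "\<And>q. q \<in> N \<Longrightarrow> linear (\<omega> q)"
    and d: "\<And>v. smooth_on N (\<lambda>q. \<omega> q v)" "smooth_on N e"
  shows "smooth_on N (\<lambda>q. \<omega> q (e q))"
proof -
  have "smooth_on N (\<lambda>q. \<Sum>b\<in>Basis. (e q \<bullet> b) *\<^sub>R \<omega> q b)"
    using d unfolding smooth_on_def
    by (intro allI Ck_on_sum[OF N] Ck_on_bilinear[OF bounded_bilinear_scaleR N] Ck_on_linear[OF bounded_linear_inner_left N]) auto
  moreover have "\<omega> q (e q) = (\<Sum>b\<in>Basis. (e q \<bullet> b) *\<^sub>R \<omega> q b)" if "q \<in> N" for q
    by (rule form_eq_sum_Basis[OF lin[OF that]])
  ultimately show ?thesis using smooth_on_cong[OF N, of "\<lambda>q. \<omega> q (e q)"] by simp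
qed

text \<open>The coordinate expression of a surface in one affine chart. The lift \<open>Z\<close> through the chart is
  not normalized to \<open>bform Z Z = -1\<close>; so it is holomorphic in the chart coordinates.\<close>

locale chart_surface =
  fixes k :: 3 and f :: "real^2 \<Rightarrow> complex^2" and N :: "(real^2) set"
  assumes open_N: "open N" and smooth_f: "smooth_on N f" and range_f: "\<And>x. x \<in> N \<Longrightarrow> f x \<in> ch_range k"
begin

abbreviation Z :: "real^2 \<Rightarrow> complex^3" where "Z x \<equiv> ch_lift k (f x)"
abbreviation G :: "real^2 \<Rightarrow> real^2 \<Rightarrow> real^2 \<Rightarrow> real" where "G \<equiv> pullback (ch_metric k) f"

lemma smooth_Z: "smooth_on N Z"
  unfolding ch_lift_eq by (intro smooth_on_add smooth_on_const smooth_on_linear[OF bounded_linear_ch_lin] open_N smooth_f)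

lemma dd_Z: "x \<in> N \<Longrightarrow> dd Z x v = ch_lin k (dd f x v)"
  using dd_eqI[OF has_derivative_compose[OF smooth_on_has_derivative[OF smooth_f] has_derivative_ch_lift]] .

lemma dd_dd_Z: assumes "x \<in> N" shows "dd (\<lambda>y. dd Z y v) x u = ch_lin k (dd (\<lambda>y. dd f y v) x u)"
proof -
  have "dd (\<lambda>y. dd Z y v) x u = dd (\<lambda>y. ch_lin k (dd f y v)) x u"
    by (subst dd_cong_open[OF open_N assms]) (auto simp: dd_Z)
  then show ?thesis
    using dd_linear_comp[OF bounded_linear_ch_lin smooth_on_differentiable[OF smooth_on_dd[OF smooth_f] assms]] by simp
qed

lemma lifted_dd: "x \<in> N \<Longrightarrow> lifted k (f x) (dd f x v) = hor (Z x) (dd Z x v)"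
  by (simp add: lifted_eq_hor dd_Z)

lemma norm_Z: "x \<in> N \<Longrightarrow> Re (bform (Z x) (Z x)) < 0"
  using range_f by (simp add: ch_range_def)

lemma pullback_eq: "x \<in> N \<Longrightarrow> G x u v = Re (bform (hor (Z x) (dd Z x u)) (hor (Z x) (dd Z x v)) / - bform (Z x) (Z x))"
  by (simp add: pullback_def ch_metric_eq_Re_herm[OF range_f] ch_herm_def lifted_dd)

lemma linear_dd_f: "x \<in> N \<Longrightarrow> linear (dd f x)"
  by (rule linear_dd[OF smooth_on_differentiable[OF smooth_f]])

lemma pullback_linear: "x \<in> N \<Longrightarrow> linear (\<lambda>u. G x u v)"
  using linear_compose[OF linear_dd_f ch_metric_linear[OF range_f]] by (simp add: pullback_def o_def)

lemma pullback_sym: "x \<in> N \<Longrightarrow> G x u v = G x v u"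
  by (simp add: pullback_def ch_metric_sym[OF range_f])

lemma ambient_derivative_eq:
  "x \<in> N \<Longrightarrow> ambient_derivative (ch_metric k) f x u v = dd (\<lambda>y. dd f y v) x u
     - (bform (Z x) (dd Z x u) / bform (Z x) (Z x)) *s dd f x v - (bform (Z x) (dd Z x v) / bform (Z x) (Z x)) *s dd f x u"
  by (simp add: ambient_derivative_def christoffel_ch_metric[OF range_f] dd_Z)

text \<open>The covariant derivative lifts to the horizontal part of the second derivative of \<open>Z\<close>, up to terms
  that account for the vertical parts of the first derivatives.\<close>

lemma lifted_ambient_derivative:
  assumes x: "x \<in> N"
  shows "lifted k (f x) (ambient_derivative (ch_metric k) f x u v) = hor (Z x) (dd (\<lambda>y. dd Z y v) x u)
     - (bform (Z x) (dd Z x u) / bform (Z x) (Z x)) *s hor (Z x) (dd Z x v)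
     - (bform (Z x) (dd Z x v) / bform (Z x) (Z x)) *s hor (Z x) (dd Z x u)"
  unfolding ambient_derivative_eq[OF x] lifted_diff lifted_smult lifted_dd[OF x] by (simp add: lifted_eq_hor dd_dd_Z[OF x])

lemma dd_add_direction:
  assumes x: "x \<in> N"
  shows "dd (\<lambda>y. dd f y (u + v)) x w = dd (\<lambda>y. dd f y u) x w + dd (\<lambda>y. dd f y v) x w"
    "dd (\<lambda>y. dd f y (r *\<^sub>R v)) x w = r *\<^sub>R dd (\<lambda>y. dd f y v) x w"
proof -
  note d = smooth_on_differentiable[OF smooth_on_dd[OF smooth_f] x]
  have "dd (\<lambda>y. dd f y (u + v)) x w = dd (\<lambda>y. dd f y u + dd f y v) x w"
    using linear_dd_f by (subst dd_cong_open[OF open_N x]) (auto simp: linear_add)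
  then show "dd (\<lambda>y. dd f y (u + v)) x w = dd (\<lambda>y. dd f y u) x w + dd (\<lambda>y. dd f y v) x w"
    by (simp add: dd_add d)
  have "dd (\<lambda>y. dd f y (r *\<^sub>R v)) x w = dd (\<lambda>y. r *\<^sub>R dd f y v) x w"
    using linear_dd_f by (subst dd_cong_open[OF open_N x]) (auto simp: linear_scale)
  then show "dd (\<lambda>y. dd f y (r *\<^sub>R v)) x w = r *\<^sub>R dd (\<lambda>y. dd f y v) x w"
    by (simp add: dd_scaleR d dd_const)
qed

lemma ambient_derivative_linear:
  assumes x: "x \<in> N"
  shows "linear (ambient_derivative (ch_metric k) f x u)" "linear (\<lambda>u. ambient_derivative (ch_metric k) f x u v)"
proof -
  note l = linear_add[OF linear_dd_f[OF x]] linear_scale[OF linear_dd_f[OF x]]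
  note d = smooth_on_differentiable[OF smooth_on_dd[OF smooth_f] x, THEN linear_dd]
  note ls = ch_lin_add ch_lin_scaleR bform_simps
  show "linear (ambient_derivative (ch_metric k) f x u)"
    by (rule linearI; simp only: ambient_derivative_eq[OF x] dd_Z[OF x] l ls dd_add_direction[OF x])
      (simp_all add: vec_eq_iff algebra_simps add_divide_distrib scaleR_conv_of_real[where 'a = complex])
  show "linear (\<lambda>u. ambient_derivative (ch_metric k) f x u v)"
    by (rule linearI; simp only: ambient_derivative_eq[OF x] dd_Z[OF x] l ls linear_add[OF d] linear_scale[OF d])
      (simp_all add: vec_eq_iff algebra_simps add_divide_distrib scaleR_conv_of_real[where 'a = complex])
qed

lemma ambient_derivative_sym:
  "x \<in> N \<Longrightarrow> ambient_derivative (ch_metric k) f x u v = ambient_derivative (ch_metric k) f x v u"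
  using dd_commute[OF smooth_f open_N, of x u v] by (simp add: ambient_derivative_eq)

end

text \<open>The tangent fields \<open>e1\<close>, \<open>e2\<close> form a null frame with constant Wirtinger angle; \<open>s\<close> is its
  hyperbolic sine.\<close>

locale minimal_slant_chart = chart_surface +
  fixes e1 e2 :: "real^2 \<Rightarrow> real^2" and s :: real
  assumes smooth_e: "smooth_on N e1" "smooth_on N e2"
    and null: "\<And>x. x \<in> N \<Longrightarrow> G x (e1 x) (e1 x) = 0 \<and> G x (e2 x) (e2 x) = 0 \<and> G x (e1 x) (e2 x) = -1"
    and slant: "\<And>x. x \<in> N \<Longrightarrow> tangential_part (ch_metric k) f x (J (dd f x (e1 x))) = s *\<^sub>R dd f x (e1 x)"
    and minimal: "\<And>x. x \<in> N \<Longrightarrow> mean_curvature_vector (ch_metric k) f x = 0"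
begin

lemma det: assumes x: "x \<in> N" shows "e1 x$1 * e2 x$2 - e1 x$2 * e2 x$1 \<noteq> 0"
  using null_frame_det[of "G x" "e1 x" "e2 x", OF pullback_linear[OF x]] null[OF x] pullback_sym[OF x] by metis

definition H1 where "H1 x = hor (Z x) (dd Z x (e1 x))"
definition H2 where "H2 x = hor (Z x) (dd Z x (e2 x))"

lemma normal_part_eq:
  assumes x: "x \<in> N"
  shows "normal_part (ch_metric k) f x X = X + ch_metric k (f x) X (dd f x (e2 x)) *\<^sub>R dd f x (e1 x)
    + ch_metric k (f x) X (dd f x (e1 x)) *\<^sub>R dd f x (e2 x)"
  using null[OF x] coframe_expansion[OF det[OF x]]
  by (intro normal_part_null_frame ch_metric_linear[OF range_f[OF x]] ch_metric_sym[OF range_f[OF x]] linear_dd_f[OF x])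
    (auto simp: pullback_def)

text \<open>The hermitian product of \<open>e1\<close> and \<open>e2\<close> has the real part \<open>-1\<close>, and its imaginary part is the product of \<open>J e1\<close>
  and \<open>e2\<close>, which is \<open>- s\<close> as the tangential part of \<open>J e1\<close> is \<open>s e1\<close>.\<close>

lemma gram:
  assumes x: "x \<in> N"
  shows "bform (H1 x) (H1 x) = 0" "bform (H2 x) (H2 x) = 0"
    "bform (H1 x) (H2 x) = - bform (Z x) (Z x) * (-1 - \<i> * s)"
proof -
  define n where "n = bform (Z x) (Z x)"
  have n: "n = complex_of_real (Re n)" "Re n \<noteq> 0" using bform_self_real norm_Z[OF x] by (auto simp: n_def)
  then have n0: "n \<noteq> 0" by auto
  have Re_n: "Re (c / - n) = - Re c / Re n" "Im (c / - n) = - Im c / Re n" for c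
    by (subst n(1), simp)+
  have "G x (e1 x) (e1 x) = Re (bform (H1 x) (H1 x) / - n)" "G x (e2 x) (e2 x) = Re (bform (H2 x) (H2 x) / - n)"
    "G x (e1 x) (e2 x) = Re (bform (H1 x) (H2 x) / - n)"
    by (simp_all only: pullback_eq[OF x] H1_def H2_def n_def)
  then have "Re (bform (H1 x) (H1 x)) = 0" "Re (bform (H2 x) (H2 x)) = 0" and re: "- Re (bform (H1 x) (H2 x)) / Re n = -1"
    using null[OF x] n(2) unfolding Re_n by simp_all
  then show "bform (H1 x) (H1 x) = 0" "bform (H2 x) (H2 x) = 0" by (metis bform_self_real of_real_0)+
  define a1 a2 where "a1 = dd f x (e1 x)" and "a2 = dd f x (e2 x)"
  note g = ch_metric_eq_Re_herm[OF range_f[OF x]]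
  have gn: "ch_metric k (f x) a1 a1 = 0" "ch_metric k (f x) a2 a2 = 0" "ch_metric k (f x) a1 a2 = -1" "ch_metric k (f x) a2 a1 = -1"
    using null[OF x] ch_metric_sym[OF range_f[OF x]] by (auto simp: pullback_def a1_def a2_def)
  have "- (ch_metric k (f x) (J a1) a2 *\<^sub>R a1) - ch_metric k (f x) (J a1) a1 *\<^sub>R a2 = s *\<^sub>R a1"
    using slant[OF x] by (simp add: tangential_part_def normal_part_eq[OF x] a1_def a2_def)
  then have "ch_metric k (f x) (- (ch_metric k (f x) (J a1) a2 *\<^sub>R a1) - ch_metric k (f x) (J a1) a1 *\<^sub>R a2) a2
     = ch_metric k (f x) (s *\<^sub>R a1) a2" by simp
  then have "ch_metric k (f x) (J a1) a2 = - s"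
    using linear_diff[OF ch_metric_linear[OF range_f[OF x]]] linear_neg[OF ch_metric_linear[OF range_f[OF x]]]
      linear_scale[OF ch_metric_linear[OF range_f[OF x]]] gn by simp
  then have "Im (ch_herm k (f x) a1 a2) = - s"
    by (simp add: g J_def ch_herm_simps)
  moreover have "ch_herm k (f x) a1 a2 = bform (H1 x) (H2 x) / - n"
    by (simp add: ch_herm_def a1_def a2_def lifted_dd[OF x] H1_def H2_def n_def)
  ultimately have "Im (bform (H1 x) (H2 x) / - n) = - s" by simp
  with re have "bform (H1 x) (H2 x) / - n = -1 - \<i> * s" unfolding complex_eq_iff Re_n by simp
  then show "bform (H1 x) (H2 x) = - bform (Z x) (Z x) * (-1 - \<i> * s)"
    using n0 unfolding n_def[symmetric] by (simp add: field_simps)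
qed

text \<open>In a null frame minimality says that the ambient derivative of \<open>e1\<close> along \<open>e2\<close> is tangent, that is,
  its lift is a real combination of \<open>H1\<close> and \<open>H2\<close>.\<close>

lemma minimal_lift:
  assumes x: "x \<in> N"
  shows "\<exists>p q. hor (Z x) (dd (\<lambda>y. dd Z y (e1 x)) x (e2 x))
     - (bform (Z x) (dd Z x (e2 x)) / bform (Z x) (Z x)) *s H1 x
     - (bform (Z x) (dd Z x (e1 x)) / bform (Z x) (Z x)) *s H2 x = p *\<^sub>R H1 x + q *\<^sub>R H2 x"
proof -
  let ?g = "ch_metric k (f x)" and ?D = "ambient_derivative (ch_metric k) f x"
    and ?h = "second_fundamental_form (ch_metric k) f x"
  note gl = ch_metric_linear[OF range_f[OF x]]
  have np: "linear (normal_part (ch_metric k) f x)"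
    by (rule linearI) (simp_all add: normal_part_eq[OF x] linear_add[OF gl] linear_scale[OF gl] algebra_simps)
  have h: "linear (?h u)" "linear (\<lambda>u. ?h u v)" for u v
    using linear_compose[OF ambient_derivative_linear(1)[OF x] np] linear_compose[OF ambient_derivative_linear(2)[OF x] np]
    by (simp_all add: second_fundamental_form_def[abs_def] o_def)
  have "?h (e1 x) (e2 x) = ?h (e2 x) (e1 x)"
    by (simp add: second_fundamental_form_def ambient_derivative_sym[OF x])
  moreover have "mean_curvature_vector (ch_metric k) f x = - (1/2) *\<^sub>R (?h (e1 x) (e2 x) + ?h (e2 x) (e1 x))"
    using null[OF x] by (intro mean_curvature_null_frame pullback_linear[OF x] pullback_sym[OF x] h) auto
  ultimately have "?h (e2 x) (e1 x) = 0" using minimal[OF x] by (simp flip: scaleR_2)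
  moreover have "?D (e2 x) (e1 x) = ?h (e2 x) (e1 x) + (- ?g (?D (e2 x) (e1 x)) (dd f x (e2 x))) *\<^sub>R dd f x (e1 x)
     + (- ?g (?D (e2 x) (e1 x)) (dd f x (e1 x))) *\<^sub>R dd f x (e2 x)"
    unfolding second_fundamental_form_def normal_part_eq[OF x] by simp
  ultimately have "?D (e2 x) (e1 x) = (- ?g (?D (e2 x) (e1 x)) (dd f x (e2 x))) *\<^sub>R dd f x (e1 x)
     + (- ?g (?D (e2 x) (e1 x)) (dd f x (e1 x))) *\<^sub>R dd f x (e2 x)" by (simp only: add_0)
  then obtain p q where "?D (e2 x) (e1 x) = p *\<^sub>R dd f x (e1 x) + q *\<^sub>R dd f x (e2 x)" by blast
  then have "lifted k (f x) (?D (e2 x) (e1 x)) = p *\<^sub>R H1 x + q *\<^sub>R H2 x"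
    by (simp add: lifted_add lifted_scaleR lifted_dd[OF x] H1_def H2_def)
  then show ?thesis unfolding lifted_ambient_derivative[OF x] H1_def H2_def by blast
qed

end

section \<open>Structure equations\<close>

text \<open>Vectors with a dual family of functionals form a basis when their number is the dimension: a left inverse
  of a square matrix is a right inverse.\<close>

lemma dual_basis_expansion:
  fixes \<phi> :: "'n::finite \<Rightarrow> complex^'n \<Rightarrow> complex" and v :: "'n \<Rightarrow> complex^'n"
  assumes add: "\<And>i X Y. \<phi> i (X + Y) = \<phi> i X + \<phi> i Y" and scale: "\<And>i c X. \<phi> i (c *s X) = c * \<phi> i X"
    and dual: "\<And>i j. \<phi> i (v j) = (if i = j then 1 else 0)"
  shows "X = (\<Sum>j\<in>UNIV. \<phi> j X *s v j)"
proof -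
  have zero: "\<phi> i 0 = 0" for i using scale[of i 0 0] by simp
  have sum: "\<phi> i (\<Sum>j\<in>I. g j) = (\<Sum>j\<in>I. \<phi> i (g j))" for i g and I :: "'n set"
    by (induction I rule: infinite_finite_induct) (auto simp: add zero)
  define L :: "complex^'n^'n" where "L = (\<chi> i j. \<phi> i (axis j 1))"
  define E :: "complex^'n^'n" where "E = (\<chi> i j. v j $ i)"
  have L: "L *v Y = (\<chi> i. \<phi> i Y)" for Y
  proof -
    have "\<phi> i Y = (\<Sum>j\<in>UNIV. \<phi> i (Y$j *s axis j 1))" for i
      using sum[of i "\<lambda>j. Y$j *s axis j 1" UNIV] basis_expansion[of Y] by simp
    then show ?thesis by (simp add: vec_eq_iff matrix_vector_mult_def L_def scale mult.commute)
  qed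
  have E: "E *v c = (\<Sum>j\<in>UNIV. c$j *s v j)" for c
    by (simp add: vec_eq_iff matrix_vector_mult_def E_def mult.commute)
  have "L ** E = mat 1"
  proof -
    have "(L ** E) $ i $ j = (L *v v j) $ i" for i j
      by (simp add: matrix_matrix_mult_def matrix_vector_mult_def E_def)
    then show ?thesis by (simp add: vec_eq_iff L dual mat_def)
  qed
  then have "E ** L = mat 1" using matrix_left_right_inverse by blast
  then have "X = E *v (L *v X)" by (simp add: matrix_vector_mul_assoc)
  then show ?thesis unfolding E L by simp
qed

lemma hermitian_null_frame_expansion:
  assumes n: "bform Z Z \<noteq> 0" and \<kappa>: "\<kappa> \<noteq> 0" and ZH: "bform Z H1 = 0" "bform Z H2 = 0"
    and HH: "bform H1 H1 = 0" "bform H2 H2 = 0" "bform H1 H2 = - bform Z Z * \<kappa>"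
  shows "X = (bform Z X / bform Z Z) *s Z + (bform H2 X / (- bform Z Z * cnj \<kappa>)) *s H1
    + (bform H1 X / (- bform Z Z * \<kappa>)) *s H2"
proof -
  have HZ: "bform H1 Z = 0" "bform H2 Z = 0" using ZH bform_cnj by (metis complex_cnj_zero)+
  have H21: "bform H2 H1 = - bform Z Z * cnj \<kappa>"
    using arg_cong[OF HH(3), of cnj] by (simp add: bform_cnj)
  define \<phi> :: "3 \<Rightarrow> complex^3 \<Rightarrow> complex" where "\<phi> i X = (if i = 1 then bform Z X / bform Z Z
    else if i = 2 then bform H2 X / (- bform Z Z * cnj \<kappa>) else bform H1 X / (- bform Z Z * \<kappa>))" for i X
  define v :: "3 \<Rightarrow> complex^3" where "v i = (if i = 1 then Z else if i = 2 then H1 else H2)" for i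
  have "X = (\<Sum>j\<in>UNIV. \<phi> j X *s v j)"
  proof (rule dual_basis_expansion)
    show "\<phi> i (X + Y) = \<phi> i X + \<phi> i Y" "\<phi> i (c *s X) = c * \<phi> i X" for i X Y c
      by (simp_all add: \<phi>_def bform_simps add_divide_distrib)
    show "\<phi> i (v j) = (if i = j then 1 else 0)" for i j
      using exhaust_3[of i] exhaust_3[of j] n \<kappa> by (auto simp: \<phi>_def v_def ZH HZ HH H21)
  qed
  then show ?thesis by (simp add: sum_3 \<phi>_def v_def)
qed

lemma hermitian_null_frame_independent:
  assumes n: "bform Z Z \<noteq> 0" and \<kappa>: "\<kappa> \<noteq> 0" and ZH: "bform Z H1 = 0" "bform Z H2 = 0"
    and HH: "bform H1 H1 = 0" "bform H2 H2 = 0" "bform H1 H2 = - bform Z Z * \<kappa>"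
    and 0: "a *s Z + b *s H1 + c *s H2 = 0"
  shows "a = 0 \<and> b = 0 \<and> c = 0"
proof -
  have HZ: "bform H1 Z = 0" "bform H2 Z = 0" using ZH bform_cnj by (metis complex_cnj_zero)+
  have H21: "bform H2 H1 = - bform Z Z * cnj \<kappa>"
    using arg_cong[OF HH(3), of cnj] by (simp add: bform_cnj)
  show ?thesis
    using arg_cong[OF 0, of "bform Z"] arg_cong[OF 0, of "bform H1"] arg_cong[OF 0, of "bform H2"] n \<kappa>
    by (simp add: bform_simps ZH HZ HH H21)
qed

text \<open>Equality of the mixed second derivatives of a section of the framed bundle, written in
  components: the structure equation \<open>d\<Omega> + \<Omega> \<and> \<Omega> = 0\<close> for one column of the connection matrix.\<close>

lemma frame_integrability:
  fixes E Z H1 H2 :: "'a::euclidean_space \<Rightarrow> complex^3" and p q r :: "'a \<Rightarrow> 'a \<Rightarrow> complex"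
  assumes N: "open N" "x \<in> N" and E: "smooth_on N E"
    and sm: "smooth_on N Z" "smooth_on N H1" "smooth_on N H2"
      "\<And>v. smooth_on N (\<lambda>y. p y v)" "\<And>v. smooth_on N (\<lambda>y. q y v)" "\<And>v. smooth_on N (\<lambda>y. r y v)"
    and dE: "\<And>y v. y \<in> N \<Longrightarrow> dd E y v = p y v *s Z y + q y v *s H1 y + r y v *s H2 y"
    and dZ: "\<And>v. dd Z x v = z1 v *s Z x + z2 v *s H1 x + z3 v *s H2 x"
    and dH1: "\<And>v. dd H1 x v = a1 v *s Z x + a2 v *s H1 x + a3 v *s H2 x"
    and dH2: "\<And>v. dd H2 x v = c1 v *s Z x + c2 v *s H1 x + c3 v *s H2 x"
    and independent: "\<And>a b c. a *s Z x + b *s H1 x + c *s H2 x = 0 \<Longrightarrow> a = 0 \<and> b = 0 \<and> c = 0"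
  shows "dd (\<lambda>y. p y v) x u - dd (\<lambda>y. p y u) x v + p x v * z1 u - p x u * z1 v + q x v * a1 u - q x u * a1 v
      + r x v * c1 u - r x u * c1 v = 0"
    "dd (\<lambda>y. q y v) x u - dd (\<lambda>y. q y u) x v + p x v * z2 u - p x u * z2 v + q x v * a2 u - q x u * a2 v
      + r x v * c2 u - r x u * c2 v = 0"
    "dd (\<lambda>y. r y v) x u - dd (\<lambda>y. r y u) x v + p x v * z3 u - p x u * z3 v + q x v * a3 u - q x u * a3 v
      + r x v * c3 u - r x u * c3 v = 0"
proof -
  note d = sm[THEN smooth_on_differentiable, OF N(2)]
  note db = differentiable_bilinear[OF bounded_bilinear_smult]
  have second: "dd (\<lambda>y. dd E y v) x u =
     (dd (\<lambda>y. p y v) x u + p x v * z1 u + q x v * a1 u + r x v * c1 u) *s Z x +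
     (dd (\<lambda>y. q y v) x u + p x v * z2 u + q x v * a2 u + r x v * c2 u) *s H1 x +
     (dd (\<lambda>y. r y v) x u + p x v * z3 u + q x v * a3 u + r x v * c3 u) *s H2 x" for u v
  proof -
    have "dd (\<lambda>y. dd E y v) x u = dd (\<lambda>y. p y v *s Z y + q y v *s H1 y + r y v *s H2 y) x u"
      by (subst dd_cong_open[OF N]) (auto simp: dE)
    also have "\<dots> = p x v *s dd Z x u + dd (\<lambda>y. p y v) x u *s Z x + (q x v *s dd H1 x u + dd (\<lambda>y. q y v) x u *s H1 x)
       + (r x v *s dd H2 x u + dd (\<lambda>y. r y v) x u *s H2 x)"
      by (simp only: dd_add dd_smult d db differentiable_add)
    also have "\<dots> = (dd (\<lambda>y. p y v) x u + p x v * z1 u + q x v * a1 u + r x v * c1 u) *s Z x +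
     (dd (\<lambda>y. q y v) x u + p x v * z2 u + q x v * a2 u + r x v * c2 u) *s H1 x +
     (dd (\<lambda>y. r y v) x u + p x v * z3 u + q x v * a3 u + r x v * c3 u) *s H2 x"
      unfolding dZ dH1 dH2 by (simp add: vec_eq_iff algebra_simps)
    finally show ?thesis .
  qed
  have "dd (\<lambda>y. dd E y v) x u - dd (\<lambda>y. dd E y u) x v = 0"
    using dd_commute[OF E N, of v u] by simp
  then have "(dd (\<lambda>y. p y v) x u - dd (\<lambda>y. p y u) x v + p x v * z1 u - p x u * z1 v + q x v * a1 u - q x u * a1 v
      + r x v * c1 u - r x u * c1 v) *s Z x +
    (dd (\<lambda>y. q y v) x u - dd (\<lambda>y. q y u) x v + p x v * z2 u - p x u * z2 v + q x v * a2 u - q x u * a2 v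
      + r x v * c2 u - r x u * c2 v) *s H1 x +
    (dd (\<lambda>y. r y v) x u - dd (\<lambda>y. r y u) x v + p x v * z3 u - p x u * z3 v + q x v * a3 u - q x u * a3 v
      + r x v * c3 u - r x u * c3 v) *s H2 x = 0"
    unfolding second by (simp add: vec_eq_iff algebra_simps)
  from independent[OF this]
  show "dd (\<lambda>y. p y v) x u - dd (\<lambda>y. p y u) x v + p x v * z1 u - p x u * z1 v + q x v * a1 u - q x u * a1 v
      + r x v * c1 u - r x u * c1 v = 0"
    "dd (\<lambda>y. q y v) x u - dd (\<lambda>y. q y u) x v + p x v * z2 u - p x u * z2 v + q x v * a2 u - q x u * a2 v
      + r x v * c2 u - r x u * c2 v = 0"
    "dd (\<lambda>y. r y v) x u - dd (\<lambda>y. r y u) x v + p x v * z3 u - p x u * z3 v + q x v * a3 u - q x u * a3 v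
      + r x v * c3 u - r x u * c3 v = 0" by blast+
qed

lemma dd_of_real: "h differentiable (at x) \<Longrightarrow> dd (\<lambda>y. complex_of_real (h y)) x u = complex_of_real (dd h x u)"
  by (rule dd_linear_comp[OF bounded_linear_of_real])

lemma smooth_on_of_real: "open N \<Longrightarrow> smooth_on N h \<Longrightarrow> smooth_on N (\<lambda>y. complex_of_real (h y))"
  by (rule smooth_on_linear[OF bounded_linear_of_real])

context minimal_slant_chart
begin

text \<open>The entries of the connection matrix of the frame \<open>Z\<close>, \<open>H1\<close>, \<open>H2\<close>. A priori its \<open>H1\<close>-entry for
  \<open>H1\<close> is \<open>\<tau>\<close> plus a complex form, of which \<open>w\<close> is the real part; \<open>B\<close> and \<open>C\<close> are the values of the entries
  between \<open>H1\<close> and \<open>H2\<close> on one vector of the frame.\<close>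

definition \<kappa> :: complex where "\<kappa> = -1 - \<i> * s"
definition n where "n x = bform (Z x) (Z x)"
definition \<tau> where "\<tau> x v = bform (Z x) (dd Z x v) / n x"
definition \<omega>1 where "\<omega>1 x = coframe1 (e1 x) (e2 x)"
definition \<omega>2 where "\<omega>2 x = coframe2 (e1 x) (e2 x)"
definition w where "w x v = Re (bform (H2 x) (dd H1 x v) / (- n x * cnj \<kappa>) - \<tau> x v)"
definition B where "B x = bform (H1 x) (dd H1 x (e1 x)) / (- n x * \<kappa>)"
definition C where "C x = bform (H2 x) (dd H2 x (e2 x)) / (- n x * cnj \<kappa>)"

lemma \<kappa>_nonzero: "\<kappa> \<noteq> 0" by (simp add: \<kappa>_def complex_eq_iff)
lemma n_nonzero: "x \<in> N \<Longrightarrow> n x \<noteq> 0" using norm_Z[of x] by (auto simp: n_def)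
lemma cnj_n: "cnj (n x) = n x" by (simp add: n_def bform_cnj)

lemma smooth_dd_apply:
  assumes "smooth_on N (X :: real^2 \<Rightarrow> complex^3)" "smooth_on N e" shows "smooth_on N (\<lambda>x. dd X x (e x))"
  by (rule smooth_on_form_apply[OF open_N linear_dd[OF smooth_on_differentiable[OF assms(1)]] smooth_on_dd[OF assms(1)] assms(2)])

lemma smooth_n: "smooth_on N n"
  unfolding n_def[abs_def] by (intro smooth_on_bform open_N smooth_Z)

lemma smooth_hor: "smooth_on N X \<Longrightarrow> smooth_on N (\<lambda>x. hor (Z x) (X x))"
  unfolding hor_def using n_nonzero
  by (intro smooth_on_diff smooth_on_smult smooth_on_divide smooth_on_bform open_N smooth_Z) (auto simp: n_def)

lemma smooth_H: "smooth_on N H1" "smooth_on N H2"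
  unfolding H1_def[abs_def] H2_def[abs_def] by (intro smooth_hor smooth_dd_apply smooth_Z smooth_e)+

lemma smooth_\<tau>: "smooth_on N (\<lambda>x. \<tau> x v)"
  unfolding \<tau>_def by (intro smooth_on_divide smooth_on_bform smooth_on_dd open_N smooth_Z smooth_n n_nonzero)

lemma smooth_nth: "smooth_on N (e :: real^2 \<Rightarrow> real^2) \<Longrightarrow> smooth_on N (\<lambda>x. e x $ i)"
  by (rule smooth_on_linear[OF bounded_linear_vec_nth open_N])

lemma smooth_\<omega>: "smooth_on N (\<lambda>x. \<omega>1 x v)" "smooth_on N (\<lambda>x. \<omega>2 x v)"
  unfolding \<omega>1_def \<omega>2_def coframe1_def coframe2_def
  by (intro smooth_on_divide smooth_on_diff smooth_on_mult smooth_nth smooth_e smooth_on_const open_N det; assumption)+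

lemma smooth_w: "smooth_on N (\<lambda>x. w x v)"
proof -
  have "smooth_on N (\<lambda>x. bform (H2 x) (dd H1 x v) / (- n x * cnj \<kappa>) - \<tau> x v)"
    by (intro smooth_on_diff smooth_on_divide smooth_on_bform smooth_on_dd smooth_on_mult smooth_on_minus smooth_on_const
        open_N smooth_H smooth_n smooth_\<tau>) (simp add: \<kappa>_nonzero n_nonzero)
  then show ?thesis unfolding w_def by (rule smooth_on_linear[OF bounded_linear_Re open_N])
qed

lemma smooth_B: "smooth_on N B" and smooth_C: "smooth_on N C"
  unfolding B_def[abs_def] C_def[abs_def]
  by (intro smooth_on_divide smooth_on_bform smooth_dd_apply smooth_on_mult smooth_on_minus smooth_on_const
        open_N smooth_H smooth_n smooth_e; simp add: \<kappa>_nonzero n_nonzero)+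

lemma \<omega>_dual:
  "x \<in> N \<Longrightarrow> \<omega>1 x (e1 x) = 1" "x \<in> N \<Longrightarrow> \<omega>1 x (e2 x) = 0" "x \<in> N \<Longrightarrow> \<omega>2 x (e1 x) = 0" "x \<in> N \<Longrightarrow> \<omega>2 x (e2 x) = 1"
  by (simp_all only: \<omega>1_def \<omega>2_def coframe_dual[OF det])

lemma \<omega>_linear: "linear (\<omega>1 x)" "linear (\<omega>2 x)"
  by (simp_all only: \<omega>1_def \<omega>2_def coframe_linear)

lemma \<omega>_expansion: "x \<in> N \<Longrightarrow> v = \<omega>1 x v *\<^sub>R e1 x + \<omega>2 x v *\<^sub>R e2 x"
  unfolding \<omega>1_def \<omega>2_def by (rule coframe_expansion[OF det])

lemma ZH: assumes "x \<in> N" shows "bform (Z x) (H1 x) = 0" "bform (Z x) (H2 x) = 0"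
  using bform_hor[OF n_nonzero[OF assms, unfolded n_def]] by (simp_all add: H1_def H2_def)

lemma HH: assumes "x \<in> N" shows "bform (H1 x) (H1 x) = 0" "bform (H2 x) (H2 x) = 0"
    "bform (H1 x) (H2 x) = - n x * \<kappa>" "bform (H2 x) (H1 x) = - n x * cnj \<kappa>"
proof -
  show *: "bform (H1 x) (H1 x) = 0" "bform (H2 x) (H2 x) = 0" "bform (H1 x) (H2 x) = - n x * \<kappa>"
    using gram[OF assms] by (simp_all add: n_def \<kappa>_def)
  show "bform (H2 x) (H1 x) = - n x * cnj \<kappa>"
    using arg_cong[OF *(3), of cnj] by (simp add: bform_cnj cnj_n)
qed

lemma independent: "x \<in> N \<Longrightarrow> a *s Z x + b *s H1 x + c *s H2 x = 0 \<Longrightarrow> a = 0 \<and> b = 0 \<and> c = 0"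
  using hermitian_null_frame_independent[OF n_nonzero[unfolded n_def] \<kappa>_nonzero ZH HH(1-3)[unfolded n_def]] by blast

lemma expansion: "x \<in> N \<Longrightarrow> X = (bform (Z x) X / n x) *s Z x + (bform (H2 x) X / (- n x * cnj \<kappa>)) *s H1 x
    + (bform (H1 x) X / (- n x * \<kappa>)) *s H2 x"
  using hermitian_null_frame_expansion[OF n_nonzero[unfolded n_def] \<kappa>_nonzero ZH HH(1-3)[unfolded n_def]]
  unfolding n_def by blast

lemma linear_dd_frame: "x \<in> N \<Longrightarrow> linear (dd Z x)" "x \<in> N \<Longrightarrow> linear (dd H1 x)" "x \<in> N \<Longrightarrow> linear (dd H2 x)"
  using linear_dd[OF smooth_on_differentiable] smooth_Z smooth_H by blast+

lemma hor_dd_Z: assumes x: "x \<in> N" shows "hor (Z x) (dd Z x v) = \<omega>1 x v *\<^sub>R H1 x + \<omega>2 x v *\<^sub>R H2 x"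
proof -
  have "dd Z x v = \<omega>1 x v *\<^sub>R dd Z x (e1 x) + \<omega>2 x v *\<^sub>R dd Z x (e2 x)"
    using \<omega>_expansion[OF x, of v] linear_add[OF linear_dd_frame(1)[OF x]] linear_scale[OF linear_dd_frame(1)[OF x]] by metis
  then show ?thesis by (simp add: hor_add hor_scaleR H1_def H2_def)
qed

lemma dd_Z_frame: assumes x: "x \<in> N"
  shows "dd Z x v = \<tau> x v *s Z x + complex_of_real (\<omega>1 x v) *s H1 x + complex_of_real (\<omega>2 x v) *s H2 x"
proof -
  have "dd Z x v = \<tau> x v *s Z x + hor (Z x) (dd Z x v)" by (simp add: hor_def \<tau>_def n_def)
  then show ?thesis unfolding hor_dd_Z[OF x] by (simp add: scaleR_eq_smult)
qed

text \<open>The horizontal part of the derivative of a horizontally lifted field \<open>e\<close>. The term with \<open>dd e x u\<close> is the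
  lift of a tangent vector.\<close>

lemma dd_hor_field:
  assumes x: "x \<in> N" and e: "smooth_on N e"
  shows "hor (Z x) (dd (\<lambda>y. hor (Z y) (dd Z y (e y))) x u) =
    hor (Z x) (dd (\<lambda>y. dd Z y (e x)) x u) + hor (Z x) (dd Z x (dd e x u)) - \<tau> x (e x) *s hor (Z x) (dd Z x u)"
proof -
  have c: "smooth_on N (\<lambda>y. \<tau> y (e y))"
    unfolding \<tau>_def by (intro smooth_on_divide smooth_on_bform smooth_dd_apply open_N smooth_Z smooth_n n_nonzero e)
  note d = smooth_on_differentiable[OF _ x]
  have "dd (\<lambda>y. hor (Z y) (dd Z y (e y))) x u = dd (\<lambda>y. dd Z y (e y) - \<tau> y (e y) *s Z y) x u"
    by (simp add: hor_def \<tau>_def n_def)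
  also have "\<dots> = dd (\<lambda>y. dd Z y (e y)) x u - (\<tau> x (e x) *s dd Z x u + dd (\<lambda>y. \<tau> y (e y)) x u *s Z x)"
    by (subst dd_diff) (simp_all add: dd_smult d c smooth_Z e smooth_dd_apply differentiable_bilinear[OF bounded_bilinear_smult])
  also have "dd (\<lambda>y. dd Z y (e y)) x u = dd (\<lambda>y. dd Z y (e x)) x u + dd Z x (dd e x u)"
    by (intro dd_form_apply[OF open_N x] linear_dd_frame d smooth_on_dd smooth_Z e)
  finally show ?thesis
    by (simp add: hor_add hor_diff hor_smult) (simp add: hor_def bform_simps n_nonzero[OF x, unfolded n_def])
qed

lemma minimal_dd_H:
  assumes x: "x \<in> N"
  shows "\<exists>p q. hor (Z x) (dd H1 x (e2 x)) - \<tau> x (e2 x) *s H1 x = p *\<^sub>R H1 x + q *\<^sub>R H2 x"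
    "\<exists>p q. hor (Z x) (dd H2 x (e1 x)) - \<tau> x (e1 x) *s H2 x = p *\<^sub>R H1 x + q *\<^sub>R H2 x"
proof -
  obtain p q where pq: "hor (Z x) (dd (\<lambda>y. dd Z y (e1 x)) x (e2 x)) - \<tau> x (e2 x) *s H1 x
     - \<tau> x (e1 x) *s H2 x = p *\<^sub>R H1 x + q *\<^sub>R H2 x"
    using minimal_lift[OF x] unfolding \<tau>_def n_def by blast
  have 1: "hor (Z x) (dd H1 x (e2 x)) = hor (Z x) (dd (\<lambda>y. dd Z y (e1 x)) x (e2 x)) +
    hor (Z x) (dd Z x (dd e1 x (e2 x))) - \<tau> x (e1 x) *s H2 x"
    using dd_hor_field[OF x smooth_e(1)] by (simp add: H1_def[abs_def] H2_def)
  have 2: "hor (Z x) (dd H2 x (e1 x)) = hor (Z x) (dd (\<lambda>y. dd Z y (e2 x)) x (e1 x)) +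
    hor (Z x) (dd Z x (dd e2 x (e1 x))) - \<tau> x (e2 x) *s H1 x"
    using dd_hor_field[OF x smooth_e(2)] by (simp add: H2_def[abs_def] H1_def)
  have sym: "dd (\<lambda>y. dd Z y (e2 x)) x (e1 x) = dd (\<lambda>y. dd Z y (e1 x)) x (e2 x)"
    by (rule dd_commute[OF smooth_Z open_N x])
  let ?y = "dd e1 x (e2 x)" and ?z = "dd e2 x (e1 x)"
  have "hor (Z x) (dd H1 x (e2 x)) - \<tau> x (e2 x) *s H1 x = (p + \<omega>1 x ?y) *\<^sub>R H1 x + (q + \<omega>2 x ?y) *\<^sub>R H2 x"
    using pq unfolding 1 hor_dd_Z[OF x] by (simp add: algebra_simps)
  then show "\<exists>p q. hor (Z x) (dd H1 x (e2 x)) - \<tau> x (e2 x) *s H1 x = p *\<^sub>R H1 x + q *\<^sub>R H2 x" by blast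
  have "hor (Z x) (dd H2 x (e1 x)) - \<tau> x (e1 x) *s H2 x = (p + \<omega>1 x ?z) *\<^sub>R H1 x + (q + \<omega>2 x ?z) *\<^sub>R H2 x"
    using pq unfolding 2 sym hor_dd_Z[OF x] by (simp add: algebra_simps)
  then show "\<exists>p q. hor (Z x) (dd H2 x (e1 x)) - \<tau> x (e1 x) *s H2 x = p *\<^sub>R H1 x + q *\<^sub>R H2 x" by blast
qed

text \<open>Derivative of a Gram matrix entry, each of which is a constant multiple of \<open>n\<close>.\<close>

lemma dd_bform_frame:
  assumes x: "x \<in> N" and X: "smooth_on N X" and Y: "smooth_on N Y"
    and c: "\<And>y. y \<in> N \<Longrightarrow> bform (X y) (Y y) = c * n y"
  shows "bform (X x) (dd Y x v) + bform (dd X x v) (Y x) = c * n x * (\<tau> x v + cnj (\<tau> x v))"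
proof -
  note d = smooth_on_differentiable[OF _ x]
  have n: "dd n x v = n x * (\<tau> x v + cnj (\<tau> x v))"
  proof -
    have "dd n x v = bform (Z x) (dd Z x v) + bform (dd Z x v) (Z x)"
      unfolding n_def[abs_def] using dd_bform[OF d d, OF smooth_Z smooth_Z] .
    also have "bform (dd Z x v) (Z x) = cnj (bform (Z x) (dd Z x v))" by (simp add: bform_cnj)
    also have "bform (Z x) (dd Z x v) = n x * \<tau> x v" using n_nonzero[OF x] by (simp add: \<tau>_def)
    finally show ?thesis by (simp add: cnj_n algebra_simps)
  qed
  have "bform (X x) (dd Y x v) + bform (dd X x v) (Y x) = dd (\<lambda>y. bform (X y) (Y y)) x v"
    by (rule dd_bform[symmetric]) (rule d X Y)+
  also have "\<dots> = dd (\<lambda>y. c * n y) x v"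
    by (subst dd_cong_open[OF open_N x]) (auto simp: c)
  also have "\<dots> = c * dd n x v" by (simp add: dd_mult dd_const d smooth_n)
  finally show ?thesis by (simp add: n)
qed

text \<open>The Gram matrix makes the connection matrix skew-hermitian up to \<open>\<tau>\<close>. In particular the entry \<open>b\<close>
  between \<open>H1\<close> and \<open>H2\<close> has imaginary \<open>b \<kappa>\<close>, while minimality makes \<open>b\<close> real on \<open>e2\<close>. As \<open>\<kappa>\<close> has
  real part \<open>-1\<close>, the entry vanishes on \<open>e2\<close>. For the diagonal entries, minimality gives reality
  on one vector of the frame, and the skew symmetry on the other one.\<close>

lemma dd_H_frame:
  assumes x: "x \<in> N"
  shows "dd H1 x v = (cnj \<kappa> * \<omega>2 x v) *s Z x + (w x v + \<tau> x v) *s H1 x + (B x * \<omega>1 x v) *s H2 x"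
    "dd H2 x v = (\<kappa> * \<omega>1 x v) *s Z x + (C x * \<omega>2 x v) *s H1 x + (\<tau> x v - w x v) *s H2 x"
    "Re (B x * \<kappa>) = 0" "Re (C x * cnj \<kappa>) = 0"
proof -
  note nz = n_nonzero[OF x] \<kappa>_nonzero
  define a where "a v = bform (H2 x) (dd H1 x v) / (- n x * cnj \<kappa>)" for v
  define b where "b v = bform (H1 x) (dd H1 x v) / (- n x * \<kappa>)" for v
  define c where "c v = bform (H2 x) (dd H2 x v) / (- n x * cnj \<kappa>)" for v
  define d where "d v = bform (H1 x) (dd H2 x v) / (- n x * \<kappa>)" for v
  have HZ: "bform (H1 x) (Z x) = 0" "bform (H2 x) (Z x) = 0" using ZH[OF x] bform_cnj by (metis complex_cnj_zero)+
  have z1: "bform (Z x) (dd H1 x v) = n x * (cnj \<kappa> * \<omega>2 x v)" for v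
    using dd_bform_frame[OF x smooth_Z smooth_H(1), of 0 v] ZH unfolding dd_Z_frame[OF x]
    by (simp add: bform_simps HZ HH[OF x] ZH[OF x] eq_neg_iff_add_eq_0 algebra_simps)
  have z2: "bform (Z x) (dd H2 x v) = n x * (\<kappa> * \<omega>1 x v)" for v
    using dd_bform_frame[OF x smooth_Z smooth_H(2), of 0 v] ZH unfolding dd_Z_frame[OF x]
    by (simp add: bform_simps HZ HH[OF x] ZH[OF x] eq_neg_iff_add_eq_0 algebra_simps)
  have e1: "dd H1 x v = (cnj \<kappa> * \<omega>2 x v) *s Z x + a v *s H1 x + b v *s H2 x" for v
    using expansion[OF x, of "dd H1 x v"] nz(1) unfolding z1 by (simp add: a_def b_def)
  have e2: "dd H2 x v = (\<kappa> * \<omega>1 x v) *s Z x + c v *s H1 x + d v *s H2 x" for v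
    using expansion[OF x, of "dd H2 x v"] nz(1) unfolding z2 by (simp add: c_def d_def)
  have unscale: "bform (H1 x) (dd H1 x v) = - n x * (b v * \<kappa>)" "bform (H2 x) (dd H2 x v) = - n x * (c v * cnj \<kappa>)"
    "bform (H2 x) (dd H1 x v) = - n x * (a v * cnj \<kappa>)" "bform (H1 x) (dd H2 x v) = - n x * (d v * \<kappa>)" for v
    using nz by (simp_all add: a_def b_def c_def d_def)
  have flip: "bform (dd X x v) Y = cnj (bform Y (dd X x v))" for X v Y by (simp add: bform_cnj)
  have "- n x * (b v * \<kappa> + cnj (b v * \<kappa>)) = 0" for v
    using dd_bform_frame[OF x smooth_H(1) smooth_H(1), of 0 v] HH(1) unfolding flip unscale by (simp add: cnj_n algebra_simps)
  then have "complex_of_real (2 * Re (b v * \<kappa>)) = 0" for v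
    using nz(1) unfolding complex_add_cnj mult_eq_0_iff neg_equal_0_iff_equal by blast
  then have bk: "Re (b v * \<kappa>) = 0" for v by (simp only: of_real_eq_0_iff mult_eq_0_iff) simp
  have "- n x * (c v * cnj \<kappa> + cnj (c v * cnj \<kappa>)) = 0" for v
    using dd_bform_frame[OF x smooth_H(2) smooth_H(2), of 0 v] HH(2) unfolding flip unscale by (simp add: cnj_n algebra_simps)
  then have "complex_of_real (2 * Re (c v * cnj \<kappa>)) = 0" for v
    using nz(1) unfolding complex_add_cnj mult_eq_0_iff neg_equal_0_iff_equal by blast
  then have ck: "Re (c v * cnj \<kappa>) = 0" for v by (simp only: of_real_eq_0_iff mult_eq_0_iff) simp
  have "- n x * \<kappa> * (d v + cnj (a v)) = - n x * \<kappa> * (\<tau> x v + cnj (\<tau> x v))" for v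
    using dd_bform_frame[OF x smooth_H(1) smooth_H(2), of "-\<kappa>" v] HH(3) unfolding flip unscale by (simp add: cnj_n algebra_simps)
  then have da: "d v + cnj (a v) = \<tau> x v + cnj (\<tau> x v)" for v using nz by simp
  have hZ: "hor (Z x) (Z x) = 0" using nz(1) by (simp add: hor_def n_def)
  have hH: "hor (Z x) (H1 x) = H1 x" "hor (Z x) (H2 x) = H2 x" by (simp_all add: hor_def ZH[OF x])
  have h1: "hor (Z x) (dd H1 x v) = a v *s H1 x + b v *s H2 x" for v
    unfolding e1 by (simp add: hor_add hor_smult hZ hH)
  have h2: "hor (Z x) (dd H2 x v) = c v *s H1 x + d v *s H2 x" for v
    unfolding e2 by (simp add: hor_add hor_smult hZ hH)
  have coeff: "\<alpha> = complex_of_real p \<and> \<beta> = complex_of_real q"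
    if "\<alpha> *s H1 x + \<beta> *s H2 x = p *\<^sub>R H1 x + q *\<^sub>R H2 x" for \<alpha> \<beta> p q
  proof -
    have "0 *s Z x + (\<alpha> - complex_of_real p) *s H1 x + (\<beta> - complex_of_real q) *s H2 x = 0"
      using that unfolding scaleR_eq_smult by (simp add: vec_eq_iff algebra_simps)
    from independent[OF x this] show ?thesis by simp
  qed
  obtain p q where "(a (e2 x) - \<tau> x (e2 x)) *s H1 x + b (e2 x) *s H2 x = p *\<^sub>R H1 x + q *\<^sub>R H2 x"
    using minimal_dd_H(1)[OF x] unfolding h1 by (auto simp: algebra_simps)
  from coeff[OF this] have m1: "Im (a (e2 x) - \<tau> x (e2 x)) = 0" "Im (b (e2 x)) = 0" by simp_all
  obtain p q where "c (e1 x) *s H1 x + (d (e1 x) - \<tau> x (e1 x)) *s H2 x = p *\<^sub>R H1 x + q *\<^sub>R H2 x"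
    using minimal_dd_H(2)[OF x] unfolding h2 by (auto simp: algebra_simps)
  from coeff[OF this] have m2: "Im (d (e1 x) - \<tau> x (e1 x)) = 0" "Im (c (e1 x)) = 0" by simp_all
  have b0: "b (e2 x) = 0" using bk[of "e2 x"] m1(2) by (simp add: \<kappa>_def complex_eq_iff)
  have c0: "c (e1 x) = 0" using ck[of "e1 x"] m2(2) by (simp add: \<kappa>_def complex_eq_iff)
  have m3: "Im (a (e1 x) - \<tau> x (e1 x)) = 0" using arg_cong[OF da[of "e1 x"], of Im] m2(1) by simp
  have lin: "linear (\<lambda>v. bform Y (dd H1 x v) / k)" "linear (\<lambda>v. bform Y (dd H2 x v) / k)" "linear (\<lambda>v. bform Y (dd Z x v) / k)" for Y k
    using linear_dd_frame[OF x] by (auto intro!: linearI simp: linear_add linear_scale bform_simps add_divide_distrib scaleR_conv_of_real[where 'a = complex])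
  have la: "linear a" "linear b" "linear c" "linear (\<tau> x)" unfolding a_def[abs_def] b_def[abs_def] c_def[abs_def] \<tau>_def[abs_def]
    by (intro lin)+
  have ex: "\<phi> v = \<omega>1 x v *\<^sub>R \<phi> (e1 x) + \<omega>2 x v *\<^sub>R \<phi> (e2 x)" if "linear \<phi>" for \<phi> :: "real^2 \<Rightarrow> complex" and v
    using \<omega>_expansion[OF x, of v] linear_add[OF that] linear_scale[OF that] by metis
  have "Im (a v - \<tau> x v) = 0" for v
    using m1(1) m3 ex[OF la(1), of v] ex[OF la(4), of v] by simp
  then have wv: "complex_of_real (w x v) = a v - \<tau> x v" for v
    by (simp add: complex_eq_iff w_def a_def)
  have Bb: "B x = b (e1 x)" and Cc: "C x = c (e2 x)" by (simp_all add: B_def b_def C_def c_def)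
  have bv: "b v = B x * \<omega>1 x v" for v using ex[OF la(2), of v] b0 by (simp add: Bb scaleR_conv_of_real[where 'a = complex])
  have cv: "c v = C x * \<omega>2 x v" for v using ex[OF la(3), of v] c0 by (simp add: Cc scaleR_conv_of_real[where 'a = complex])
  have dv: "d v = \<tau> x v - w x v" for v
  proof -
    have "cnj (complex_of_real (w x v)) = cnj (a v) - cnj (\<tau> x v)" unfolding wv by simp
    moreover have "d v = \<tau> x v - (cnj (a v) - cnj (\<tau> x v))" using da[of v] by (simp add: algebra_simps)
    ultimately show ?thesis by simp
  qed
  show "dd H1 x v = (cnj \<kappa> * \<omega>2 x v) *s Z x + (w x v + \<tau> x v) *s H1 x + (B x * \<omega>1 x v) *s H2 x"
    unfolding e1 bv wv by simp
  show "dd H2 x v = (\<kappa> * \<omega>1 x v) *s Z x + (C x * \<omega>2 x v) *s H1 x + (\<tau> x v - w x v) *s H2 x"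
    unfolding e2 cv dv ..
  show "Re (B x * \<kappa>) = 0" "Re (C x * cnj \<kappa>) = 0" using bk ck by (simp_all only: Bb Cc)
qed


text \<open>The equality of mixed second derivatives for the frame, in components. The first two equations are
  the structure equations of the induced metric, the third is the curvature of the tautological
  line bundle, the fourth contains the equations of Gauss (real part) and Ricci (imaginary part), and the
  last two are those of Codazzi.\<close>

lemma structure_equations:
  assumes x: "x \<in> N"
  shows "dd (\<lambda>y. \<omega>1 y v) x u - dd (\<lambda>y. \<omega>1 y u) x v = - (w x u * \<omega>1 x v - w x v * \<omega>1 x u)"
    "dd (\<lambda>y. \<omega>2 y v) x u - dd (\<lambda>y. \<omega>2 y u) x v = w x u * \<omega>2 x v - w x v * \<omega>2 x u"
    "dd (\<lambda>y. \<tau> y v) x u - dd (\<lambda>y. \<tau> y u) x v = (cnj \<kappa> - \<kappa>) * (\<omega>1 x u * \<omega>2 x v - \<omega>1 x v * \<omega>2 x u)"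
    "complex_of_real (dd (\<lambda>y. w y v) x u - dd (\<lambda>y. w y u) x v)
       = (\<kappa> - 2 * cnj \<kappa> + B x * C x) * (\<omega>1 x u * \<omega>2 x v - \<omega>1 x v * \<omega>2 x u)"
    "dd B x u * \<omega>1 x v - dd B x v * \<omega>1 x u = 3 * B x * (w x u * \<omega>1 x v - w x v * \<omega>1 x u)"
    "dd C x u * \<omega>2 x v - dd C x v * \<omega>2 x u = - 3 * C x * (w x u * \<omega>2 x v - w x v * \<omega>2 x u)"
proof -
  note d = smooth_on_differentiable[OF _ x]
  note so = smooth_on_of_real[OF open_N]
  note fr = dd_Z_frame[OF x] dd_H_frame(1,2)[OF x]
  note sm = smooth_Z smooth_H
  have I1: "smooth_on N (\<lambda>y. \<tau> y v)" "smooth_on N (\<lambda>y. complex_of_real (\<omega>1 y v))" "smooth_on N (\<lambda>y. complex_of_real (\<omega>2 y v))" for v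
    by (intro so smooth_\<tau> smooth_\<omega>)+
  note E1 = frame_integrability[OF open_N x smooth_Z sm I1 dd_Z_frame fr independent[OF x], where u = u and v = v]
  have I2: "smooth_on N (\<lambda>y. cnj \<kappa> * complex_of_real (\<omega>2 y v))" "smooth_on N (\<lambda>y. complex_of_real (w y v) + \<tau> y v)"
    "smooth_on N (\<lambda>y. B y * complex_of_real (\<omega>1 y v))" for v
    by (intro smooth_on_mult smooth_on_add smooth_on_const so smooth_\<tau> smooth_\<omega> smooth_w smooth_B open_N)+
  note E2 = frame_integrability[OF open_N x smooth_H(1) sm I2 dd_H_frame(1) fr independent[OF x], where u = u and v = v]
  have I3: "smooth_on N (\<lambda>y. \<kappa> * complex_of_real (\<omega>1 y v))" "smooth_on N (\<lambda>y. C y * complex_of_real (\<omega>2 y v))"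
    "smooth_on N (\<lambda>y. \<tau> y v - complex_of_real (w y v))" for v
    by (intro smooth_on_mult smooth_on_diff smooth_on_const so smooth_\<tau> smooth_\<omega> smooth_w smooth_C open_N)+
  note E3 = frame_integrability[OF open_N x smooth_H(2) sm I3 dd_H_frame(2) fr independent[OF x], where u = u and v = v]
  note D = dd_of_real[OF d[OF smooth_\<omega>(1)]] dd_of_real[OF d[OF smooth_\<omega>(2)]] dd_of_real[OF d[OF smooth_w]]
  have P: "dd (\<lambda>y. complex_of_real (w y v) + \<tau> y v) x u = complex_of_real (dd (\<lambda>y. w y v) x u) + dd (\<lambda>y. \<tau> y v) x u"
    "dd (\<lambda>y. B y * complex_of_real (\<omega>1 y v)) x u = B x * complex_of_real (dd (\<lambda>y. \<omega>1 y v) x u) + dd B x u * \<omega>1 x v"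
    "dd (\<lambda>y. C y * complex_of_real (\<omega>2 y v)) x u = C x * complex_of_real (dd (\<lambda>y. \<omega>2 y v) x u) + dd C x u * \<omega>2 x v" for u v
    by (simp_all add: dd_add dd_mult D d so smooth_\<tau> smooth_\<omega> smooth_w smooth_B smooth_C)
  have "complex_of_real (dd (\<lambda>y. \<omega>1 y v) x u - dd (\<lambda>y. \<omega>1 y u) x v + w x u * \<omega>1 x v - w x v * \<omega>1 x u) = 0"
    using E1(2) unfolding D by (simp add: algebra_simps)
  then show T1: "dd (\<lambda>y. \<omega>1 y v) x u - dd (\<lambda>y. \<omega>1 y u) x v = - (w x u * \<omega>1 x v - w x v * \<omega>1 x u)"
    by (simp only: of_real_eq_0_iff)
  have "complex_of_real (dd (\<lambda>y. \<omega>2 y v) x u - dd (\<lambda>y. \<omega>2 y u) x v - (w x u * \<omega>2 x v - w x v * \<omega>2 x u)) = 0"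
    using E1(3) unfolding D by (simp add: algebra_simps)
  then show T2: "dd (\<lambda>y. \<omega>2 y v) x u - dd (\<lambda>y. \<omega>2 y u) x v = w x u * \<omega>2 x v - w x v * \<omega>2 x u"
    by (simp only: of_real_eq_0_iff)
  show T3: "dd (\<lambda>y. \<tau> y v) x u - dd (\<lambda>y. \<tau> y u) x v = (cnj \<kappa> - \<kappa>) * (\<omega>1 x u * \<omega>2 x v - \<omega>1 x v * \<omega>2 x u)"
    using E1(1) by (simp add: algebra_simps)
  have "complex_of_real (dd (\<lambda>y. w y v) x u - dd (\<lambda>y. w y u) x v) + (dd (\<lambda>y. \<tau> y v) x u - dd (\<lambda>y. \<tau> y u) x v)
     = (B x * C x - cnj \<kappa>) * (\<omega>1 x u * \<omega>2 x v - \<omega>1 x v * \<omega>2 x u)"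
    using E2(2) unfolding P by (simp add: algebra_simps)
  then show "complex_of_real (dd (\<lambda>y. w y v) x u - dd (\<lambda>y. w y u) x v)
       = (\<kappa> - 2 * cnj \<kappa> + B x * C x) * (\<omega>1 x u * \<omega>2 x v - \<omega>1 x v * \<omega>2 x u)"
    unfolding T3 by (simp add: algebra_simps)
  have "B x * complex_of_real (dd (\<lambda>y. \<omega>1 y v) x u - dd (\<lambda>y. \<omega>1 y u) x v) + (dd B x u * \<omega>1 x v - dd B x v * \<omega>1 x u)
    = 2 * B x * (w x u * \<omega>1 x v - w x v * \<omega>1 x u)"
    using E2(3) unfolding P by (simp add: algebra_simps)
  then show "dd B x u * \<omega>1 x v - dd B x v * \<omega>1 x u = 3 * B x * (w x u * \<omega>1 x v - w x v * \<omega>1 x u)"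
    unfolding T1 by (simp add: algebra_simps)
  have "C x * complex_of_real (dd (\<lambda>y. \<omega>2 y v) x u - dd (\<lambda>y. \<omega>2 y u) x v) + (dd C x u * \<omega>2 x v - dd C x v * \<omega>2 x u)
    = - 2 * C x * (w x u * \<omega>2 x v - w x v * \<omega>2 x u)"
    using E3(2) unfolding P by (simp add: algebra_simps)
  then show "dd C x u * \<omega>2 x v - dd C x v * \<omega>2 x u = - 3 * C x * (w x u * \<omega>2 x v - w x v * \<omega>2 x u)"
    unfolding T2 by (simp add: algebra_simps)
qed

end

locale flat_minimal_slant_chart = minimal_slant_chart +
  assumes flat: "\<And>x u v z. x \<in> N \<Longrightarrow> curvature G x u v z = 0"
begin

lemma \<tau>_linear: "x \<in> N \<Longrightarrow> linear (\<tau> x)"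
  using linear_dd_frame(1)[of x]
  by (auto intro!: linearI simp: \<tau>_def linear_add linear_scale bform_simps add_divide_distrib scaleR_conv_of_real[where 'a = complex])

lemma w_linear: "x \<in> N \<Longrightarrow> linear (w x)"
  unfolding w_def[abs_def] using linear_dd_frame(2)[of x] \<tau>_linear[of x]
  by (intro linear_compose[OF linear_compose_sub bounded_linear.linear[OF bounded_linear_Re], unfolded o_def])
    (auto intro!: linearI simp: linear_add linear_scale bform_simps add_divide_distrib scaleR_conv_of_real[where 'a = complex])

lemma dw: assumes x: "x \<in> N" shows "dd (\<lambda>y. w y v) x u = dd (\<lambda>y. w y u) x v"
proof (rule flat_connection_form_closed[OF open_N x smooth_\<omega> smooth_w smooth_e \<omega>_linear w_linear _ \<omega>_expansion _
      structure_equations(1,2) flat[OF x]])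
  show "\<omega>1 q (e1 q) = 1 \<and> \<omega>1 q (e2 q) = 0 \<and> \<omega>2 q (e1 q) = 0 \<and> \<omega>2 q (e2 q) = 1" if "q \<in> N" for q
    using \<omega>_dual[OF that] by blast
  fix q u v assume q: "q \<in> N"
  have lr: "G q z (a *\<^sub>R y + b *\<^sub>R y') = a * G q z y + b * G q z y'" for z y y' a b
    using pullback_sym[OF q] linear_add[OF pullback_linear[OF q]] linear_scale[OF pullback_linear[OF q]] by simp
  have "G q (\<omega>1 q u *\<^sub>R e1 q + \<omega>2 q u *\<^sub>R e2 q) (\<omega>1 q v *\<^sub>R e1 q + \<omega>2 q v *\<^sub>R e2 q)
      = - (\<omega>1 q u * \<omega>2 q v + \<omega>2 q u * \<omega>1 q v)"
    using null[OF q] pullback_sym[OF q, of "e2 q" "e1 q"] unfolding lr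
    by (simp add: linear_add[OF pullback_linear[OF q]] linear_scale[OF pullback_linear[OF q]])
  then show "G q u v = - (\<omega>1 q u * \<omega>2 q v + \<omega>2 q u * \<omega>1 q v)"
    using \<omega>_expansion[OF q, of u] \<omega>_expansion[OF q, of v] by simp
qed

text \<open>The imaginary part of the equation for \<open>w\<close> is \<open>3 s = 0\<close>, and its real part
  is the Gauss equation.\<close>

lemma B_C: assumes x: "x \<in> N" shows "s = 0" "Re (B x) = 0" "Re (C x) = 0" "Im (B x) * Im (C x) = 1"
proof -
  have "\<kappa> - 2 * cnj \<kappa> + B x * C x = 0"
    using structure_equations(4)[OF x, of "e2 x" "e1 x"] dw[OF x, of "e2 x" "e1 x"] \<omega>_dual[OF x] by simp
  then have BC: "B x * C x = 2 * cnj \<kappa> - \<kappa>" by (simp add: algebra_simps add_eq_0_iff)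
  have k: "\<kappa> * cnj \<kappa> = complex_of_real (1 + s\<^sup>2)" by (simp add: \<kappa>_def complex_eq_iff power2_eq_square)
  have "(B x * \<kappa>) * (C x * cnj \<kappa>) = (B x * C x) * (\<kappa> * cnj \<kappa>)" by (simp add: algebra_simps)
  also have "\<dots> = (2 * cnj \<kappa> - \<kappa>) * complex_of_real (1 + s\<^sup>2)" by (simp only: BC k)
  finally have "Im ((B x * \<kappa>) * (C x * cnj \<kappa>)) = Im ((2 * cnj \<kappa> - \<kappa>) * complex_of_real (1 + s\<^sup>2))" by simp
  moreover have "Im ((B x * \<kappa>) * (C x * cnj \<kappa>)) = 0"
    using dd_H_frame(3,4)[OF x] by (simp only: times_complex.sel mult_zero_left mult_zero_right add_0)
  moreover have "Im ((2 * cnj \<kappa> - \<kappa>) * complex_of_real (1 + s\<^sup>2)) = 3 * s * (1 + s\<^sup>2)"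
    by (simp add: \<kappa>_def)
  ultimately have "3 * s * (1 + s\<^sup>2) = 0" by metis
  moreover have "1 + s\<^sup>2 \<noteq> 0" using zero_le_power2[of s] by linarith
  ultimately show s: "s = 0" by simp
  then have \<kappa>: "\<kappa> = -1" unfolding \<kappa>_def by simp
  show B: "Re (B x) = 0" and C: "Re (C x) = 0" using dd_H_frame(3,4)[OF x] unfolding \<kappa> by simp_all
  have "Re (B x * C x) = -1" using BC unfolding \<kappa> by simp
  then show "Im (B x) * Im (C x) = 1" using B C by simp
qed

definition \<beta> where "\<beta> x = Im (B x)"

lemma smooth_\<beta>: "smooth_on N \<beta>"
  unfolding \<beta>_def[abs_def] by (rule smooth_on_linear[OF bounded_linear_Im open_N smooth_B])

lemma \<beta>_nonzero: "x \<in> N \<Longrightarrow> \<beta> x \<noteq> 0"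
  using B_C(4)[of x] by (auto simp: \<beta>_def)

lemma B_eq: assumes "x \<in> N" shows "B x = \<i> * \<beta> x" "C x = \<i> / \<beta> x"
  using B_C(2-4)[OF assms] \<beta>_nonzero[OF assms] by (auto simp: \<beta>_def complex_eq_iff field_simps Im_divide_of_real)

text \<open>Each of the two Codazzi equations determines one component of \<open>d\<beta>\<close>. The one for \<open>C\<close> applies because \<open>C\<close>
  is \<open>\<i> / \<beta>\<close>.\<close>

lemma d\<beta>: assumes x: "x \<in> N" shows "dd \<beta> x v = 3 * \<beta> x * w x v"
proof -
  note d = smooth_on_differentiable[OF _ x]
  have dB: "Im (dd B x v) = dd \<beta> x v" for v
    unfolding \<beta>_def[abs_def] by (rule dd_linear_comp[OF bounded_linear_Im d[OF smooth_B], symmetric])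
  have 2: "dd \<beta> x (e2 x) = 3 * \<beta> x * w x (e2 x)"
    using arg_cong[OF structure_equations(5)[OF x, of "e2 x" "e1 x"], of Im] \<omega>_dual[OF x] B_C(2-4)[OF x]
    by (simp add: dB[symmetric] \<beta>_def)
  have dC: "Im (dd C x v) = - dd \<beta> x v / (\<beta> x)\<^sup>2" for v
  proof -
    have "Im (dd C x v) = dd (\<lambda>y. Im (C y)) x v"
      by (rule dd_linear_comp[OF bounded_linear_Im d[OF smooth_C], symmetric])
    also have "\<dots> = dd (\<lambda>y. inverse (\<beta> y)) x v"
      by (subst dd_cong_open[OF open_N x]) (auto simp: B_eq(2) Im_divide_of_real inverse_eq_divide)
    also have "\<dots> = - (inverse (\<beta> x) * dd \<beta> x v * inverse (\<beta> x))"
      by (rule dd_eqI[OF Deriv.has_derivative_inverse[OF \<beta>_nonzero[OF x] smooth_on_has_derivative[OF smooth_\<beta> x]]])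
    finally show ?thesis by (simp add: power2_eq_square divide_inverse)
  qed
  have "Im (dd C x (e1 x)) = - 3 * (1 / \<beta> x) * w x (e1 x)"
    using arg_cong[OF structure_equations(6)[OF x, of "e2 x" "e1 x"], of Im] \<omega>_dual[OF x]
    by (simp add: B_eq[OF x] Im_divide_of_real)
  then have 1: "dd \<beta> x (e1 x) = 3 * \<beta> x * w x (e1 x)"
    using \<beta>_nonzero[OF x] unfolding dC by (simp add: field_simps power2_eq_square)
  have lin: "linear (dd \<beta> x)" by (rule linear_dd[OF d[OF smooth_\<beta>]])
  have "dd \<beta> x v = \<omega>1 x v * dd \<beta> x (e1 x) + \<omega>2 x v * dd \<beta> x (e2 x)"
    using \<omega>_expansion[OF x, of v] linear_add[OF lin] linear_scale[OF lin] by (metis real_scaleR_def)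
  also have "\<dots> = 3 * \<beta> x * (\<omega>1 x v * w x (e1 x) + \<omega>2 x v * w x (e2 x))" unfolding 1 2 by (simp add: algebra_simps)
  also have "\<omega>1 x v * w x (e1 x) + \<omega>2 x v * w x (e2 x) = w x v"
    using \<omega>_expansion[OF x, of v] linear_add[OF w_linear[OF x]] linear_scale[OF w_linear[OF x]] by (metis real_scaleR_def)
  finally show ?thesis .
qed

end

section \<open>The model surface\<close>

text \<open>The map \<open>L_tilde 1\<close> and its partial derivatives are members of the following
  family, which is closed under differentiation.\<close>

definition model :: "complex \<Rightarrow> complex \<Rightarrow> complex \<Rightarrow> real^2 \<Rightarrow> complex^3" where
  "model \<alpha> \<beta> \<gamma> t = (1 / sqrt 3) *\<^sub>R vector
     [complex_of_real (sqrt 2) * exp (- \<i> / 2 * (t$1 + t$2)) *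
        (\<alpha> * complex_of_real (cosh (sqrt 3 / 2 * (t$1 - t$2))) + \<beta> * complex_of_real (sinh (sqrt 3 / 2 * (t$1 - t$2)))),
      \<gamma> * exp (\<i> * (t$1 + t$2)),
      complex_of_real (sqrt 2) * exp (- \<i> / 2 * (t$1 + t$2)) *
        (\<alpha> * complex_of_real (sinh (sqrt 3 / 2 * (t$1 - t$2))) + \<beta> * complex_of_real (cosh (sqrt 3 / 2 * (t$1 - t$2))))]"

lemma L_tilde_1_eq: "L_tilde 1 t = model 1 0 1 t"
  by (simp add: L_tilde_def model_def Let_def vec_eq_iff forall_3 add.commute)


lemma model_combination:
  "model (\<alpha> + \<alpha>') (\<beta> + \<beta>') (\<gamma> + \<gamma>') t = model \<alpha> \<beta> \<gamma> t + model \<alpha>' \<beta>' \<gamma>' t"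
  "model (c * \<alpha>) (c * \<beta>) (c * \<gamma>) t = c *s model \<alpha> \<beta> \<gamma> t"
  by (simp_all add: model_def vec_eq_iff forall_3 algebra_simps)

lemma bform_model:
  "bform (model \<alpha> \<beta> \<gamma> t) (model \<alpha>' \<beta>' \<gamma>' t) = (- 2 * cnj \<alpha> * \<alpha>' + 2 * cnj \<beta> * \<beta>' - cnj \<gamma> * \<gamma>') / 3"
proof -
  define c s where "c = cosh (sqrt 3 / 2 * (t$1 - t$2))" and "s = sinh (sqrt 3 / 2 * (t$1 - t$2))"
  define P Q where "P = exp (- \<i> / 2 * (t$1 + t$2))" and "Q = exp (\<i> * (t$1 + t$2))"
  have "c\<^sup>2 - s\<^sup>2 = 1" unfolding c_def s_def by (rule hyperbolic_pythagoras)
  then have cs: "complex_of_real c * c = 1 + complex_of_real s * s"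
    by (simp add: power2_eq_square flip: of_real_mult) (metis add.commute diff_eq_eq of_real_1 of_real_add)
  have P: "cnj P * P = 1" and Q: "cnj Q * Q = 1"
    unfolding P_def Q_def exp_cnj exp_add[symmetric] by (simp_all add: algebra_simps)
  have r: "complex_of_real (sqrt 2) * complex_of_real (sqrt 2) = 2" "complex_of_real (sqrt 3) * complex_of_real (sqrt 3) = 3"
    by (simp_all flip: of_real_mult)
  have m: "model \<alpha> \<beta> \<gamma> t = (1 / sqrt 3) *\<^sub>R vector [complex_of_real (sqrt 2) * P * (\<alpha> * c + \<beta> * s), \<gamma> * Q,
      complex_of_real (sqrt 2) * P * (\<alpha> * s + \<beta> * c)]" for \<alpha> \<beta> \<gamma>
    by (simp only: model_def c_def s_def P_def Q_def)
  have "bform (model \<alpha> \<beta> \<gamma> t) (model \<alpha>' \<beta>' \<gamma>' t) =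
     (- ((complex_of_real (sqrt 2) * complex_of_real (sqrt 2)) * (cnj P * P) * (cnj \<alpha> * c + cnj \<beta> * s) * (\<alpha>' * c + \<beta>' * s))
      - cnj \<gamma> * \<gamma>' * (cnj Q * Q)
      + (complex_of_real (sqrt 2) * complex_of_real (sqrt 2)) * (cnj P * P) * (cnj \<alpha> * s + cnj \<beta> * c) * (\<alpha>' * s + \<beta>' * c))
     / (complex_of_real (sqrt 3) * complex_of_real (sqrt 3))"
    unfolding m bform_scaleR_left bform_scaleR_right by (simp add: bform_def add_divide_distrib diff_divide_distrib algebra_simps)
  also have "\<dots> = (- 2 * (cnj \<alpha> * c + cnj \<beta> * s) * (\<alpha>' * c + \<beta>' * s) - cnj \<gamma> * \<gamma>' + 2 * (cnj \<alpha> * s + cnj \<beta> * c) * (\<alpha>' * s + \<beta>' * c)) / 3"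
    unfolding P Q r by (simp add: algebra_simps)
  also have "- 2 * (cnj \<alpha> * c + cnj \<beta> * s) * (\<alpha>' * c + \<beta>' * s) - cnj \<gamma> * \<gamma>' + 2 * (cnj \<alpha> * s + cnj \<beta> * c) * (\<alpha>' * s + \<beta>' * c)
      = - 2 * cnj \<alpha> * \<alpha>' * (complex_of_real c * c - complex_of_real s * s)
        + 2 * cnj \<beta> * \<beta>' * (complex_of_real c * c - complex_of_real s * s) - cnj \<gamma> * \<gamma>'"
    by (simp add: algebra_simps)
  also have "\<dots> = - 2 * cnj \<alpha> * \<alpha>' + 2 * cnj \<beta> * \<beta>' - cnj \<gamma> * \<gamma>'" unfolding cs by simp
  finally show ?thesis .
qed

lemma has_derivative_vector3:
  fixes f g h :: "'a::real_normed_vector \<Rightarrow> complex"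
  assumes "(f has_derivative f') F" "(g has_derivative g') F" "(h has_derivative h') F"
  shows "((\<lambda>x. vector [f x, g x, h x] :: complex^3) has_derivative (\<lambda>v. vector [f' v, g' v, h' v])) F"
proof -
  have eq: "(vector [a, b, c] :: complex^3) = a *s axis 1 1 + b *s axis 2 1 + c *s axis 3 1" for a b c
    by (simp add: vec_eq_iff forall_3 axis_def)
  have bl: "bounded_linear (\<lambda>a. a *s (v :: complex^3))" for v
    by (rule bounded_bilinear.bounded_linear_left[OF bounded_bilinear_smult])
  show ?thesis unfolding eq by (intro has_derivative_add bounded_linear.has_derivative[OF bl] assms)
qed

lemma has_derivative_model:
  "(model \<alpha> \<beta> \<gamma> has_derivative (\<lambda>v. model
     (- \<i> / 2 * (v$1 + v$2) * \<alpha> + complex_of_real (sqrt 3) / 2 * (v$1 - v$2) * \<beta>)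
     (- \<i> / 2 * (v$1 + v$2) * \<beta> + complex_of_real (sqrt 3) / 2 * (v$1 - v$2) * \<alpha>)
     (\<i> * (v$1 + v$2) * \<gamma>) t)) (at t)"
proof -
  have nth: "((\<lambda>t :: real^2. t$i) has_derivative (\<lambda>v. v$i)) (at t)" for i
    by (rule bounded_linear.has_derivative[OF bounded_linear_vec_nth has_derivative_ident])
  have nthc: "((\<lambda>t :: real^2. complex_of_real (t$i)) has_derivative (\<lambda>v. complex_of_real (v$i))) (at t)" for i
    by (rule bounded_linear.has_derivative[OF bounded_linear_of_real nth])
  define T where "T t = sqrt 3 / 2 * (t$1 - t$2)" for t :: "real^2"
  have T: "(T has_derivative (\<lambda>v. sqrt 3 / 2 * (v$1 - v$2))) (at t)"
    unfolding T_def[abs_def] by (intro has_derivative_mult_right has_derivative_diff nth)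
  have "((\<lambda>t. cosh (T t)) has_derivative (\<lambda>v. sinh (T t) * (sqrt 3 / 2 * (v$1 - v$2)))) (at t)"
    "((\<lambda>t. sinh (T t)) has_derivative (\<lambda>v. cosh (T t) * (sqrt 3 / 2 * (v$1 - v$2)))) (at t)"
    using has_derivative_compose[OF T has_field_derivative_cosh[OF DERIV_ident, unfolded has_field_derivative_def]]
      has_derivative_compose[OF T has_field_derivative_sinh[OF DERIV_ident, unfolded has_field_derivative_def]] by simp_all
  note cs = this[THEN bounded_linear.has_derivative[OF bounded_linear_of_real[where 'a = complex]]]
  have ex: "((\<lambda>t :: real^2. exp (k * (complex_of_real (t$1) + t$2))) has_derivative
      (\<lambda>v. exp (k * (complex_of_real (t$1) + t$2)) * (k * (v$1 + v$2)))) (at t)" for k :: complex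
  proof -
    have "((\<lambda>t :: real^2. k * (complex_of_real (t$1) + t$2)) has_derivative (\<lambda>v. k * (complex_of_real (v$1) + v$2))) (at t)"
      by (intro has_derivative_mult_right has_derivative_add nthc)
    from has_derivative_compose[OF this DERIV_exp[unfolded has_field_derivative_def]] show ?thesis by simp
  qed
  have m: "model \<alpha> \<beta> \<gamma> = (\<lambda>t. (1 / sqrt 3) *\<^sub>R vector
     [complex_of_real (sqrt 2) * (exp (- \<i> / 2 * (complex_of_real (t$1) + t$2)) *
        (\<alpha> * complex_of_real (cosh (T t)) + \<beta> * complex_of_real (sinh (T t)))),
      \<gamma> * exp (\<i> * (complex_of_real (t$1) + t$2)),
      complex_of_real (sqrt 2) * (exp (- \<i> / 2 * (complex_of_real (t$1) + t$2)) *
        (\<alpha> * complex_of_real (sinh (T t)) + \<beta> * complex_of_real (cosh (T t))))])" for \<alpha> \<beta> \<gamma>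
    by (simp add: fun_eq_iff model_def T_def mult.assoc)
  note c = has_derivative_add[OF has_derivative_mult_right[OF cs(1)] has_derivative_mult_right[OF cs(2)]]
  note s = has_derivative_add[OF has_derivative_mult_right[OF cs(2)] has_derivative_mult_right[OF cs(1)]]
  have "(model \<alpha> \<beta> \<gamma> has_derivative (\<lambda>v. (1 / sqrt 3) *\<^sub>R vector
     [complex_of_real (sqrt 2) * (exp (- \<i> / 2 * (complex_of_real (t$1) + t$2)) *
        (\<alpha> * complex_of_real (sinh (T t) * (sqrt 3 / 2 * (v$1 - v$2))) + \<beta> * complex_of_real (cosh (T t) * (sqrt 3 / 2 * (v$1 - v$2))))
       + exp (- \<i> / 2 * (complex_of_real (t$1) + t$2)) * (- \<i> / 2 * (v$1 + v$2)) *
        (\<alpha> * complex_of_real (cosh (T t)) + \<beta> * complex_of_real (sinh (T t)))),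
      \<gamma> * (exp (\<i> * (complex_of_real (t$1) + t$2)) * (\<i> * (v$1 + v$2))),
      complex_of_real (sqrt 2) * (exp (- \<i> / 2 * (complex_of_real (t$1) + t$2)) *
        (\<alpha> * complex_of_real (cosh (T t) * (sqrt 3 / 2 * (v$1 - v$2))) + \<beta> * complex_of_real (sinh (T t) * (sqrt 3 / 2 * (v$1 - v$2))))
       + exp (- \<i> / 2 * (complex_of_real (t$1) + t$2)) * (- \<i> / 2 * (v$1 + v$2)) *
        (\<alpha> * complex_of_real (sinh (T t)) + \<beta> * complex_of_real (cosh (T t))))])) (at t)"
    unfolding m by (rule has_derivative_scaleR_right has_derivative_vector3 has_derivative_mult_right
        has_derivative_mult[OF ex c] has_derivative_mult[OF ex s] ex)+
  then show ?thesis
  proof (rule has_derivative_eq_rhs)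
    let ?P = "exp (- \<i> / 2 * (complex_of_real (t$1) + t$2))"
    have m': "model a b c t = (1 / sqrt 3) *\<^sub>R vector
     [complex_of_real (sqrt 2) * (?P * (a * complex_of_real (cosh (T t)) + b * complex_of_real (sinh (T t)))),
      c * exp (\<i> * (complex_of_real (t$1) + t$2)),
      complex_of_real (sqrt 2) * (?P * (a * complex_of_real (sinh (T t)) + b * complex_of_real (cosh (T t))))]" for a b c
      by (simp only: m)
    show "(\<lambda>v :: real^2. (1 / sqrt 3) *\<^sub>R vector
     [complex_of_real (sqrt 2) * (?P *
        (\<alpha> * complex_of_real (sinh (T t) * (sqrt 3 / 2 * (v$1 - v$2))) + \<beta> * complex_of_real (cosh (T t) * (sqrt 3 / 2 * (v$1 - v$2))))
       + ?P * (- \<i> / 2 * (v$1 + v$2)) *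
        (\<alpha> * complex_of_real (cosh (T t)) + \<beta> * complex_of_real (sinh (T t)))),
      \<gamma> * (exp (\<i> * (complex_of_real (t$1) + t$2)) * (\<i> * (v$1 + v$2))),
      complex_of_real (sqrt 2) * (?P *
        (\<alpha> * complex_of_real (cosh (T t) * (sqrt 3 / 2 * (v$1 - v$2))) + \<beta> * complex_of_real (sinh (T t) * (sqrt 3 / 2 * (v$1 - v$2))))
       + ?P * (- \<i> / 2 * (v$1 + v$2)) *
        (\<alpha> * complex_of_real (sinh (T t)) + \<beta> * complex_of_real (cosh (T t))))]) =
      (\<lambda>v. model
     (- \<i> / 2 * (v$1 + v$2) * \<alpha> + complex_of_real (sqrt 3) / 2 * (v$1 - v$2) * \<beta>)
     (- \<i> / 2 * (v$1 + v$2) * \<beta> + complex_of_real (sqrt 3) / 2 * (v$1 - v$2) * \<alpha>)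
     (\<i> * (v$1 + v$2) * \<gamma>) t)"
      unfolding m' by (rule ext, rule arg_cong[where f = "\<lambda>v. (1 / sqrt 3) *\<^sub>R v"]) (simp add: vec_eq_iff forall_3 algebra_simps add_divide_distrib diff_divide_distrib)
  qed
qed

definition surf where "surf = model 1 0 1"
definition surf_x where "surf_x = model (- \<i> / 2) (complex_of_real (sqrt 3) / 2) \<i>"
definition surf_y where "surf_y = model (- \<i> / 2) (- complex_of_real (sqrt 3) / 2) \<i>"

lemma L_tilde_1: "L_tilde 1 = surf"
  by (simp add: surf_def L_tilde_1_eq fun_eq_iff)

lemma has_derivative_surf:
  "(surf has_derivative (\<lambda>v. v$1 *\<^sub>R surf_x t + v$2 *\<^sub>R surf_y t)) (at t)"
  "(surf_x has_derivative (\<lambda>v. - (v$2 *\<^sub>R surf t) + v$1 *\<^sub>R (\<i> *s surf_y t))) (at t)"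
  "(surf_y has_derivative (\<lambda>v. - (v$1 *\<^sub>R surf t) + v$2 *\<^sub>R (\<i> *s surf_x t))) (at t)"
proof -
  have r: "complex_of_real (sqrt 3) * complex_of_real (sqrt 3) = 3" by (simp flip: of_real_mult)
  have comb: "a *s model \<alpha> \<beta> \<gamma> t + b *s model \<alpha>' \<beta>' \<gamma>' t = model (a * \<alpha> + b * \<alpha>') (a * \<beta> + b * \<beta>') (a * \<gamma> + b * \<gamma>') t"
    for a b \<alpha> \<beta> \<gamma> \<alpha>' \<beta>' \<gamma>' by (simp only: model_combination)
  have neg: "- (a *\<^sub>R X) + b *\<^sub>R (\<i> *s Y) = (- complex_of_real a) *s X + (complex_of_real b * \<i>) *s Y" for a b and X Y :: "complex^3"
    by (simp add: scaleR_eq_smult)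
  show "(surf has_derivative (\<lambda>v. v$1 *\<^sub>R surf_x t + v$2 *\<^sub>R surf_y t)) (at t)"
    unfolding surf_def surf_x_def surf_y_def scaleR_eq_smult comb
    by (rule has_derivative_eq_rhs[OF has_derivative_model], rule ext, rule arg_cong3[where f = "\<lambda>a b c. model a b c t"])
      (simp_all add: algebra_simps)
  show "(surf_x has_derivative (\<lambda>v. - (v$2 *\<^sub>R surf t) + v$1 *\<^sub>R (\<i> *s surf_y t))) (at t)"
    unfolding surf_def surf_x_def surf_y_def neg comb
    by (rule has_derivative_eq_rhs[OF has_derivative_model], rule ext, rule arg_cong3[where f = "\<lambda>a b c. model a b c t"])
      (simp_all add: algebra_simps r)
  show "(surf_y has_derivative (\<lambda>v. - (v$1 *\<^sub>R surf t) + v$2 *\<^sub>R (\<i> *s surf_x t))) (at t)"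
    unfolding surf_def surf_x_def surf_y_def neg comb
    by (rule has_derivative_eq_rhs[OF has_derivative_model], rule ext, rule arg_cong3[where f = "\<lambda>a b c. model a b c t"])
      (simp_all add: algebra_simps r)
qed

text \<open>The Gram matrix of the frame consisting of the model and its partial derivatives.\<close>

definition normal_gram :: "complex^3 \<Rightarrow> complex^3 \<Rightarrow> complex^3 \<Rightarrow> bool" where
  "normal_gram Z X Y \<longleftrightarrow> bform Z Z = -1 \<and> bform Z X = 0 \<and> bform Z Y = 0 \<and> bform X X = 0 \<and> bform Y Y = 0 \<and> bform X Y = -1"

lemma normal_gram_surf: "normal_gram (surf t) (surf_x t) (surf_y t)"
proof -
  have r: "complex_of_real (sqrt 3) * complex_of_real (sqrt 3) = 3" by (simp flip: of_real_mult)
  show ?thesis unfolding normal_gram_def surf_def surf_x_def surf_y_def bform_model by (simp add: r)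
qed

lemma normal_gram_flip:
  assumes "normal_gram Z X Y"
  shows "bform X Z = 0" "bform Y Z = 0" "bform Y X = -1"
  using assms bform_cnj unfolding normal_gram_def by (metis complex_cnj_zero complex_cnj_minus complex_cnj_one)+

lemma normal_gram_expansion:
  assumes "normal_gram Z X Y"
  shows "V = - (bform Z V *s Z) - bform Y V *s X - bform X V *s Y"
proof -
  have "bform Z Z \<noteq> 0" "(-1::complex) \<noteq> 0" "bform Z X = 0" "bform Z Y = 0" "bform X X = 0" "bform Y Y = 0"
    "bform X Y = - bform Z Z * -1" and 1: "bform Z Z = -1"
    using assms by (auto simp: normal_gram_def)
  note hermitian_null_frame_expansion[OF this(1-7), of V]
  then show ?thesis unfolding 1 by (simp add: vec_eq_iff)
qed

section \<open>Unitary maps and normal frames\<close>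

definition b_unitary :: "(complex^3 \<Rightarrow> complex^3) \<Rightarrow> bool" where
  "b_unitary \<Phi> \<longleftrightarrow> (\<forall>c d v w. \<Phi> (c *s v + d *s w) = c *s \<Phi> v + d *s \<Phi> w) \<and> (\<forall>v w. bform (\<Phi> v) (\<Phi> w) = bform v w)"

lemma b_unitary_simps:
  assumes "b_unitary \<Phi>"
  shows "\<Phi> (v + w) = \<Phi> v + \<Phi> w" "\<Phi> (c *s v) = c *s \<Phi> v" "\<Phi> (r *\<^sub>R v) = r *\<^sub>R \<Phi> v" "\<Phi> (- v) = - \<Phi> v" "\<Phi> (v - w) = \<Phi> v - \<Phi> w"
    "bform (\<Phi> v) (\<Phi> w) = bform v w"
proof -
  have L: "\<Phi> (c *s v + d *s w) = c *s \<Phi> v + d *s \<Phi> w" for c d v w using assms by (simp add: b_unitary_def)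
  show "\<Phi> (v + w) = \<Phi> v + \<Phi> w" using L[of 1 v 1 w] by simp
  show s: "\<Phi> (c *s v) = c *s \<Phi> v" for c using L[of c v 0 0] by simp
  show "\<Phi> (r *\<^sub>R v) = r *\<^sub>R \<Phi> v" by (simp add: scaleR_eq_smult s)
  show "\<Phi> (- v) = - \<Phi> v" using s[of "-1"] by simp
  show "\<Phi> (v - w) = \<Phi> v - \<Phi> w" using L[of 1 v "-1" w] by simp
  show "bform (\<Phi> v) (\<Phi> w) = bform v w" using assms by (simp add: b_unitary_def)
qed

lemma b_unitary_bounded_linear: "b_unitary \<Phi> \<Longrightarrow> bounded_linear \<Phi>"
  unfolding linear_conv_bounded_linear[symmetric] by (rule linearI) (simp_all add: b_unitary_simps)

lemma b_unitary_scale: "b_unitary \<Phi> \<Longrightarrow> cnj c * c = 1 \<Longrightarrow> b_unitary (\<lambda>v. c *s \<Phi> v)"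
  by (auto simp: b_unitary_def bform_simps vec_eq_iff algebra_simps)

lemma hopf_scale: assumes "c \<noteq> 0" shows "hopf (c *s z) = hopf z"
proof (intro set_eqI iffI)
  fix v
  show "v \<in> hopf z" if "v \<in> hopf (c *s z)"
  proof -
    obtain d where "d \<noteq> 0" "v = d *s (c *s z)" using \<open>v \<in> hopf (c *s z)\<close> by (auto simp: hopf_def)
    then have "d * c \<noteq> 0" "v = (d * c) *s z" using assms by (auto simp: vector_smult_assoc)
    then show ?thesis unfolding hopf_def by blast
  qed
  show "v \<in> hopf (c *s z)" if "v \<in> hopf z"
  proof -
    obtain d where "d \<noteq> 0" "v = d *s z" using \<open>v \<in> hopf z\<close> by (auto simp: hopf_def)
    then have "d / c \<noteq> 0" "v = (d / c) *s (c *s z)" using assms by (auto simp: vector_smult_assoc)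
    then show ?thesis unfolding hopf_def by blast
  qed
qed

text \<open>The equations \<open>Z\<^sub>x\<^sub>x = \<i> Z\<^sub>y\<close>, \<open>Z\<^sub>y\<^sub>y = \<i> Z\<^sub>x\<close>, \<open>Z\<^sub>x\<^sub>y = - Z\<close> with \<open>X = Z\<^sub>x\<close> and \<open>Y = Z\<^sub>y\<close>, where the coordinates
  are the components of \<open>\<psi>\<close>.\<close>

definition normal_frame :: "('a::real_normed_vector) set \<Rightarrow> ('a \<Rightarrow> real^2) \<Rightarrow> ('a \<Rightarrow> complex^3) \<Rightarrow> ('a \<Rightarrow> complex^3) \<Rightarrow> ('a \<Rightarrow> complex^3) \<Rightarrow> bool" where
  "normal_frame S \<psi> Z X Y \<longleftrightarrow> (\<forall>x\<in>S. \<exists>\<psi>'. (\<psi> has_derivative \<psi>') (at x) \<and>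
     (Z has_derivative (\<lambda>v. \<psi>' v$1 *\<^sub>R X x + \<psi>' v$2 *\<^sub>R Y x)) (at x) \<and>
     (X has_derivative (\<lambda>v. - (\<psi>' v$2 *\<^sub>R Z x) + \<psi>' v$1 *\<^sub>R (\<i> *s Y x))) (at x) \<and>
     (Y has_derivative (\<lambda>v. - (\<psi>' v$1 *\<^sub>R Z x) + \<psi>' v$2 *\<^sub>R (\<i> *s X x))) (at x))"

text \<open>The equations of a normal frame are those of the model, and both preserve the Gram matrix. So the unitary map that
  takes the frame of the model to the given frame does not depend on the point.\<close>

lemma normal_frame_congruent_model:
  fixes S :: "'a::euclidean_space set"
  assumes S: "open S" "convex S" "x0 \<in> S" and fr: "normal_frame S \<psi> Z X Y" and gram: "normal_gram (Z x0) (X x0) (Y x0)"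
  shows "\<exists>\<Phi>. b_unitary \<Phi> \<and> (\<forall>x\<in>S. Z x = \<Phi> (surf (\<psi> x)) \<and> X x = \<Phi> (surf_x (\<psi> x)) \<and> Y x = \<Phi> (surf_y (\<psi> x)))"
proof -
  define \<Phi> where "\<Phi> x v = - (bform (surf (\<psi> x)) v *s Z x) - bform (surf_y (\<psi> x)) v *s X x - bform (surf_x (\<psi> x)) v *s Y x" for x v
  have "((\<lambda>x. \<Phi> x v) has_derivative (\<lambda>h. 0)) (at x within S)" if x: "x \<in> S" for x v
  proof -
    obtain \<psi>' where d: "(\<psi> has_derivative \<psi>') (at x)"
     "(Z has_derivative (\<lambda>v. \<psi>' v$1 *\<^sub>R X x + \<psi>' v$2 *\<^sub>R Y x)) (at x)"
     "(X has_derivative (\<lambda>v. - (\<psi>' v$2 *\<^sub>R Z x) + \<psi>' v$1 *\<^sub>R (\<i> *s Y x))) (at x)"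
     "(Y has_derivative (\<lambda>v. - (\<psi>' v$1 *\<^sub>R Z x) + \<psi>' v$2 *\<^sub>R (\<i> *s X x))) (at x)"
      using fr x unfolding normal_frame_def by blast
    note dF = has_derivative_surf[THEN has_derivative_compose[OF d(1)]]
    note db = has_derivative_bform[OF _ has_derivative_const[of v]]
    note ds = bounded_bilinear.FDERIV[OF bounded_bilinear_smult]
    have "((\<lambda>x. \<Phi> x v) has_derivative (\<lambda>h. 0)) (at x)"
      unfolding \<Phi>_def
      by (rule has_derivative_eq_rhs[OF has_derivative_diff[OF has_derivative_diff[OF has_derivative_minus[OF
         ds[OF db[OF dF(1)] d(2)]] ds[OF db[OF dF(3)] d(3)]] ds[OF db[OF dF(2)] d(4)]]])
        (simp add: fun_eq_iff bform_simps vec_eq_iff algebra_simps scaleR_conv_of_real[where 'a = complex])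
    then show ?thesis by (rule has_derivative_at_withinI)
  qed
  then have const: "\<Phi> x v = \<Phi> x0 v" if "x \<in> S" for x v
    using has_derivative_zero_unique[OF S(2), of "\<lambda>x. \<Phi> x v"] that S(3) by metis
  note gF = normal_gram_surf[unfolded normal_gram_def] normal_gram_flip[OF normal_gram_surf]
  have val: "Z x = \<Phi> x0 (surf (\<psi> x))" "X x = \<Phi> x0 (surf_x (\<psi> x))" "Y x = \<Phi> x0 (surf_y (\<psi> x))" if "x \<in> S" for x
    unfolding const[OF that, symmetric] by (simp_all add: \<Phi>_def gF)
  have "b_unitary (\<Phi> x0)"
    unfolding b_unitary_def
  proof (intro conjI allI)
    show "\<Phi> x0 (c *s v + d *s w) = c *s \<Phi> x0 v + d *s \<Phi> x0 w" for c d v w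
      by (simp add: \<Phi>_def bform_simps vec_eq_iff algebra_simps)
    fix v w
    have "bform v w = bform (- (bform (surf (\<psi> x0)) v *s surf (\<psi> x0)) - bform (surf_y (\<psi> x0)) v *s surf_x (\<psi> x0) - bform (surf_x (\<psi> x0)) v *s surf_y (\<psi> x0)) w"
      using normal_gram_expansion[OF normal_gram_surf, of v] by metis
    also have "\<dots> = - (cnj (bform (surf (\<psi> x0)) v) * bform (surf (\<psi> x0)) w) - cnj (bform (surf_y (\<psi> x0)) v) * bform (surf_x (\<psi> x0)) w
       - cnj (bform (surf_x (\<psi> x0)) v) * bform (surf_y (\<psi> x0)) w" by (simp add: bform_simps)
    also have "\<dots> = bform (\<Phi> x0 v) (\<Phi> x0 w)"
      using gram normal_gram_flip[OF gram] by (simp add: \<Phi>_def bform_simps normal_gram_def)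
    finally show "bform (\<Phi> x0 v) (\<Phi> x0 w) = bform v w" by simp
  qed
  then show ?thesis using val by blast
qed

context flat_minimal_slant_chart
begin

text \<open>The scaling \<open>e1 \<mapsto> \<mu> e1\<close>, \<open>e2 \<mapsto> e2 / \<mu>\<close> multiplies \<open>\<beta>\<close> by \<open>\<mu>\<^sup>3\<close>. So \<open>\<nu>\<close>
  normalizes it to 1. Then \<open>w\<close> vanishes, and the dual forms \<open>\<omega>1 / \<nu>\<close>, \<open>\<nu> \<omega>2\<close> are closed.\<close>

definition \<nu> where "\<nu> x = root 3 (1 / \<beta> x)"

lemma smooth_\<nu>: "smooth_on N \<nu>"
  unfolding \<nu>_def[abs_def]
  by (rule smooth_on_compose[OF open_N _ smooth_on_divide[OF open_N smooth_on_const smooth_\<beta> \<beta>_nonzero] smooth_on_cube_root_function])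
    (auto simp: \<beta>_nonzero)

lemma \<nu>: assumes "x \<in> N" shows "\<nu> x * \<nu> x * \<nu> x * \<beta> x = 1" "\<nu> x \<noteq> 0"
proof -
  have "(root 3 (1 / \<beta> x)) ^ 3 = 1 / \<beta> x" by (rule odd_real_root_pow) simp
  then show *: "\<nu> x * \<nu> x * \<nu> x * \<beta> x = 1"
    using \<beta>_nonzero[OF assms] by (simp add: \<nu>_def power3_eq_cube)
  then show "\<nu> x \<noteq> 0" by auto
qed

lemma d\<nu>: assumes x: "x \<in> N" shows "dd \<nu> x v = - \<nu> x * w x v"
proof -
  note d = smooth_on_differentiable[OF smooth_\<nu> x] smooth_on_differentiable[OF smooth_\<beta> x]
  note db = differentiable_bilinear[OF bounded_bilinear_mult]
  have "dd (\<lambda>y. \<nu> y * \<nu> y * \<nu> y * \<beta> y) x v = dd (\<lambda>y. 1) x v"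
    using \<nu>(1) by (subst dd_cong_open[OF open_N x]) auto
  then have "3 * (\<nu> x * \<nu> x * \<beta> x) * (dd \<nu> x v + \<nu> x * w x v) = 0"
    by (simp add: dd_mult d db d\<beta>[OF x] dd_const algebra_simps)
  then have "dd \<nu> x v + \<nu> x * w x v = 0" using \<nu>(2)[OF x] \<beta>_nonzero[OF x] by simp
  then show ?thesis by linarith
qed

text \<open>The potentials of the three closed forms give the coordinates and the factor \<open>\<mu>\<close> that makes the lift
  \<open>\<mu> Z\<close> horizontal, that is, free of a \<open>Z\<close>-component in its derivative.\<close>

lemma local_normal_form:
  assumes x0: "x0 \<in> N"
  shows "\<exists>r>0. \<exists>\<psi> \<epsilon>1 \<epsilon>2 \<Phi>. ball x0 r \<subseteq> N \<and> b_unitary \<Phi> \<and> smooth_on (ball x0 r) \<epsilon>1 \<and> smooth_on (ball x0 r) \<epsilon>2 \<and>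
    smooth_on (ball x0 r) \<psi> \<and> (\<forall>x\<in>ball x0 r. dd \<psi> x (\<epsilon>1 x) = axis 1 1 \<and> dd \<psi> x (\<epsilon>2 x) = axis 2 1 \<and>
      hopf (Z x) = hopf (\<Phi> (surf (\<psi> x))))"
proof -
  obtain r where r: "r > 0" "ball x0 r \<subseteq> N" using open_N x0 open_contains_ball by blast
  let ?S = "ball x0 r"
  have inN: "x \<in> N" if "x \<in> ?S" for x using that r by blast
  note sub = smooth_on_subset[OF _ r(2)]
  define \<alpha>1 \<alpha>2 where "\<alpha>1 x v = \<omega>1 x v / \<nu> x" and "\<alpha>2 x v = \<nu> x * \<omega>2 x v" for x v
  have s\<alpha>: "smooth_on N (\<lambda>x. \<alpha>1 x v)" "smooth_on N (\<lambda>x. \<alpha>2 x v)" for v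
    unfolding \<alpha>1_def \<alpha>2_def by (intro smooth_on_divide smooth_on_mult open_N smooth_\<omega> smooth_\<nu> \<nu>(2); assumption)+
  have l\<alpha>: "linear (\<alpha>1 x)" "linear (\<alpha>2 x)" for x
    by (auto intro!: linearI simp: \<alpha>1_def \<alpha>2_def linear_add[OF \<omega>_linear(1)] linear_add[OF \<omega>_linear(2)]
        linear_scale[OF \<omega>_linear(1)] linear_scale[OF \<omega>_linear(2)] add_divide_distrib algebra_simps)
  note d = smooth_on_differentiable
  have \<omega>1: "\<omega>1 y v = \<nu> y * \<alpha>1 y v" if "y \<in> N" for y v using \<nu>(2)[OF that] by (simp add: \<alpha>1_def)
  have cl1: "dd (\<lambda>y. \<alpha>1 y v) x u = dd (\<lambda>y. \<alpha>1 y u) x v" if x: "x \<in> ?S" for x u v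
  proof -
    note xN = inN[OF x]
    have "dd (\<lambda>y. \<omega>1 y v) x u = dd (\<lambda>y. \<nu> y * \<alpha>1 y v) x u" for u v
      using \<omega>1 by (subst dd_cong_open[OF open_N xN]) auto
    then have "dd (\<lambda>y. \<omega>1 y v) x u = \<nu> x * dd (\<lambda>y. \<alpha>1 y v) x u - \<nu> x * w x u * \<alpha>1 x v" for u v
      by (simp add: dd_mult d[OF smooth_\<nu> xN] d[OF s\<alpha>(1) xN] d\<nu>[OF xN])
    then have "\<nu> x * dd (\<lambda>y. \<alpha>1 y v) x u = \<nu> x * dd (\<lambda>y. \<alpha>1 y u) x v"
      using structure_equations(1)[OF xN, of v u] \<omega>1[OF xN] by (simp add: algebra_simps)
    then show ?thesis using \<nu>(2)[OF xN] by simp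
  qed
  have cl2: "dd (\<lambda>y. \<alpha>2 y v) x u = dd (\<lambda>y. \<alpha>2 y u) x v" if x: "x \<in> ?S" for x u v
  proof -
    note xN = inN[OF x]
    have A: "dd (\<lambda>y. \<alpha>2 y v) x u = \<nu> x * dd (\<lambda>y. \<omega>2 y v) x u - \<nu> x * w x u * \<omega>2 x v" for u v
      unfolding \<alpha>2_def by (simp add: dd_mult d[OF smooth_\<nu> xN] d[OF smooth_\<omega>(2) xN] d\<nu>[OF xN])
    have "\<nu> x * (dd (\<lambda>y. \<omega>2 y v) x u - dd (\<lambda>y. \<omega>2 y u) x v) = \<nu> x * (w x u * \<omega>2 x v - w x v * \<omega>2 x u)"
      using structure_equations(2)[OF xN, of v u] by simp
    then show ?thesis unfolding A by (simp add: algebra_simps)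
  qed
  have \<kappa>: "\<kappa> = -1" using B_C(1)[OF x0] unfolding \<kappa>_def by simp
  have cl3: "dd (\<lambda>y. \<tau> y v) x u = dd (\<lambda>y. \<tau> y u) x v" if x: "x \<in> ?S" for x u v
    using structure_equations(3)[OF inN[OF x], of v u] unfolding \<kappa> by simp
  obtain P where P: "\<And>x. x \<in> ?S \<Longrightarrow> (P has_derivative \<alpha>1 x) (at x)"
    using closed_form_has_potential[of x0 r \<alpha>1] l\<alpha>(1) sub[OF s\<alpha>(1)] cl1 by blast
  obtain Q where Q: "\<And>x. x \<in> ?S \<Longrightarrow> (Q has_derivative \<alpha>2 x) (at x)"
    using closed_form_has_potential[of x0 r \<alpha>2] l\<alpha>(2) sub[OF s\<alpha>(2)] cl2 by blast
  obtain T where T: "\<And>x. x \<in> ?S \<Longrightarrow> (T has_derivative \<tau> x) (at x)"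
    using closed_form_has_potential[of x0 r \<tau>] \<tau>_linear[OF inN] sub[OF smooth_\<tau>] cl3 by blast
  define \<psi> :: "real^2 \<Rightarrow> real^2" where "\<psi> x = P x *\<^sub>R axis 1 1 + Q x *\<^sub>R axis 2 1" for x
  have d\<psi>: "(\<psi> has_derivative (\<lambda>v. \<alpha>1 x v *\<^sub>R axis 1 1 + \<alpha>2 x v *\<^sub>R axis 2 1)) (at x)" if "x \<in> ?S" for x
    unfolding \<psi>_def[abs_def] by (intro has_derivative_add has_derivative_scaleR_left P Q that)
  have smooth_\<psi>: "smooth_on ?S \<psi>"
    by (rule smooth_onI[OF _ d\<psi>]) (intro smooth_on_add smooth_on_scaleR smooth_on_const sub s\<alpha> open_ball | simp)+
  \<comment> \<open>The coordinate fields of \<open>\<psi>\<close>.\<close>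
  define \<epsilon>1 \<epsilon>2 where "\<epsilon>1 x = \<nu> x *\<^sub>R e1 x" and "\<epsilon>2 x = (1 / \<nu> x) *\<^sub>R e2 x" for x
  have s\<epsilon>: "smooth_on N \<epsilon>1" "smooth_on N \<epsilon>2"
    unfolding \<epsilon>1_def[abs_def] \<epsilon>2_def[abs_def]
    by (intro smooth_on_scaleR smooth_on_divide smooth_on_const open_N smooth_\<nu> smooth_e \<nu>(2); assumption)+
  have \<epsilon>: "dd \<psi> x (\<epsilon>1 x) = axis 1 1" "dd \<psi> x (\<epsilon>2 x) = axis 2 1" if x: "x \<in> ?S" for x
    unfolding dd_eqI[OF d\<psi>[OF x]] using \<omega>_dual[OF inN[OF x]] \<nu>(2)[OF inN[OF x]]
    by (simp_all add: \<alpha>1_def \<alpha>2_def \<epsilon>1_def \<epsilon>2_def linear_scale[OF \<omega>_linear(1)] linear_scale[OF \<omega>_linear(2)])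
  define m where "m = - Re (n x0)"
  have m: "m > 0" "n x0 = - complex_of_real m" using norm_Z[OF x0] bform_self_real[of "Z x0"] by (auto simp: m_def n_def)
  \<comment> \<open>The real constant makes \<open>bform Z' Z' = -1\<close> at \<open>x0\<close>.\<close>
  define \<mu> where "\<mu> x = exp (- (T x - T x0)) * complex_of_real (1 / sqrt m)" for x
  have d\<mu>: "(\<mu> has_derivative (\<lambda>v. - \<tau> x v * \<mu> x)) (at x)" if x: "x \<in> ?S" for x
  proof -
    have "((\<lambda>x. - (T x - T x0)) has_derivative (\<lambda>v. - (\<tau> x v - 0))) (at x)"
      by (intro has_derivative_minus has_derivative_diff T[OF x] has_derivative_const)
    from has_derivative_mult_left[OF has_derivative_compose[OF this DERIV_exp[unfolded has_field_derivative_def]]]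
    show ?thesis unfolding \<mu>_def[abs_def] by (rule has_derivative_eq_rhs) (simp add: fun_eq_iff)
  qed
  define Z' X Y where "Z' x = \<mu> x *s Z x" and "X x = (\<mu> x * \<nu> x) *s H1 x" and "Y x = (\<mu> x * (1 / \<nu> x)) *s H2 x" for x
  have "normal_frame ?S \<psi> Z' X Y"
    unfolding normal_frame_def
  proof
    fix x assume x: "x \<in> ?S"
    note xN = inN[OF x]
    define \<psi>' :: "real^2 \<Rightarrow> real^2" where "\<psi>' v = \<alpha>1 x v *\<^sub>R axis 1 1 + \<alpha>2 x v *\<^sub>R axis 2 1" for v
    have comp: "\<psi>' v $ 1 = \<alpha>1 x v" "\<psi>' v $ 2 = \<alpha>2 x v" for v by (simp_all add: \<psi>'_def axis_def)
    note D = smooth_on_has_derivative[OF _ xN]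
    note ds = bounded_bilinear.FDERIV[OF bounded_bilinear_smult]
    have d\<nu>_of_real: "((\<lambda>x. complex_of_real (\<nu> x)) has_derivative (\<lambda>v. complex_of_real (- \<nu> x * w x v))) (at x)"
      using bounded_linear.has_derivative[OF bounded_linear_of_real D[OF smooth_\<nu>]] by (simp only: d\<nu>[OF xN])
    have "((\<lambda>x. 1 / \<nu> x) has_derivative (\<lambda>v. 1 / \<nu> x * w x v)) (at x)"
      by (rule has_derivative_eq_rhs[OF has_derivative_divide'[OF has_derivative_const D[OF smooth_\<nu>] \<nu>(2)[OF xN]]])
        (use \<nu>(2)[OF xN] in \<open>simp add: fun_eq_iff d\<nu>[OF xN]\<close>)
    from bounded_linear.has_derivative[OF bounded_linear_of_real this]
    have d\<nu>_inv: "((\<lambda>x. complex_of_real (1 / \<nu> x)) has_derivative (\<lambda>v. complex_of_real (1 / \<nu> x * w x v))) (at x)" .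
    have L: "complex_of_real (\<nu> x) * complex_of_real (\<nu> x) * complex_of_real (\<nu> x) * complex_of_real (\<beta> x) = 1"
      unfolding of_real_mult[symmetric] \<nu>(1)[OF xN] by simp
    have L0: "complex_of_real (\<nu> x) \<noteq> 0" "complex_of_real (\<beta> x) \<noteq> 0" using \<nu>(2)[OF xN] \<beta>_nonzero[OF xN] by simp_all
    have o1: "\<omega>1 x v = \<nu> x * \<alpha>1 x v" and o2: "\<omega>2 x v = 1 / \<nu> x * \<alpha>2 x v" for v
      using \<nu>(2)[OF xN] by (simp_all add: \<alpha>1_def \<alpha>2_def)
    define l l' b where "l = complex_of_real (\<nu> x)" and "l' = complex_of_real (1 / \<nu> x)" and "b = complex_of_real (\<beta> x)"
    note fold = l_def[symmetric] l'_def[symmetric] b_def[symmetric]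
    have l: "l \<noteq> 0" "l' = 1 / l" "b = 1 / (l * l * l)"
      using L L0 by (auto simp: l_def l'_def b_def field_simps)
    have "(Z' has_derivative (\<lambda>v. \<psi>' v$1 *\<^sub>R X x + \<psi>' v$2 *\<^sub>R Y x)) (at x)"
      unfolding Z'_def[abs_def] X_def Y_def comp
      apply (rule has_derivative_eq_rhs[OF ds[OF d\<mu>[OF x] D[OF smooth_Z]]])
      unfolding dd_Z_frame[OF xN] o1 o2 scaleR_eq_smult of_real_mult of_real_minus fold
      unfolding l(2,3) using l(1) by (simp add: fun_eq_iff vec_eq_iff field_simps)
    moreover have "(X has_derivative (\<lambda>v. - (\<psi>' v$2 *\<^sub>R Z' x) + \<psi>' v$1 *\<^sub>R (\<i> *s Y x))) (at x)"
      unfolding Z'_def X_def[abs_def] Y_def comp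
      apply (rule has_derivative_eq_rhs[OF ds[OF has_derivative_mult[OF d\<mu>[OF x] d\<nu>_of_real] D[OF smooth_H(1)]]])
      unfolding dd_H_frame(1)[OF xN] o1 o2 scaleR_eq_smult of_real_mult of_real_minus fold B_eq[OF xN] \<kappa>
      unfolding l(2,3) using l(1) by (simp add: fun_eq_iff vec_eq_iff field_simps)
    moreover have "(Y has_derivative (\<lambda>v. - (\<psi>' v$1 *\<^sub>R Z' x) + \<psi>' v$2 *\<^sub>R (\<i> *s X x))) (at x)"
      unfolding Z'_def X_def Y_def[abs_def] comp
      apply (rule has_derivative_eq_rhs[OF ds[OF has_derivative_mult[OF d\<mu>[OF x] d\<nu>_inv] D[OF smooth_H(2)]]])
      unfolding dd_H_frame(2)[OF xN] o1 o2 scaleR_eq_smult of_real_mult of_real_minus fold B_eq[OF xN] \<kappa>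
      unfolding l(2,3) using l(1) by (simp add: fun_eq_iff vec_eq_iff field_simps)
    moreover have "(\<psi> has_derivative \<psi>') (at x)" unfolding \<psi>'_def[abs_def] by (rule d\<psi>[OF x])
    ultimately show "\<exists>\<psi>'. (\<psi> has_derivative \<psi>') (at x) \<and>
     (Z' has_derivative (\<lambda>v. \<psi>' v$1 *\<^sub>R X x + \<psi>' v$2 *\<^sub>R Y x)) (at x) \<and>
     (X has_derivative (\<lambda>v. - (\<psi>' v$2 *\<^sub>R Z' x) + \<psi>' v$1 *\<^sub>R (\<i> *s Y x))) (at x) \<and>
     (Y has_derivative (\<lambda>v. - (\<psi>' v$1 *\<^sub>R Z' x) + \<psi>' v$2 *\<^sub>R (\<i> *s X x))) (at x)" by blast
  qed
  moreover have "normal_gram (Z' x0) (X x0) (Y x0)"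
  proof -
    have \<mu>0: "\<mu> x0 = complex_of_real (1 / sqrt m)" by (simp add: \<mu>_def)
    have "1 / sqrt m * (1 / sqrt m) * m = 1" using m(1) by simp
    then have mm: "complex_of_real (1 / sqrt m) * complex_of_real (1 / sqrt m) * complex_of_real m = 1"
      by (simp only: of_real_mult[symmetric] of_real_1)
    have "\<nu> x0 * (1 / \<nu> x0) = 1" using \<nu>(2)[OF x0] by simp
    then have ll: "complex_of_real (\<nu> x0) * complex_of_real (1 / \<nu> x0) = 1" by (simp only: of_real_mult[symmetric] of_real_1)
    show ?thesis
      unfolding normal_gram_def Z'_def X_def Y_def \<mu>0 bform_scale_left bform_scale_right
      using HH[OF x0] ZH[OF x0] m(2) mm ll unfolding n_def \<kappa> complex_cnj_mult complex_cnj_complex_of_real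
      by (simp add: mult.assoc)
  qed
  ultimately obtain \<Phi> where \<Phi>: "b_unitary \<Phi>" "\<And>x. x \<in> ?S \<Longrightarrow> Z' x = \<Phi> (surf (\<psi> x))"
    using normal_frame_congruent_model[of ?S x0 \<psi> Z' X Y] r by auto
  have "hopf (Z x) = hopf (\<Phi> (surf (\<psi> x)))" if x: "x \<in> ?S" for x
  proof -
    have "\<mu> x \<noteq> 0" using m by (simp add: \<mu>_def)
    then have "hopf (\<mu> x *s Z x) = hopf (Z x)" by (rule hopf_scale)
    then show ?thesis using \<Phi>(2)[OF x] by (simp add: Z'_def)
  qed
  then show ?thesis using r \<Phi>(1) sub[OF s\<epsilon>(1)] sub[OF s\<epsilon>(2)] smooth_\<psi> \<epsilon> by blast
qed

end

section \<open>Holomorphic isometries\<close>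

lemma hopf_self: "z \<in> hopf z"
  unfolding hopf_def by (rule CollectI, rule exI[of _ 1]) simp

lemma hopf_eqD: "hopf z = hopf z' \<Longrightarrow> \<exists>c. c \<noteq> 0 \<and> z = c *s z'"
  using hopf_self[of z] by (auto simp: hopf_def)

lemma cnj_mult_self: "cnj c * c = complex_of_real ((cmod c)\<^sup>2)"
  by (simp only: complex_norm_square mult.commute)

lemma hopf_in_CH21: "hopf z \<in> CH21 \<longleftrightarrow> Re (bform z z) < 0"
proof
  assume "hopf z \<in> CH21"
  then obtain z' where z': "bform z' z' = -1" "hopf z = hopf z'" by (auto simp: CH21_def H52_def)
  then obtain c where c: "c \<noteq> 0" "z = c *s z'" using hopf_eqD by blast
  have "bform z z = - complex_of_real ((cmod c)\<^sup>2)"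
    unfolding c(2) bform_scale z'(1) cnj_mult_self by simp
  then show "Re (bform z z) < 0" using c(1) by simp
next
  assume n: "Re (bform z z) < 0"
  define m where "m = - Re (bform z z)"
  have m: "m > 0" "bform z z = - complex_of_real m" using n bform_self_real[of z] by (auto simp: m_def)
  have "bform (complex_of_real (1 / sqrt m) *s z) (complex_of_real (1 / sqrt m) *s z) = complex_of_real (1 / sqrt m * (1 / sqrt m) * - m)"
    unfolding bform_scale m(2) by (simp only: complex_cnj_complex_of_real of_real_mult of_real_minus)
  also have "1 / sqrt m * (1 / sqrt m) * - m = -1" using m(1) by simp
  finally have "complex_of_real (1 / sqrt m) *s z \<in> H52" by (simp add: H52_def)
  moreover have "hopf (complex_of_real (1 / sqrt m) *s z) = hopf z" using m(1) by (intro hopf_scale) simp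
  ultimately show "hopf z \<in> CH21" unfolding CH21_def by (metis imageI)
qed

lemma hopf_in_ch_dom: "hopf z \<in> ch_dom k \<longleftrightarrow> Re (bform z z) < 0 \<and> z$k \<noteq> 0"
  using hopf_self[of z] by (auto simp: ch_dom_def hopf_in_CH21) (auto simp: hopf_def)

lemma b_unitary_hopf: assumes "b_unitary \<Phi>" shows "\<Phi> ` hopf z = hopf (\<Phi> z)"
  by (auto simp: hopf_def b_unitary_simps[OF assms] image_iff) (metis b_unitary_simps(2)[OF assms])

lemma CH21_hopf: "l \<in> CH21 \<Longrightarrow> \<exists>z. l = hopf z \<and> Re (bform z z) < 0"
  by (auto simp: CH21_def H52_def)

lemma b_unitary_image_CH21: "b_unitary \<Phi> \<Longrightarrow> l \<in> CH21 \<Longrightarrow> \<Phi> ` l \<in> CH21"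
  using CH21_hopf[of l] by (auto simp: b_unitary_hopf hopf_in_CH21 b_unitary_simps)

lemma b_unitary_id: "b_unitary (\<lambda>v. v)"
  by (simp add: b_unitary_def)

lemma b_unitary_inverse:
  assumes "b_unitary \<Phi>"
  shows "\<exists>\<Psi>. b_unitary \<Psi> \<and> (\<forall>v. \<Psi> (\<Phi> v) = v) \<and> (\<forall>v. \<Phi> (\<Psi> v) = v)"
proof -
  note s = b_unitary_simps[OF assms]
  have inj: "inj \<Phi>"
  proof (rule injI)
    fix v w assume "\<Phi> v = \<Phi> w"
    then have "bform (\<Phi> (v - w)) (\<Phi> u) = 0" for u by (simp add: s(5) bform_zero)
    then have "bform (v - w) u = 0" for u by (simp add: s(6))
    then show "v = w" using bform_nondegenerate[of "v - w"] by simp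
  qed
  then have "surj \<Phi>"
    using linear_injective_imp_surjective[OF bounded_linear.linear[OF b_unitary_bounded_linear[OF assms]]] by simp
  then have inv: "\<Phi> (inv \<Phi> v) = v" "inv \<Phi> (\<Phi> v) = v" for v using inj by (simp_all add: surj_f_inv_f)
  have "b_unitary (inv \<Phi>)"
    unfolding b_unitary_def
  proof (intro conjI allI)
    fix c d v w
    have "\<Phi> (inv \<Phi> (c *s v + d *s w)) = \<Phi> (c *s inv \<Phi> v + d *s inv \<Phi> w)" by (simp add: s inv)
    then show "inv \<Phi> (c *s v + d *s w) = c *s inv \<Phi> v + d *s inv \<Phi> w" using inj by (simp add: inj_eq)
    show "bform (inv \<Phi> v) (inv \<Phi> w) = bform v w" using s(6)[of "inv \<Phi> v" "inv \<Phi> w"] by (simp add: inv)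
  qed
  then show ?thesis using inv by blast
qed

lemma affine_coord_eq: "affine_coord l z = inverse (z$l) *s (\<chi> i. z $ (if i = 1 then l + 1 else l + 2))"
  by (simp add: affine_coord_def vec_eq_iff divide_inverse mult.commute)

lemma smooth_on_affine_coord: "smooth_on {z. z$l \<noteq> 0} (affine_coord l)"
proof -
  have o: "open {z::complex^3. z $ l \<noteq> 0}" by (intro open_Collect_neq continuous_intros)
  have "bounded_linear (\<lambda>z::complex^3. \<chi> i::2. z $ (if i = 1 then l + 1 else l + 2))"
    unfolding linear_conv_bounded_linear[symmetric] by (rule linearI) (auto simp: vec_eq_iff)
  from smooth_on_linear[OF this o smooth_on_id[OF o]] show ?thesis unfolding affine_coord_eq[abs_def]
    using smooth_on_smult[OF o smooth_on_inverse[OF o smooth_on_linear[OF bounded_linear_vec_nth o smooth_on_id[OF o]]]] by simp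
qed

text \<open>The differential of the affine coordinates only forgets multiples of the base point \<open>z\<close>.\<close>

lemma affine_coord_deriv_lift:
  assumes "z$l \<noteq> 0"
  shows "ch_lin l (\<chi> i. (X $ (if i = 1 then l + 1 else l + 2) - affine_coord l z $ i * X$l) / z$l)
    = (1 / z$l) *s (X - (X$l / z$l) *s z)"
  unfolding vec_eq_iff
proof
  fix i
  show "ch_lin l (\<chi> i. (X $ (if i = 1 then l + 1 else l + 2) - affine_coord l z $ i * X$l) / z$l) $ i
    = ((1 / z$l) *s (X - (X$l / z$l) *s z)) $ i"
    using ex3[of i l]
  proof (elim disjE)
    assume i: "i = l" show ?thesis unfolding i using assms by (simp add: ch_lin_comp)
  next
    assume i: "i = l + 1"
    have ne: "(l + 1 = l) = False" using mod3[of l] by blast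
    have "ch_lin l u $ i = u$1" for u unfolding ch_lin_def i by (simp only: ne vec_lambda_beta if_False if_True refl)
    then show ?thesis by (simp add: affine_coord_def i diff_divide_distrib mult.commute)
  next
    assume i: "i = l + 2"
    have ne: "(l + 2 = l) = False" "(l + 2 = l + 1) = False" using mod3[of l] by blast+
    have "ch_lin l u $ i = u$2" for u unfolding ch_lin_def i by (simp only: ne vec_lambda_beta if_False)
    then show ?thesis by (simp add: affine_coord_def i diff_divide_distrib mult.commute)
  qed
qed

lemma hor_scale_base: "c \<noteq> 0 \<Longrightarrow> hor (c *s Z) X = hor Z X"
  by (simp add: hor_def bform_simps vec_eq_iff)

lemma hor_self: "bform Z Z \<noteq> 0 \<Longrightarrow> hor Z Z = 0"
  by (simp add: hor_def)

text \<open>In affine charts a unitary map is a projective transformation. Its differential lifts to the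
  unitary map itself on horizontal vectors, up to the factor between the two lifts of the point.\<close>

locale unitary_chart_rep =
  fixes \<Phi> :: "complex^3 \<Rightarrow> complex^3" and T :: "(complex^3) set \<Rightarrow> (complex^3) set" and k l :: 3
  assumes \<Phi>: "b_unitary \<Phi>" and T: "\<And>L. L \<in> CH21 \<Longrightarrow> T L = \<Phi> ` L"
begin

abbreviation D where "D \<equiv> ch_map_dom T k l"

lemma dom_eq: "D = {w \<in> ch_range k. \<Phi> (ch_lift k w) $ l \<noteq> 0}"
proof -
  have "T (hopf z) = hopf (\<Phi> z)" if "Re (bform z z) < 0" for z
    using T[of "hopf z"] that b_unitary_hopf[OF \<Phi>] by (simp add: hopf_in_CH21)
  then show ?thesis
    by (auto simp: ch_map_dom_def hopf_in_ch_dom ch_range_def ch_lift_comp b_unitary_simps[OF \<Phi>])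
qed

lemma rep_eq: "w \<in> D \<Longrightarrow> ch_map_rep T k l w = affine_coord l (\<Phi> (ch_lift k w))"
  using T[of "hopf (ch_lift k w)"] b_unitary_hopf[OF \<Phi>]
  by (simp add: ch_map_rep_def dom_eq ch_range_def hopf_in_CH21 coord_hopf)

lemma smooth_lift: "smooth_on UNIV (\<lambda>w. \<Phi> (ch_lift k w))"
  unfolding ch_lift_eq
  by (intro smooth_on_linear[OF b_unitary_bounded_linear[OF \<Phi>]] smooth_on_add smooth_on_const
      smooth_on_linear[OF bounded_linear_ch_lin] smooth_on_id open_UNIV)

lemma open_dom: "open D"
proof -
  have "continuous_on UNIV (\<lambda>w. \<Phi> (ch_lift k w))" by (rule smooth_on_continuous[OF smooth_lift])
  then have "open {w. \<Phi> (ch_lift k w) $ l \<noteq> 0}"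
    by (intro open_Collect_neq continuous_intros)
  then have "open (ch_range k \<inter> {w. \<Phi> (ch_lift k w) $ l \<noteq> 0})" by (intro open_Int open_ch_range)
  then show ?thesis unfolding dom_eq by (simp add: Int_def)
qed

lemma smooth_rep: "smooth_on D (ch_map_rep T k l)"
proof -
  have o: "open {z::complex^3. z $ l \<noteq> 0}" by (intro open_Collect_neq continuous_intros)
  have "smooth_on D (\<lambda>w. affine_coord l (\<Phi> (ch_lift k w)))"
    by (rule smooth_on_compose[OF open_dom o smooth_on_subset[OF smooth_lift] smooth_on_affine_coord]) (auto simp: dom_eq)
  then show ?thesis using smooth_on_cong[OF open_dom rep_eq] by simp
qed

lemma dd_rep: assumes w: "w \<in> D"
  shows "dd (ch_map_rep T k l) w u = (\<chi> i. (\<Phi> (ch_lin k u) $ (if i = 1 then l + 1 else l + 2)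
     - affine_coord l (\<Phi> (ch_lift k w)) $ i * \<Phi> (ch_lin k u) $ l) / \<Phi> (ch_lift k w) $ l)"
proof -
  have nz: "\<Phi> (ch_lift k w) $ l \<noteq> 0" using w by (simp add: dom_eq)
  have 1: "((\<lambda>w. \<Phi> (ch_lift k w)) has_derivative (\<lambda>u. \<Phi> (ch_lin k u))) (at w)"
    by (rule bounded_linear.has_derivative[OF b_unitary_bounded_linear[OF \<Phi>] has_derivative_ch_lift])
  have "frechet_derivative (ch_map_rep T k l) (at w) = frechet_derivative (\<lambda>w. affine_coord l (\<Phi> (ch_lift k w))) (at w)"
    by (rule dd_cong_open[OF open_dom w rep_eq])
  then show ?thesis using dd_eqI[OF has_derivative_compose[OF 1 affine_coord_deriv[OF nz]]] by simp
qed

lemma dd_rep_J: assumes w: "w \<in> D" shows "dd (ch_map_rep T k l) w (J u) = J (dd (ch_map_rep T k l) w u)"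
  unfolding dd_rep[OF w] J_def ch_lin_smult b_unitary_simps[OF \<Phi>]
  by (simp add: vec_eq_iff algebra_simps diff_divide_distrib)

lemma isometric:
  assumes w: "w \<in> D" shows "pullback (ch_metric l) (ch_map_rep T k l) w u v = ch_metric k w u v"
proof -
  define Z where "Z = ch_lift k w"
  define c where "c = 1 / \<Phi> Z $ l"
  have nz: "\<Phi> Z $ l \<noteq> 0" and wk: "w \<in> ch_range k" using w by (simp_all add: dom_eq Z_def)
  have c: "c \<noteq> 0" using nz by (simp add: c_def)
  have lift: "ch_lift l (ch_map_rep T k l w) = c *s \<Phi> Z"
    using lift_affine_coord[OF nz] by (simp add: rep_eq[OF w] c_def Z_def)
  have n: "bform Z Z \<noteq> 0" "Re (bform Z Z) < 0" using ch_range_nonzero[OF wk] wk by (auto simp: Z_def ch_range_def)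
  have bl: "bform (c *s \<Phi> X) (c *s \<Phi> Y) = complex_of_real ((cmod c)\<^sup>2) * bform X Y" for X Y
    by (simp only: bform_scale cnj_mult_self b_unitary_simps[OF \<Phi>])
  have "Re (bform (c *s \<Phi> Z) (c *s \<Phi> Z)) = (cmod c)\<^sup>2 * Re (bform Z Z)" unfolding bl by simp
  also have "\<dots> < 0" using n(2) c by (intro mult_pos_neg) auto
  finally have wl: "ch_map_rep T k l w \<in> ch_range l" by (simp add: ch_range_def lift)
  have lifted: "lifted l (ch_map_rep T k l w) (dd (ch_map_rep T k l) w u) = c *s \<Phi> (lifted k w u)" for u
  proof -
    let ?X = "\<Phi> (ch_lin k u)"
    have "lifted l (ch_map_rep T k l w) (dd (ch_map_rep T k l) w u) = hor (\<Phi> Z) (c *s (?X - (?X$l / \<Phi> Z$l) *s \<Phi> Z))"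
      unfolding lifted_eq_hor lift hor_scale_base[OF c] dd_rep[OF w] affine_coord_deriv_lift[OF nz[unfolded Z_def]]
      by (simp add: c_def Z_def)
    also have "\<dots> = c *s hor (\<Phi> Z) ?X"
      using hor_self[of "\<Phi> Z"] n(1) by (simp add: hor_smult hor_diff b_unitary_simps[OF \<Phi>])
    also have "hor (\<Phi> Z) ?X = \<Phi> (lifted k w u)"
      by (simp add: lifted_eq_hor hor_def b_unitary_simps[OF \<Phi>] Z_def)
    finally show ?thesis .
  qed
  show ?thesis
    unfolding pullback_def ch_metric_eq_Re_herm[OF wl] ch_metric_eq_Re_herm[OF wk] ch_herm_def lifted lift bl Z_def[symmetric]
    using c by simp
qed

end

lemma ch_holomorphic_unitary:
  assumes "b_unitary \<Phi>" "\<And>L. L \<in> CH21 \<Longrightarrow> T L = \<Phi> ` L" shows "ch_holomorphic T"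
proof -
  interpret unitary_chart_rep \<Phi> T k l for k l using assms by unfold_locales
  show ?thesis unfolding ch_holomorphic_def
    using open_dom smooth_rep dd_rep_J assms b_unitary_image_CH21 by auto
qed

text \<open>The inverse of the isometry is induced by the inverse unitary map. The two inverses agree on
  \<open>CH21\<close>, so they have the same expressions in charts.\<close>

lemma holomorphic_isometry_unitary:
  assumes \<Phi>: "b_unitary \<Phi>" shows "holomorphic_isometry (\<lambda>L. \<Phi> ` L)"
proof -
  obtain \<Psi> where \<Psi>: "b_unitary \<Psi>" "\<And>v. \<Psi> (\<Phi> v) = v" "\<And>v. \<Phi> (\<Psi> v) = v"
    using b_unitary_inverse[OF \<Phi>] by blast
  have c: "\<Psi> ` \<Phi> ` L = L" "\<Phi> ` \<Psi> ` L = L" for L by (simp_all add: image_image \<Psi>)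
  have bij: "bij_betw (\<lambda>L. \<Phi> ` L) CH21 CH21"
    by (rule bij_betw_byWitness[where f' = "\<lambda>L. \<Psi> ` L"]) (auto simp: c b_unitary_image_CH21 \<Phi> \<Psi>(1))
  have "inv_into CH21 (\<lambda>L. \<Phi> ` L) L = \<Psi> ` L" if "L \<in> CH21" for L
    using bij that b_unitary_image_CH21[OF \<Psi>(1) that] by (intro inv_into_f_eq) (auto simp: bij_betw_def c)
  then have inv: "ch_holomorphic (inv_into CH21 (\<lambda>L. \<Phi> ` L))" by (rule ch_holomorphic_unitary[OF \<Psi>(1)])
  interpret unitary_chart_rep \<Phi> "\<lambda>L. \<Phi> ` L" k l for k l using \<Phi> by unfold_locales auto
  show ?thesis
    unfolding holomorphic_isometry_def using inv bij ch_holomorphic_unitary[OF \<Phi>] isometric by auto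
qed

section \<open>Rigidity of the model\<close>

lemma smooth_on_model: "smooth_on UNIV (model \<alpha> \<beta> \<gamma>)"
  unfolding smooth_on_def
proof
  fix n show "Ck_on n UNIV (model \<alpha> \<beta> \<gamma>)"
  proof (induction n arbitrary: \<alpha> \<beta> \<gamma>)
    case 0 show ?case
      by (auto intro!: continuous_at_imp_continuous_on has_derivative_continuous[OF has_derivative_model])
  next
    case (Suc n)
    show ?case by (rule Ck_on_SucI[OF open_UNIV has_derivative_model]) (rule Suc)
  qed
qed

lemma smooth_on_surf: "smooth_on UNIV surf" "smooth_on UNIV surf_x" "smooth_on UNIV surf_y"
  unfolding surf_def surf_x_def surf_y_def by (rule smooth_on_model)+

definition swap2 :: "real^2 \<Rightarrow> real^2" where
  "swap2 v = v$2 *\<^sub>R axis 1 1 + v$1 *\<^sub>R axis 2 1"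

lemma swap2_nth: "swap2 v $ 1 = v$2" "swap2 v $ 2 = v$1"
  by (simp_all add: swap2_def axis_def)

lemma swap2_swap2: "swap2 (swap2 v) = v"
  by (simp add: vec_eq_iff forall_2 swap2_nth)

lemma bounded_linear_swap2: "bounded_linear swap2"
  unfolding linear_conv_bounded_linear[symmetric]
  by (rule linearI) (simp_all add: vec_eq_iff forall_2 swap2_nth)

lemma has_derivative_shift:
  assumes "bounded_linear \<sigma>" shows "((\<lambda>v. t + \<sigma> v) has_derivative \<sigma>) (at v)"
  using has_derivative_add[OF has_derivative_const bounded_linear.has_derivative[OF assms has_derivative_ident]] by simp

text \<open>A frame of the model at one point determines the frame at all other points. The exchange of the
  null directions exchanges \<open>surf_x\<close> and \<open>surf_y\<close>.\<close>

lemma model_frame_determines: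
  assumes \<Phi>: "b_unitary \<Phi>" "b_unitary \<Phi>'" and 0: "\<Phi> (surf t) = \<Phi>' (surf t')"
    and \<sigma>: "\<sigma> = (\<lambda>v. v) \<and> \<Phi> (surf_x t) = \<Phi>' (surf_x t') \<and> \<Phi> (surf_y t) = \<Phi>' (surf_y t') \<or>
       \<sigma> = swap2 \<and> \<Phi> (surf_x t) = \<Phi>' (surf_y t') \<and> \<Phi> (surf_y t) = \<Phi>' (surf_x t')"
  shows "\<Phi> (surf (t + v)) = \<Phi>' (surf (t' + \<sigma> v))"
proof -
  define G1 G2 where "G1 = (if \<sigma> = (\<lambda>v. v) then surf_x else surf_y)" and "G2 = (if \<sigma> = (\<lambda>v. v) then surf_y else surf_x)"
  have ne: "swap2 \<noteq> (\<lambda>v. v)"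
  proof
    assume "swap2 = (\<lambda>v. v)"
    then have "axis 1 (1::real) $ (2::2) = axis 1 1 $ (1::2)" by (metis swap2_nth(1))
    then show False by (simp add: axis_def)
  qed
  note lin = b_unitary_bounded_linear[OF \<Phi>(2), THEN bounded_linear.has_derivative]
  note sh = has_derivative_shift[OF bounded_linear_ident] has_derivative_shift[OF bounded_linear_swap2]
  have "normal_frame UNIV (\<lambda>v. t + v) (\<lambda>v. \<Phi>' (surf (t' + \<sigma> v))) (\<lambda>v. \<Phi>' (G1 (t' + \<sigma> v))) (\<lambda>v. \<Phi>' (G2 (t' + \<sigma> v)))"
    unfolding normal_frame_def
  proof (intro ballI exI conjI)
    fix v :: "real^2"
    show "((\<lambda>v. t + v) has_derivative (\<lambda>v. v)) (at v)" by (rule sh(1))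
    have s: "\<sigma> = (\<lambda>v. v) \<or> \<sigma> = swap2" using \<sigma> by blast
    show "((\<lambda>v. \<Phi>' (surf (t' + \<sigma> v))) has_derivative (\<lambda>h. h$1 *\<^sub>R \<Phi>' (G1 (t' + \<sigma> v)) + h$2 *\<^sub>R \<Phi>' (G2 (t' + \<sigma> v)))) (at v)"
      using s lin[OF has_derivative_compose[OF sh(1) has_derivative_surf(1)], of t' v] lin[OF has_derivative_compose[OF sh(2) has_derivative_surf(1)], of t' v]
      by (auto simp: G1_def G2_def ne swap2_nth b_unitary_simps[OF \<Phi>(2)] add.commute)
    show "((\<lambda>v. \<Phi>' (G1 (t' + \<sigma> v))) has_derivative (\<lambda>h. - (h$2 *\<^sub>R \<Phi>' (surf (t' + \<sigma> v))) + h$1 *\<^sub>R (\<i> *s \<Phi>' (G2 (t' + \<sigma> v))))) (at v)"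
      using s lin[OF has_derivative_compose[OF sh(1) has_derivative_surf(2)], of t' v] lin[OF has_derivative_compose[OF sh(2) has_derivative_surf(3)], of t' v]
      by (auto simp: G1_def G2_def ne swap2_nth b_unitary_simps[OF \<Phi>(2)])
    show "((\<lambda>v. \<Phi>' (G2 (t' + \<sigma> v))) has_derivative (\<lambda>h. - (h$1 *\<^sub>R \<Phi>' (surf (t' + \<sigma> v))) + h$2 *\<^sub>R (\<i> *s \<Phi>' (G1 (t' + \<sigma> v))))) (at v)"
      using s lin[OF has_derivative_compose[OF sh(1) has_derivative_surf(3)], of t' v] lin[OF has_derivative_compose[OF sh(2) has_derivative_surf(2)], of t' v]
      by (auto simp: G1_def G2_def ne swap2_nth b_unitary_simps[OF \<Phi>(2)])
  qed
  moreover have \<sigma>0: "\<sigma> 0 = 0" using \<sigma> by (auto simp: vec_eq_iff forall_2 swap2_nth)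
  have G: "\<Phi>' (G1 t') = \<Phi> (surf_x t)" "\<Phi>' (G2 t') = \<Phi> (surf_y t)" using \<sigma> ne by (auto simp: G1_def G2_def)
  have "normal_gram (\<Phi>' (surf (t' + \<sigma> 0))) (\<Phi>' (G1 (t' + \<sigma> 0))) (\<Phi>' (G2 (t' + \<sigma> 0)))"
    using normal_gram_surf[of t] unfolding normal_gram_def \<sigma>0 add_0_right G 0[symmetric] b_unitary_simps[OF \<Phi>(1)] .
  ultimately obtain \<Psi> where \<Psi>: "b_unitary \<Psi>" "\<And>v. \<Phi>' (surf (t' + \<sigma> v)) = \<Psi> (surf (t + v))"
      "\<And>v. \<Phi>' (G1 (t' + \<sigma> v)) = \<Psi> (surf_x (t + v))" "\<And>v. \<Phi>' (G2 (t' + \<sigma> v)) = \<Psi> (surf_y (t + v))"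
    using normal_frame_congruent_model[OF open_UNIV convex_UNIV UNIV_I[of 0]] by blast
  have "\<Psi> X = \<Phi> X" for X
  proof -
    have e: "\<Psi> (surf t) = \<Phi> (surf t)" "\<Psi> (surf_x t) = \<Phi> (surf_x t)" "\<Psi> (surf_y t) = \<Phi> (surf_y t)"
      using \<Psi>(2-4)[of 0] by (simp_all add: \<sigma>0 G 0)
    show ?thesis
      by (subst (1 2) normal_gram_expansion[OF normal_gram_surf[of t], of X])
        (simp only: b_unitary_simps[OF \<Psi>(1)] b_unitary_simps[OF \<Phi>(1)] e)
  qed
  then show ?thesis using \<Psi>(2) by simp
qed

lemma null_cubic:
  fixes p q :: real
  assumes "p * q = 0" "p ^ 3 + q ^ 3 = 1" shows "p = 1 \<and> q = 0 \<or> p = 0 \<and> q = 1"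
proof -
  have one: "r = 1" if "r ^ 3 = 1" for r :: real
    using that real_root_pos_unique[of 3 r 1] odd_real_root_unique[of 3 r 1] by simp
  show ?thesis using assms one by auto
qed

text \<open>The induced metric \<open>- 2 dx dy\<close> and the cubic form \<open>dx\<^sup>3 + dy\<^sup>3\<close> of the second
  fundamental form are invariants. Together they leave only the exchange of the coordinates.\<close>

lemma model_reparametrization:
  fixes S :: "(real^2) set"
  assumes \<Phi>: "b_unitary \<Phi>" "b_unitary \<Phi>'" and S: "open S" "x0 \<in> S"
    and a: "smooth_on S a" "smooth_on S a'" and eq: "\<And>x. x \<in> S \<Longrightarrow> \<Phi> (surf (a x)) = \<Phi>' (surf (a' x))"
    and v: "dd a x0 v1 = axis 1 1" "dd a x0 v2 = axis 2 1"
  shows "\<exists>\<sigma>. (\<sigma> = (\<lambda>v. v) \<or> \<sigma> = swap2) \<and> (\<forall>v. \<Phi> (surf (a x0 + v)) = \<Phi>' (surf (a' x0 + \<sigma> v)))"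
proof -
  have dF: "((\<lambda>x. \<Phi> (surf (a x))) has_derivative (\<lambda>v. dd a x v$1 *\<^sub>R \<Phi> (surf_x (a x)) + dd a x v$2 *\<^sub>R \<Phi> (surf_y (a x)))) (at x)"
    if "b_unitary \<Phi>" "smooth_on S a" "x \<in> S" for \<Phi> a x
    using bounded_linear.has_derivative[OF b_unitary_bounded_linear[OF that(1)]
        has_derivative_compose[OF smooth_on_has_derivative[OF that(2,3)] has_derivative_surf(1)]]
    by (simp add: b_unitary_simps[OF that(1)])
  define E where "E \<Phi> a v x = dd a x v$1 *\<^sub>R \<Phi> (surf_x (a x)) + dd a x v$2 *\<^sub>R \<Phi> (surf_y (a x))"
    for \<Phi> :: "complex^3 \<Rightarrow> complex^3" and a :: "real^2 \<Rightarrow> real^2" and v x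
  have first: "E \<Phi> a v x = E \<Phi>' a' v x" if x: "x \<in> S" for v x
  proof -
    have "dd (\<lambda>x. \<Phi> (surf (a x))) x v = dd (\<lambda>x. \<Phi>' (surf (a' x))) x v"
      by (subst dd_cong_open[OF S(1) x eq]) auto
    then show ?thesis
      unfolding E_def dd_eqI[OF dF[OF \<Phi>(1) a(1) x]] dd_eqI[OF dF[OF \<Phi>(2) a(2) x]] .
  qed
  note g = normal_gram_surf[unfolded normal_gram_def] normal_gram_flip[OF normal_gram_surf]
  have metric: "bform (E \<Phi> a v x) (E \<Phi> a v x) = complex_of_real (- 2 * (dd a x v$1 * dd a x v$2))" if "b_unitary \<Phi>" for \<Phi> a v x
    by (simp add: E_def bform_simps b_unitary_simps[OF that] g)
  \<comment> \<open>The second derivatives of the parameters contribute tangent vectors, whose products with the first derivative are real.\<close>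
  have cubic: "Im (bform (E \<Phi> a v x0) (dd (E \<Phi> a v) x0 v)) = - ((dd a x0 v$1) ^ 3 + (dd a x0 v$2) ^ 3)"
    if U: "b_unitary \<Phi>" and sa: "smooth_on S a" for \<Phi> a v
  proof -
    let ?w = "dd a x0 v" and ?y = "dd (\<lambda>x. dd a x v) x0 v"
    note da = smooth_on_has_derivative[OF sa S(2)]
    note lin = bounded_linear.has_derivative[OF b_unitary_bounded_linear[OF U]]
    note dc = bounded_linear.has_derivative[OF bounded_linear_vec_nth smooth_on_has_derivative[OF smooth_on_dd[OF sa] S(2)]]
    have "(E \<Phi> a v has_derivative (\<lambda>h. (dd a x0 v$1 *\<^sub>R \<Phi> (- (dd a x0 h$2 *\<^sub>R surf (a x0)) + dd a x0 h$1 *\<^sub>R (\<i> *s surf_y (a x0)))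
        + (dd (\<lambda>x. dd a x v) x0 h$1) *\<^sub>R \<Phi> (surf_x (a x0)))
       + (dd a x0 v$2 *\<^sub>R \<Phi> (- (dd a x0 h$1 *\<^sub>R surf (a x0)) + dd a x0 h$2 *\<^sub>R (\<i> *s surf_x (a x0)))
        + (dd (\<lambda>x. dd a x v) x0 h$2) *\<^sub>R \<Phi> (surf_y (a x0))))) (at x0)"
      unfolding E_def[abs_def]
      by (rule has_derivative_add[OF has_derivative_scaleR[OF dc lin[OF has_derivative_compose[OF da has_derivative_surf(2)]]]
          has_derivative_scaleR[OF dc lin[OF has_derivative_compose[OF da has_derivative_surf(3)]]]])
    from dd_eqI[OF this, of v]
    have D: "dd (E \<Phi> a v) x0 v = (?w$1 *\<^sub>R \<Phi> (- (?w$2 *\<^sub>R surf (a x0)) + ?w$1 *\<^sub>R (\<i> *s surf_y (a x0))) + ?y$1 *\<^sub>R \<Phi> (surf_x (a x0)))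
       + (?w$2 *\<^sub>R \<Phi> (- (?w$1 *\<^sub>R surf (a x0)) + ?w$2 *\<^sub>R (\<i> *s surf_x (a x0))) + ?y$2 *\<^sub>R \<Phi> (surf_y (a x0)))" .
    show ?thesis
      unfolding D E_def by (simp add: bform_simps b_unitary_simps[OF U] g power3_eq_cube)
  qed
  have inv1: "dd a x0 v$1 * dd a x0 v$2 = dd a' x0 v$1 * dd a' x0 v$2" for v
  proof -
    have "complex_of_real (- 2 * (dd a x0 v$1 * dd a x0 v$2)) = complex_of_real (- 2 * (dd a' x0 v$1 * dd a' x0 v$2))"
      using metric[OF \<Phi>(1), of a v x0] metric[OF \<Phi>(2), of a' v x0] first[OF S(2), of v] by metis
    then show ?thesis unfolding of_real_eq_iff by simp
  qed
  have inv2: "(dd a x0 v$1) ^ 3 + (dd a x0 v$2) ^ 3 = (dd a' x0 v$1) ^ 3 + (dd a' x0 v$2) ^ 3" for v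
  proof -
    have "frechet_derivative (E \<Phi> a v) (at x0) = frechet_derivative (E \<Phi>' a' v) (at x0)"
      by (rule dd_cong_open[OF S first])
    then have "- ((dd a x0 v$1) ^ 3 + (dd a x0 v$2) ^ 3) = - ((dd a' x0 v$1) ^ 3 + (dd a' x0 v$2) ^ 3)"
      using cubic[OF \<Phi>(1) a(1), of v] cubic[OF \<Phi>(2) a(2), of v] first[OF S(2), of v] by metis
    then show ?thesis by linarith
  qed
  let ?p = "dd a' x0 v1" and ?q = "dd a' x0 v2"
  have ax: "axis 1 1 $ (1::2) = (1::real)" "axis 1 1 $ (2::2) = (0::real)" "axis 2 1 $ (1::2) = (0::real)" "axis 2 1 $ (2::2) = (1::real)"
    by (simp_all add: axis_def)
  have p: "?p$1 = 1 \<and> ?p$2 = 0 \<or> ?p$1 = 0 \<and> ?p$2 = 1"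
    using inv1[of v1] inv2[of v1] by (intro null_cubic) (simp_all add: v ax)
  have q: "?q$1 = 1 \<and> ?q$2 = 0 \<or> ?q$1 = 0 \<and> ?q$2 = 1"
    using inv1[of v2] inv2[of v2] by (intro null_cubic) (simp_all add: v ax)
  \<comment> \<open>The invariants of \<open>v1 + v2\<close> exclude that \<open>?p\<close> and \<open>?q\<close> coincide.\<close>
  have "(?p + ?q)$1 * (?p + ?q)$2 = 1"
    using inv1[of "v1 + v2"] linear_add[OF has_derivative_linear[OF smooth_on_has_derivative[OF a(1) S(2)]], of v1 v2]
      linear_add[OF has_derivative_linear[OF smooth_on_has_derivative[OF a(2) S(2)]], of v1 v2] by (simp add: v ax)
  with p q have "?p$1 = 1 \<and> ?p$2 = 0 \<and> ?q$1 = 0 \<and> ?q$2 = 1 \<or> ?p$1 = 0 \<and> ?p$2 = 1 \<and> ?q$1 = 1 \<and> ?q$2 = 0" by auto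
  moreover have "\<Phi> (surf_x (a x0)) = ?p$1 *\<^sub>R \<Phi>' (surf_x (a' x0)) + ?p$2 *\<^sub>R \<Phi>' (surf_y (a' x0))"
    "\<Phi> (surf_y (a x0)) = ?q$1 *\<^sub>R \<Phi>' (surf_x (a' x0)) + ?q$2 *\<^sub>R \<Phi>' (surf_y (a' x0))"
    using first[OF S(2), of v1] first[OF S(2), of v2] by (simp_all add: E_def v ax)
  ultimately have "(\<Phi> (surf_x (a x0)) = \<Phi>' (surf_x (a' x0)) \<and> \<Phi> (surf_y (a x0)) = \<Phi>' (surf_y (a' x0))) \<or>
       (\<Phi> (surf_x (a x0)) = \<Phi>' (surf_y (a' x0)) \<and> \<Phi> (surf_y (a x0)) = \<Phi>' (surf_x (a' x0)))" by auto
  then show ?thesis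
    using model_frame_determines[OF \<Phi> eq[OF S(2)], of "\<lambda>v. v"] model_frame_determines[OF \<Phi> eq[OF S(2)], of swap2] by blast
qed

text \<open>The lift \<open>surf\<close> is horizontal, so the phase by which two lifts of the same surface differ is constant.\<close>

lemma projective_model_reparametrization:
  fixes S :: "(real^2) set"
  assumes \<Phi>: "b_unitary \<Phi>" "b_unitary \<Phi>'" and S: "open S" "x0 \<in> S"
    and a: "smooth_on S a" "smooth_on S a'" and eq: "\<And>x. x \<in> S \<Longrightarrow> hopf (\<Phi> (surf (a x))) = hopf (\<Phi>' (surf (a' x)))"
    and v: "dd a x0 v1 = axis 1 1" "dd a x0 v2 = axis 2 1"
  shows "\<exists>\<sigma>. (\<sigma> = (\<lambda>v. v) \<or> \<sigma> = swap2) \<and> (\<forall>v. hopf (\<Phi> (surf (a x0 + v))) = hopf (\<Phi>' (surf (a' x0 + \<sigma> v))))"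
proof -
  obtain r where r: "r > 0" "ball x0 r \<subseteq> S" using S open_contains_ball by blast
  let ?B = "ball x0 r"
  define P P' where "P x = \<Phi> (surf (a x))" and "P' x = \<Phi>' (surf (a' x))" for x
  define \<mu> where "\<mu> x = - bform (P' x) (P x)" for x
  note g = normal_gram_surf[unfolded normal_gram_def]
  have n: "bform (P x) (P x) = -1" "bform (P' x) (P' x) = -1" for x
    by (simp_all add: P_def P'_def b_unitary_simps[OF \<Phi>(1)] b_unitary_simps[OF \<Phi>(2)] g)
  have sm: "smooth_on ?B P" "smooth_on ?B P'"
    unfolding P_def[abs_def] P'_def[abs_def] using smooth_on_subset[OF a(1) r(2)] smooth_on_subset[OF a(2) r(2)]
    by (auto intro!: smooth_on_linear[OF b_unitary_bounded_linear[OF \<Phi>(1)]] smooth_on_linear[OF b_unitary_bounded_linear[OF \<Phi>(2)]]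
       smooth_on_compose[OF open_ball open_UNIV _ smooth_on_surf(1)])
  have P: "P x = \<mu> x *s P' x" "cnj (\<mu> x) * \<mu> x = 1" if x: "x \<in> ?B" for x
  proof -
    obtain c where c: "P x = c *s P' x" using hopf_eqD[OF eq[of x]] x r unfolding P_def P'_def by blast
    then have "\<mu> x = c" by (simp add: \<mu>_def bform_simps n)
    then show P: "P x = \<mu> x *s P' x" using c by simp
    have "bform (P x) (P x) = cnj (\<mu> x) * \<mu> x * bform (P' x) (P' x)" by (subst (1 2) P) (rule bform_scale)
    then show "cnj (\<mu> x) * \<mu> x = 1" unfolding n by simp
  qed
  have hor: "bform (Q (surf (b x))) (dd (\<lambda>x. Q (surf (b x))) x h) = 0"
    if "b_unitary Q" "smooth_on S b" "x \<in> ?B" for Q :: "complex^3 \<Rightarrow> complex^3" and b :: "real^2 \<Rightarrow> real^2" and x h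
  proof -
    have x: "x \<in> S" using that r by blast
    have "((\<lambda>x. Q (surf (b x))) has_derivative (\<lambda>v. dd b x v$1 *\<^sub>R Q (surf_x (b x)) + dd b x v$2 *\<^sub>R Q (surf_y (b x)))) (at x)"
      using bounded_linear.has_derivative[OF b_unitary_bounded_linear[OF that(1)]
          has_derivative_compose[OF smooth_on_has_derivative[OF that(2) x] has_derivative_surf(1)]]
      by (simp add: b_unitary_simps[OF that(1)])
    from dd_eqI[OF this] show ?thesis by (simp add: bform_simps b_unitary_simps[OF that(1)] g)
  qed
  have s\<mu>: "smooth_on ?B \<mu>" unfolding \<mu>_def[abs_def] by (intro smooth_on_minus smooth_on_bform sm open_ball)
  have "dd \<mu> x h = 0" if x: "x \<in> ?B" for x h
  proof -
    have "dd P x h = dd (\<lambda>x. \<mu> x *s P' x) x h" by (subst dd_cong_open[OF open_ball x P(1)]) auto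
    also have "\<dots> = \<mu> x *s dd P' x h + dd \<mu> x h *s P' x"
      by (rule dd_smult[OF smooth_on_differentiable[OF s\<mu> x] smooth_on_differentiable[OF sm(2) x]])
    finally have "bform (P' x) (dd P x h) = - dd \<mu> x h"
      using hor[OF \<Phi>(2) a(2) x, of h] by (simp add: bform_simps n P'_def[symmetric] P'_def[abs_def, symmetric])
    moreover have "cnj (\<mu> x) * bform (P' x) (dd P x h) = 0"
      using hor[OF \<Phi>(1) a(1) x, of h] P(1)[OF x] unfolding P_def[symmetric] P_def[abs_def, symmetric]
      by (metis bform_scale_left)
    ultimately show ?thesis using P(2)[OF x] by auto
  qed
  then have "dd \<mu> x = (\<lambda>h. 0)" if "x \<in> ?B" for x using that by blast
  then have "(\<mu> has_derivative (\<lambda>h. 0)) (at x within ?B)" if "x \<in> ?B" for x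
    using has_derivative_at_withinI[OF smooth_on_has_derivative[OF s\<mu> that]] that by simp
  then have \<mu>: "\<mu> x = \<mu> x0" if "x \<in> ?B" for x
    using has_derivative_zero_unique[OF convex_ball, where f = \<mu>] that r(1) by (metis centre_in_ball)
  have x0: "x0 \<in> ?B" using r by simp
  have \<mu>0: "\<mu> x0 \<noteq> 0" using P(2)[OF x0] by auto
  have "\<exists>\<sigma>. (\<sigma> = (\<lambda>v. v) \<or> \<sigma> = swap2) \<and> (\<forall>v. \<Phi> (surf (a x0 + v)) = \<mu> x0 *s \<Phi>' (surf (a' x0 + \<sigma> v)))"
    using P(1) \<mu> unfolding P_def P'_def
    by (intro model_reparametrization[OF \<Phi>(1) b_unitary_scale[OF \<Phi>(2) P(2)[OF x0]] open_ball x0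
          smooth_on_subset[OF a(1) r(2)] smooth_on_subset[OF a(2) r(2)] _ v]) auto
  then show ?thesis using hopf_scale[OF \<mu>0] by metis
qed

section \<open>Charts\<close>

text \<open>The fields \<open>\<epsilon>1\<close>, \<open>\<epsilon>2\<close> are the columns of the inverse of the Jacobian matrix. So the derivative of the local
  inverse \<open>g\<close> is a smooth function of \<open>g\<close>.\<close>

lemma inverse_chart:
  fixes \<psi> :: "real^2 \<Rightarrow> real^2"
  assumes S: "open S" "x0 \<in> S" and sm: "smooth_on S \<psi>" "smooth_on S \<epsilon>1" "smooth_on S \<epsilon>2"
    and \<epsilon>: "\<And>x. x \<in> S \<Longrightarrow> dd \<psi> x (\<epsilon>1 x) = axis 1 1" "\<And>x. x \<in> S \<Longrightarrow> dd \<psi> x (\<epsilon>2 x) = axis 2 1"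
  shows "\<exists>O' W g. open O' \<and> O' \<subseteq> S \<and> x0 \<in> O' \<and> open W \<and> homeomorphism O' W \<psi> g \<and> smooth_on W g"
proof -
  define E where "E x v = v$1 *\<^sub>R \<epsilon>1 x + v$2 *\<^sub>R \<epsilon>2 x" for x and v :: "real^2"
  have lD: "linear (dd \<psi> x)" if "x \<in> S" for x
    using that by (intro linear_dd smooth_on_differentiable[OF sm(1)])
  have lE: "linear (E x)" for x by (rule linearI) (simp_all add: E_def algebra_simps)
  have DE: "dd \<psi> x (E x v) = v" if "x \<in> S" for x v
    using vec2_expansion[of v] by (simp add: E_def linear_add[OF lD[OF that]] linear_scale[OF lD[OF that]] \<epsilon>[OF that])
  have ED: "E x (dd \<psi> x v) = v" if "x \<in> S" for x v
    using linear_inverse_left[OF lD[OF that] lE[of x]] DE[OF that] by (auto simp: fun_eq_iff)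
  have bl: "bounded_linear (dd \<psi> x)" if "x \<in> S" for x
    using lD[OF that] by (simp add: linear_conv_bounded_linear)
  define \<psi>' where "\<psi>' x = Blinfun (dd \<psi> x)" for x
  have ap: "blinfun_apply (\<psi>' x) = dd \<psi> x" if "x \<in> S" for x
    by (simp add: \<psi>'_def bounded_linear_Blinfun_apply[OF bl[OF that]])
  have c: "continuous_on S \<psi>'"
  proof (rule continuous_on_blinfun_componentwise)
    fix i
    show "continuous_on S (\<lambda>x. blinfun_apply (\<psi>' x) i)"
      by (rule continuous_on_eq[OF smooth_on_continuous[OF smooth_on_dd[OF sm(1)]]]) (simp add: ap)
  qed
  have d: "(\<psi> has_derivative blinfun_apply (\<psi>' x)) (at x)" if "x \<in> S" for x
    unfolding ap[OF that] by (rule smooth_on_has_derivative[OF sm(1) that])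
  have "Blinfun (E x0) o\<^sub>L \<psi>' x0 = id_blinfun"
    using lE[of x0] ED[OF S(2)] by (intro blinfun_eqI) (simp add: ap[OF S(2)] bounded_linear_Blinfun_apply linear_conv_bounded_linear)
  from inverse_function_theorem[OF S(1) d c S(2) this]
  obtain O' W g g' where O': "open O'" "O' \<subseteq> S" "x0 \<in> O'" "open W" "\<psi> x0 \<in> W" "homeomorphism O' W \<psi> g"
    "\<And>y. y \<in> W \<Longrightarrow> (g has_derivative g' y) (at y)" "\<And>y. y \<in> W \<Longrightarrow> g' y = inv (blinfun_apply (\<psi>' (g y)))"
    "\<And>y. y \<in> W \<Longrightarrow> bij (blinfun_apply (\<psi>' (g y)))" by metis
  have gO: "g ` W \<subseteq> S" using O' by (auto simp: homeomorphism_def)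
  define e where "e b = (if b = axis 1 1 then \<epsilon>1 else \<epsilon>2)" for b :: "real^2"
  have "smooth_on W g"
  proof (rule smooth_on_inverse_map[OF O'(4) S(1) gO])
    show "smooth_on S (e b)" for b using sm by (simp add: e_def)
    fix y assume y: "y \<in> W"
    have gy: "g y \<in> S" using gO y by blast
    have ne: "axis 1 (1::real) \<noteq> (axis 2 1 :: real^2)" by (simp add: axis_eq_axis)
    have B: "(Basis :: (real^2) set) = {axis 1 1, axis 2 1}"
      by (auto simp: Basis_vec_def UNIV_2)
    have "g' y = (\<lambda>v. \<Sum>b\<in>Basis. (v \<bullet> b) *\<^sub>R e b (g y))"
    proof
      fix v
      have "g' y v = E (g y) v"
        unfolding O'(8)[OF y] using O'(9)[OF y] DE[OF gy] by (intro inv_f_eq) (auto simp: ap[OF gy] bij_def)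
      then show "g' y v = (\<Sum>b\<in>Basis. (v \<bullet> b) *\<^sub>R e b (g y))"
        unfolding B using ne by (simp add: e_def E_def inner_axis)
    qed
    then show "(g has_derivative (\<lambda>v. \<Sum>b\<in>Basis. (v \<bullet> b) *\<^sub>R e b (g y))) (at y)"
      using O'(7)[OF y] by simp
  qed
  then show ?thesis using O' by blast
qed

lemma smooth_atlas_chart:
  assumes "smooth_atlas A" "(U, \<phi>) \<in> A"
  shows "open U" "open (\<phi> ` U)" "homeomorphism U (\<phi> ` U) \<phi> (inv_into U \<phi>)" "inj_on \<phi> U"
    "\<And>p. p \<in> U \<Longrightarrow> inv_into U \<phi> (\<phi> p) = p"
proof -
  show "open U" "open (\<phi> ` U)" and h: "homeomorphism U (\<phi> ` U) \<phi> (inv_into U \<phi>)"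
    using assms by (auto simp: smooth_atlas_def)
  show "inj_on \<phi> U" by (rule inj_on_inverseI[of _ "inv_into U \<phi>"]) (use h in \<open>auto simp: homeomorphism_def\<close>)
  then show "\<And>p. p \<in> U \<Longrightarrow> inv_into U \<phi> (\<phi> p) = p" by simp
qed

lemma smooth_atlas_transition:
  "smooth_atlas A \<Longrightarrow> (U, \<phi>) \<in> A \<Longrightarrow> (V, \<psi>) \<in> A \<Longrightarrow> smooth_on (\<phi> ` (U \<inter> V)) (\<psi> \<circ> inv_into U \<phi>)"
  unfolding smooth_atlas_def by blast

lemma smooth_atlas_subset: "smooth_atlas A \<Longrightarrow> A' \<subseteq> A \<Longrightarrow> smooth_atlas A'"
  unfolding smooth_atlas_def by blast

lemma open_chart_image:
  assumes "smooth_atlas A" "(U, \<phi>) \<in> A" "open S" "S \<subseteq> U" shows "open (\<phi> ` S)"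
proof -
  note c = smooth_atlas_chart[OF assms(1,2)]
  have "openin (top_of_set (\<phi> ` U)) (\<phi> ` S)"
    by (rule homeomorphism_imp_open_map[OF c(3)]) (use assms c(1) in \<open>auto simp: openin_open_eq\<close>)
  then show ?thesis using c(2) by (simp add: openin_open_eq)
qed

text \<open>This turns local diffeomorphisms of the plane into the reparametrizations that occur in the
  definition of congruence.\<close>

lemma smooth_atlas_insert_compose:
  assumes A: "smooth_atlas A" "(U, \<phi>) \<in> A" and O': "open O'" "O' \<subseteq> \<phi> ` U" and W: "open W" "homeomorphism O' W \<rho> g"
    and sm: "smooth_on O' \<rho>" "smooth_on W g"
  defines "V \<equiv> {p \<in> U. \<phi> p \<in> O'}"
  shows "smooth_atlas (insert (V, \<rho> \<circ> \<phi>) A)"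
proof -
  note c = smooth_atlas_chart[OF A]
  have contU: "continuous_on U \<phi>" using c(3) by (simp add: homeomorphism_def)
  have "V = U \<inter> \<phi> -` O'" by (auto simp: V_def)
  then have oV: "open V" using continuous_open_preimage[OF contU c(1) O'(1)] by simp
  have VU: "V \<subseteq> U" by (auto simp: V_def)
  have img: "\<phi> ` V = O'" using O'(2) by (auto simp: V_def)
  have h1: "homeomorphism V O' \<phi> (inv_into U \<phi>)"
    by (rule homeomorphism_of_subsets[OF c(3)]) (use img VU c(5) in auto)
  let ?\<psi> = "\<rho> \<circ> \<phi>" and ?\<iota> = "inv_into U \<phi> \<circ> g"
  have h2: "homeomorphism V W ?\<psi> ?\<iota>" by (rule homeomorphism_compose[OF h1 W(2)])
  have im: "?\<psi> ` V = W" using h2 by (simp add: homeomorphism_def)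
  have inj: "inj_on ?\<psi> V" by (rule inj_on_inverseI[of _ "?\<iota>"]) (use h2 in \<open>auto simp: homeomorphism_def\<close>)
  have inv: "inv_into V ?\<psi> y = ?\<iota> y" if "y \<in> W" for y
    using h2 that by (intro inv_into_f_eq[OF inj]) (auto simp: homeomorphism_def)
  have h3: "homeomorphism V (?\<psi> ` V) ?\<psi> (inv_into V ?\<psi>)"
    unfolding im by (rule homeomorphism_cong[OF h2]) (auto simp: inv)
  have oimg: "open (?\<psi> ` S)" if "open S" "S \<subseteq> V" for S
  proof -
    have "openin (top_of_set W) (?\<psi> ` S)"
      by (rule homeomorphism_imp_open_map[OF h2]) (use that oV in \<open>auto simp: openin_open_eq\<close>)
    then show ?thesis using W(1) by (simp add: openin_open_eq)
  qed
  have to: "smooth_on (?\<psi> ` (V \<inter> U')) (\<phi>' \<circ> inv_into V ?\<psi>)" if B: "(U', \<phi>') \<in> A" for U' \<phi>'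
  proof -
    note c' = smooth_atlas_chart[OF A(1) B]
    have o: "open (?\<psi> ` (V \<inter> U'))" using oV c'(1) by (intro oimg) auto
    have sub: "?\<psi> ` (V \<inter> U') \<subseteq> W" using im by blast
    have gi: "g (\<rho> (\<phi> p)) = \<phi> p" if "p \<in> V" for p
      using W(2) img that by (auto simp: homeomorphism_def)
    have "smooth_on (?\<psi> ` (V \<inter> U')) (\<lambda>y. (\<phi>' \<circ> inv_into U \<phi>) (g y))"
      using open_chart_image[OF A, of "U \<inter> U'"] c(1) c'(1) VU gi
      by (intro smooth_on_compose[OF o _ smooth_on_subset[OF sm(2) sub] smooth_atlas_transition[OF A B]]) auto
    moreover have "(\<phi>' \<circ> inv_into V ?\<psi>) y = (\<phi>' \<circ> inv_into U \<phi>) (g y)" if "y \<in> ?\<psi> ` (V \<inter> U')" for y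
      using inv[of y] sub that by auto
    ultimately show ?thesis using smooth_on_cong[OF o, of "\<phi>' \<circ> inv_into V ?\<psi>"] by simp
  qed
  have from': "smooth_on (\<phi>' ` (U' \<inter> V)) (?\<psi> \<circ> inv_into U' \<phi>')" if B: "(U', \<phi>') \<in> A" for U' \<phi>'
  proof -
    note c' = smooth_atlas_chart[OF A(1) B]
    have o: "open (\<phi>' ` (U' \<inter> V))" using oV c'(1) by (intro open_chart_image[OF A(1) B]) auto
    have "smooth_on (\<phi>' ` (U' \<inter> V)) (\<lambda>y. \<rho> ((\<phi> \<circ> inv_into U' \<phi>') y))"
      using VU img c'(5)
      by (intro smooth_on_compose[OF o O'(1) smooth_on_subset[OF smooth_atlas_transition[OF A(1) B A(2)]] sm(1)]) auto
    then show ?thesis by (simp add: o_def)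
  qed
  have self: "smooth_on (?\<psi> ` (V \<inter> V)) (?\<psi> \<circ> inv_into V ?\<psi>)"
  proof -
    have "(?\<psi> \<circ> inv_into V ?\<psi>) y = y" if "y \<in> W" for y using h3 that im by (auto simp: homeomorphism_def)
    then show ?thesis using smooth_on_cong[OF W(1), of "?\<psi> \<circ> inv_into V ?\<psi>" "\<lambda>y. y"] smooth_on_id[OF W(1)] im by simp
  qed
  have chart: "open U' \<and> open (\<phi>' ` U') \<and> homeomorphism U' (\<phi>' ` U') \<phi>' (inv_into U' \<phi>')"
    if "(U', \<phi>') \<in> insert (V, ?\<psi>) A" for U' \<phi>'
    using that smooth_atlas_chart[OF A(1), of U' \<phi>'] oV h3 W(1) im by auto
  have trans: "smooth_on (\<phi>' ` (U' \<inter> U'')) (\<phi>'' \<circ> inv_into U' \<phi>')"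
    if "(U', \<phi>') \<in> insert (V, ?\<psi>) A" "(U'', \<phi>'') \<in> insert (V, ?\<psi>) A" for U' \<phi>' U'' \<phi>''
    using that to from' self smooth_atlas_transition[OF A(1)] by auto
  show ?thesis
    unfolding smooth_atlas_def
  proof (intro conjI ballI)
    fix c assume c: "c \<in> insert (V, ?\<psi>) A"
    then show "case c of (U, \<phi>) \<Rightarrow> open U \<and> open (\<phi> ` U) \<and> homeomorphism U (\<phi> ` U) \<phi> (inv_into U \<phi>)"
      using chart[of "fst c" "snd c"] by (simp add: case_prod_unfold)
    have "smooth_on (snd c ` (fst c \<inter> fst d)) (snd d \<circ> inv_into (fst c) (snd c))" if "d \<in> insert (V, ?\<psi>) A" for d
      using trans[of "fst c" "snd c" "fst d" "snd d"] c that by simp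
    then show "case c of (U, \<phi>) \<Rightarrow> \<forall>(V, \<psi>)\<in>insert (V, ?\<psi>) A. smooth_on (\<phi> ` (U \<inter> V)) (\<psi> \<circ> inv_into U \<phi>)"
      unfolding case_prod_unfold by blast
  qed
qed

section \<open>The classification\<close>

context flat_minimal_slant_chart
begin

text \<open>For \<open>s = 0\<close> the hermitian product is real on tangent vectors.\<close>

lemma lagrangian_point: assumes x: "x \<in> N" shows "ch_metric k (f x) (J (dd f x u)) (dd f x v) = 0"
proof -
  have \<kappa>: "\<kappa> = -1" using B_C(1)[OF x] unfolding \<kappa>_def by simp
  have "bform (hor (Z x) (dd Z x u)) (hor (Z x) (dd Z x v)) = n x * (\<omega>1 x u * \<omega>2 x v + \<omega>2 x u * \<omega>1 x v)"
    unfolding hor_dd_Z[OF x] by (simp add: bform_simps HH[OF x] \<kappa> algebra_simps)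
  then have "ch_herm k (f x) (dd f x u) (dd f x v) = complex_of_real (- (\<omega>1 x u * \<omega>2 x v + \<omega>2 x u * \<omega>1 x v))"
    using n_nonzero[OF x] by (simp add: ch_herm_def lifted_dd[OF x] n_def)
  then show ?thesis by (simp add: ch_metric_eq_Re_herm[OF range_f[OF x]] J_def ch_herm_simps)
qed

end

definition model_chart_at :: "'m::{t2_space,second_countable_topology} atlas \<Rightarrow> ('m \<Rightarrow> (complex^3) set) \<Rightarrow> (complex^3 \<Rightarrow> complex^3) \<Rightarrow> 'm \<Rightarrow> bool" where
  "model_chart_at A L \<Phi> p \<longleftrightarrow> (\<exists>V \<psi>. p \<in> V \<and> V \<subseteq> carrier A \<and> smooth_atlas (insert (V, \<psi>) A) \<and> (\<forall>q\<in>V. L q = hopf (\<Phi> (surf (\<psi> q)))))"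

locale flat_minimal_slant_surface =
  fixes A :: "'m::{t2_space,second_countable_topology} atlas" and L :: "'m \<Rightarrow> (complex^3) set"
  assumes atlas: "smooth_atlas A" and immersion: "immersion A L" and minimal: "minimal A L"
    and flat: "flat A L" and slant: "slant A L"
begin

lemma rep_point:
  assumes c: "(U, \<phi>) \<in> A" and x: "x \<in> rep_dom L (U, \<phi>) k"
  shows "x \<in> \<phi> ` U" "rep L (U, \<phi>) k x \<in> ch_range k" "hopf (ch_lift k (rep L (U, \<phi>) k x)) = L (inv_into U \<phi> x)"
proof -
  obtain p where p: "p \<in> U" "x = \<phi> p" "L p \<in> ch_dom k" using x by (auto simp: rep_dom_def)
  then have i: "inv_into U \<phi> x = p" using smooth_atlas_chart(5)[OF atlas c] by simp
  obtain z where z: "L p = hopf z" "Re (bform z z) < 0"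
    using CH21_hopf[of "L p"] p(3) by (auto simp: ch_dom_def)
  then have zk: "z$k \<noteq> 0" using p(3) by (simp add: hopf_in_ch_dom)
  have "rep L (U, \<phi>) k x = affine_coord k z" by (simp add: rep_def i z(1) coord_hopf[OF zk])
  then have lift: "ch_lift k (rep L (U, \<phi>) k x) = (1 / z$k) *s z" using lift_affine_coord[OF zk] by simp
  then show h: "hopf (ch_lift k (rep L (U, \<phi>) k x)) = L (inv_into U \<phi> x)" using zk by (simp add: i z(1) hopf_scale)
  show "x \<in> \<phi> ` U" using p by blast
  have "hopf (ch_lift k (rep L (U, \<phi>) k x)) \<in> ch_dom k" using h i p(3) by simp
  then show "rep L (U, \<phi>) k x \<in> ch_range k" by (simp add: hopf_in_ch_dom ch_range_def)
qed

lemma local_chart: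
  assumes c: "(U, \<phi>) \<in> A" and x: "x \<in> rep_dom L (U, \<phi>) k"
  shows "\<exists>N e1 e2 s. x \<in> N \<and> N \<subseteq> rep_dom L (U, \<phi>) k \<and> flat_minimal_slant_chart k (rep L (U, \<phi>) k) N e1 e2 s"
proof -
  obtain \<alpha>\<^sub>0 where "\<forall>c\<in>A. \<forall>k. \<forall>x\<in>rep_dom L c k.
     \<exists>N e1 e2. open N \<and> x \<in> N \<and> N \<subseteq> rep_dom L c k \<and> wirtinger_angle (ch_metric k) (rep L c k) N e1 e2 (\<lambda>_. \<alpha>\<^sub>0)"
    using slant unfolding slant_def by blast
  then obtain N e1 e2 where N: "open N" "x \<in> N" "N \<subseteq> rep_dom L (U, \<phi>) k"
    and wa: "wirtinger_angle (ch_metric k) (rep L (U, \<phi>) k) N e1 e2 (\<lambda>_. \<alpha>\<^sub>0)" using c x by meson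
  have "smooth_on (rep_dom L (U, \<phi>) k) (rep L (U, \<phi>) k)" using immersion c unfolding immersion_def by blast
  then have sm: "smooth_on N (rep L (U, \<phi>) k)" using N(3) by (rule smooth_on_subset)
  have "flat_minimal_slant_chart k (rep L (U, \<phi>) k) N e1 e2 (sinh \<alpha>\<^sub>0)"
  proof unfold_locales
    show "mean_curvature_vector (ch_metric k) (rep L (U, \<phi>) k) y = 0" if "y \<in> N" for y
      using minimal c that N(3) unfolding minimal_def in_coordinates_def by blast
    show "curvature (pullback (ch_metric k) (rep L (U, \<phi>) k)) y u v w = 0" if "y \<in> N" for y u v w
      using flat c that N(3) unfolding flat_def in_coordinates_def by blast
  qed (use N sm wa rep_point(2)[OF c] in \<open>auto simp: wirtinger_angle_def\<close>)
  then show ?thesis using N by blast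
qed

lemma lagrangian: "lagrangian A L"
  unfolding lagrangian_def in_coordinates_def
proof (intro ballI allI)
  fix c k x u v assume c: "c \<in> A" and x: "x \<in> rep_dom L c k"
  obtain U \<phi> where U: "c = (U, \<phi>)" by (cases c)
  obtain N e1 e2 s where "x \<in> N" "flat_minimal_slant_chart k (rep L c k) N e1 e2 s"
    using local_chart[OF c[unfolded U] x[unfolded U]] unfolding U by blast
  then show "ch_metric k (rep L c k x) (J (dd (rep L c k) x u)) (dd (rep L c k) x v) = 0"
    by (intro flat_minimal_slant_chart.lagrangian_point)
qed

lemma ex_model_chart:
  assumes p: "p \<in> carrier A" shows "\<exists>\<Phi>. b_unitary \<Phi> \<and> model_chart_at A L \<Phi> p"
proof -
  obtain U \<phi> where c: "(U, \<phi>) \<in> A" "p \<in> U" using p by (auto simp: carrier_def)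
  note ch = smooth_atlas_chart[OF atlas c(1)]
  have Lp: "L p \<in> CH21" using immersion p unfolding immersion_def by blast
  obtain z where z: "L p = hopf z" "Re (bform z z) < 0" using CH21_hopf[OF Lp] by blast
  have "\<exists>k. z$k \<noteq> 0"
  proof (rule ccontr)
    assume "\<nexists>k. z $ k \<noteq> 0" then have "z = 0" by (simp add: vec_eq_iff)
    then show False using z(2) by (simp add: bform_zero)
  qed
  then obtain k where "L p \<in> ch_dom k" using z by (auto simp: hopf_in_ch_dom)
  then have x: "\<phi> p \<in> rep_dom L (U, \<phi>) k" using c by (auto simp: rep_dom_def)
  obtain N e1 e2 s where N: "\<phi> p \<in> N" "N \<subseteq> rep_dom L (U, \<phi>) k" "flat_minimal_slant_chart k (rep L (U, \<phi>) k) N e1 e2 s"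
    using local_chart[OF c(1) x] by blast
  obtain r \<psi> \<epsilon>1 \<epsilon>2 \<Phi> where r: "r > 0" "ball (\<phi> p) r \<subseteq> N" and \<Phi>: "b_unitary \<Phi>" and
    sm: "smooth_on (ball (\<phi> p) r) \<psi>" "smooth_on (ball (\<phi> p) r) \<epsilon>1" "smooth_on (ball (\<phi> p) r) \<epsilon>2" and
    d: "\<And>x. x \<in> ball (\<phi> p) r \<Longrightarrow> dd \<psi> x (\<epsilon>1 x) = axis 1 1" "\<And>x. x \<in> ball (\<phi> p) r \<Longrightarrow> dd \<psi> x (\<epsilon>2 x) = axis 2 1"
      "\<And>x. x \<in> ball (\<phi> p) r \<Longrightarrow> hopf (ch_lift k (rep L (U, \<phi>) k x)) = hopf (\<Phi> (surf (\<psi> x)))"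
    using flat_minimal_slant_chart.local_normal_form[OF N(3,1)] by blast
  obtain O' W g where O': "open O'" "O' \<subseteq> ball (\<phi> p) r" "\<phi> p \<in> O'" "open W" "homeomorphism O' W \<psi> g" "smooth_on W g"
    using inverse_chart[OF open_ball _ sm d(1,2)] r(1) by (metis centre_in_ball)
  have sub: "O' \<subseteq> rep_dom L (U, \<phi>) k" using O'(2) r(2) N(2) by blast
  have subU: "O' \<subseteq> \<phi> ` U" using sub rep_point(1)[OF c(1)] by blast
  define V where "V = {q \<in> U. \<phi> q \<in> O'}"
  have "smooth_atlas (insert (V, \<psi> \<circ> \<phi>) A)"
    unfolding V_def by (rule smooth_atlas_insert_compose[OF atlas c(1) O'(1) subU O'(4,5) smooth_on_subset[OF sm(1) O'(2)] O'(6)])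
  moreover have "L q = hopf (\<Phi> (surf ((\<psi> \<circ> \<phi>) q)))" if "q \<in> V" for q
  proof -
    have q: "q \<in> U" "\<phi> q \<in> O'" using that by (auto simp: V_def)
    then have "hopf (ch_lift k (rep L (U, \<phi>) k (\<phi> q))) = L q"
      using rep_point(3)[OF c(1), of "\<phi> q"] sub ch(5) by auto
    then show ?thesis using d(3) q O'(2) by auto
  qed
  moreover have "p \<in> V" "V \<subseteq> carrier A" using c O'(3) by (auto simp: V_def carrier_def)
  ultimately show ?thesis using \<Phi> unfolding model_chart_at_def by blast
qed

text \<open>By rigidity, the two unitary maps differ by a symmetry of the model on the whole plane. Composed with the
  corresponding affine map, each chart for \<open>\<Phi>'\<close> is a chart for \<open>\<Phi>\<close>.\<close>

lemma model_chart_transfer: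
  assumes \<Phi>: "b_unitary \<Phi>" "b_unitary \<Phi>'" and q: "model_chart_at A L \<Phi> q" "model_chart_at A L \<Phi>' q"
    and p: "model_chart_at A L \<Phi>' p"
  shows "model_chart_at A L \<Phi> p"
proof -
  obtain V \<psi> where V: "q \<in> V" "V \<subseteq> carrier A" "smooth_atlas (insert (V, \<psi>) A)" "\<And>q. q \<in> V \<Longrightarrow> L q = hopf (\<Phi> (surf (\<psi> q)))"
    using q(1) unfolding model_chart_at_def by blast
  obtain V' \<psi>' where V': "q \<in> V'" "smooth_atlas (insert (V', \<psi>') A)" "\<And>q. q \<in> V' \<Longrightarrow> L q = hopf (\<Phi>' (surf (\<psi>' q)))"
    using q(2) unfolding model_chart_at_def by blast
  obtain U \<phi> where c: "(U, \<phi>) \<in> A" "q \<in> U" using V(1,2) by (auto simp: carrier_def)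
  note ch = smooth_atlas_chart[OF atlas c(1)]
  note chV = smooth_atlas_chart[OF V(3) insertI1] and chV' = smooth_atlas_chart[OF V'(2) insertI1]
  define S where "S = \<phi> ` (U \<inter> (V \<inter> V'))"
  have oS: "open S" unfolding S_def using ch(1) chV(1) chV'(1) by (intro open_chart_image[OF atlas c(1)]) auto
  have x0: "\<phi> q \<in> S" using V(1) V'(1) c(2) by (auto simp: S_def)
  define a a' where "a = \<psi> \<circ> inv_into U \<phi>" and "a' = \<psi>' \<circ> inv_into U \<phi>"
  have "smooth_on (\<phi> ` (U \<inter> V)) a" unfolding a_def by (rule smooth_atlas_transition[OF V(3)]) (use c in auto)
  then have sa: "smooth_on S a" by (rule smooth_on_subset) (auto simp: S_def)
  have "smooth_on (\<phi> ` (U \<inter> V')) a'" unfolding a'_def by (rule smooth_atlas_transition[OF V'(2)]) (use c in auto)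
  then have sa': "smooth_on S a'" by (rule smooth_on_subset) (auto simp: S_def)
  have eq: "hopf (\<Phi> (surf (a x))) = hopf (\<Phi>' (surf (a' x)))" if x: "x \<in> S" for x
  proof -
    obtain p where "p \<in> U" "p \<in> V" "p \<in> V'" "x = \<phi> p" using x unfolding S_def by blast
    then show ?thesis using V(4)[of p] V'(3)[of p] ch(5)[of p] by (simp add: a_def a'_def)
  qed
  have v: "dd a (\<phi> q) (dd (\<phi> \<circ> inv_into V \<psi>) (\<psi> q) u) = u" for u
  proof -
    let ?b = "\<phi> \<circ> inv_into V \<psi>"
    have sb: "smooth_on (\<psi> ` (V \<inter> U)) ?b" by (rule smooth_atlas_transition[OF V(3)]) (use c in auto)
    have o: "open (\<psi> ` (V \<inter> U))" using ch(1) chV(1) by (intro open_chart_image[OF V(3) insertI1]) auto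
    have y: "\<psi> q \<in> \<psi> ` (V \<inter> U)" using V(1) c(2) by auto
    have by0: "?b (\<psi> q) = \<phi> q" using chV(5)[OF V(1)] by simp
    have "((\<lambda>y. a (?b y)) has_derivative (\<lambda>u. dd a (\<phi> q) (dd ?b (\<psi> q) u))) (at (\<psi> q))"
      by (rule has_derivative_compose[OF smooth_on_has_derivative[OF sb y]]) (unfold by0, rule smooth_on_has_derivative[OF sa x0])
    moreover have "a (?b y) = y" if "y \<in> \<psi> ` (V \<inter> U)" for y
      using that chV(5) ch(5) by (auto simp: a_def)
    ultimately have "((\<lambda>y. y) has_derivative (\<lambda>u. dd a (\<phi> q) (dd ?b (\<psi> q) u))) (at (\<psi> q))"
      using has_derivative_cong_open[OF o y, of "\<lambda>y. a (?b y)" "\<lambda>y. y"] by simp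
    from has_derivative_unique[OF this has_derivative_ident] show ?thesis by (auto simp: fun_eq_iff)
  qed
  obtain \<sigma> where \<sigma>: "\<sigma> = (\<lambda>v. v) \<or> \<sigma> = swap2"
    "\<And>v. hopf (\<Phi> (surf (a (\<phi> q) + v))) = hopf (\<Phi>' (surf (a' (\<phi> q) + \<sigma> v)))"
    using projective_model_reparametrization[OF \<Phi> oS x0 sa sa' eq v v] by blast
  have \<sigma>\<sigma>: "\<sigma> (\<sigma> v) = v" and bl: "bounded_linear \<sigma>" for v
    using \<sigma>(1) swap2_swap2 bounded_linear_swap2 bounded_linear_ident by auto
  define t t' where "t = a (\<phi> q)" and "t' = a' (\<phi> q)"
  obtain V'' \<psi>'' where W: "p \<in> V''" "V'' \<subseteq> carrier A" "smooth_atlas (insert (V'', \<psi>'') A)" "\<And>q. q \<in> V'' \<Longrightarrow> L q = hopf (\<Phi>' (surf (\<psi>'' q)))"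
    using p unfolding model_chart_at_def by blast
  note chW = smooth_atlas_chart[OF W(3) insertI1]
  define \<rho> g where "\<rho> y = t + \<sigma> (y - t')" and "g y = t' + \<sigma> (y - t)" for y
  have inv: "g (\<rho> y) = y" "\<rho> (g y) = y" for y by (simp_all add: \<rho>_def g_def \<sigma>\<sigma>)
  have sm: "smooth_on X \<rho>" "smooth_on X g" if "open X" for X
    unfolding \<rho>_def[abs_def] g_def[abs_def]
    by (intro smooth_on_add smooth_on_const smooth_on_linear[OF bl] smooth_on_diff smooth_on_id that)+
  have cont: "continuous_on UNIV \<rho>" "continuous_on UNIV g" using sm[OF open_UNIV] by (auto intro: smooth_on_continuous)
  define O' where "O' = \<psi>'' ` V''"
  have oW: "open (g -` O')" using open_vimage[OF chW(2) cont(2)] by (simp add: O'_def)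
  have hom: "homeomorphism O' (g -` O') \<rho> g"
    unfolding homeomorphism_def using continuous_on_subset[OF cont(1)] continuous_on_subset[OF cont(2)] inv
    by (auto simp: image_iff) (metis, metis)
  have "{q \<in> V''. \<psi>'' q \<in> O'} = V''" by (auto simp: O'_def)
  then have "smooth_atlas (insert (V'', \<rho> \<circ> \<psi>'') (insert (V'', \<psi>'') A))"
    using smooth_atlas_insert_compose[OF W(3) insertI1, of O' "g -` O'" \<rho> g] chW(2) oW hom sm by (simp add: O'_def)
  then have "smooth_atlas (insert (V'', \<rho> \<circ> \<psi>'') A)" by (rule smooth_atlas_subset) auto
  moreover have "L q = hopf (\<Phi> (surf ((\<rho> \<circ> \<psi>'') q)))" if "q \<in> V''" for q
    using W(4)[OF that] \<sigma>(2)[of "\<sigma> (\<psi>'' q - t')"] by (simp add: \<rho>_def \<sigma>\<sigma> t_def t'_def)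
  ultimately show ?thesis using W(1,2) unfolding model_chart_at_def by blast
qed

text \<open>The sets of points where a given unitary map serves are open, cover the surface, and any two of them
  are equal or disjoint.\<close>

lemma ex_global_unitary:
  assumes conn: "connected (carrier A)"
  shows "\<exists>\<Phi>. b_unitary \<Phi> \<and> (\<forall>p\<in>carrier A. model_chart_at A L \<Phi> p)"
proof (cases "carrier A = {}")
  case True then show ?thesis using b_unitary_id by auto
next
  case False
  then obtain p0 where p0: "p0 \<in> carrier A" by blast
  obtain \<Phi> where \<Phi>: "b_unitary \<Phi>" "model_chart_at A L \<Phi> p0" using ex_model_chart[OF p0] by blast
  define D where "D \<Psi> = {p. model_chart_at A L \<Psi> p}" for \<Psi>
  have op: "open (D \<Psi>)" for \<Psi>
  proof (subst open_subopen, intro ballI)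
    fix p assume "p \<in> D \<Psi>"
    then obtain V \<psi> where V: "p \<in> V" "V \<subseteq> carrier A" "smooth_atlas (insert (V, \<psi>) A)" "\<forall>q\<in>V. L q = hopf (\<Psi> (surf (\<psi> q)))"
      unfolding D_def model_chart_at_def by blast
    have "open V" using smooth_atlas_chart(1)[OF V(3) insertI1] .
    moreover have "V \<subseteq> D \<Psi>" using V unfolding D_def model_chart_at_def by blast
    ultimately show "\<exists>T. open T \<and> p \<in> T \<and> T \<subseteq> D \<Psi>" using V(1) by blast
  qed
  define H where "H = \<Union>{D \<Psi> |\<Psi>. b_unitary \<Psi> \<and> D \<Psi> \<inter> D \<Phi> = {}}"
  have "open H" unfolding H_def using op by blast
  moreover have "D \<Phi> \<inter> H \<inter> carrier A = {}" unfolding H_def by blast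
  moreover have "carrier A \<subseteq> D \<Phi> \<union> H"
  proof
    fix p assume "p \<in> carrier A"
    then obtain \<Psi> where \<Psi>: "b_unitary \<Psi>" "p \<in> D \<Psi>" using ex_model_chart unfolding D_def by blast
    show "p \<in> D \<Phi> \<union> H"
    proof (cases "D \<Psi> \<inter> D \<Phi> = {}")
      case True then show ?thesis using \<Psi> unfolding H_def by blast
    next
      case False
      then show ?thesis using model_chart_transfer[OF \<Phi>(1) \<Psi>(1)] \<Psi>(2) unfolding D_def by blast
    qed
  qed
  ultimately have "H \<inter> carrier A = {}"
    using connectedD[OF conn op[of \<Phi>], of H] \<Phi>(2) p0 unfolding D_def by blast
  then have "carrier A \<subseteq> D \<Phi>" using \<open>carrier A \<subseteq> D \<Phi> \<union> H\<close> by blast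
  then show ?thesis using \<Phi>(1) unfolding D_def by blast
qed

end

theorem theorem7p1:
  fixes A :: "'m::{t2_space,second_countable_topology} atlas"
    and L :: "'m \<Rightarrow> (complex^3) set"
  assumes "smooth_atlas A" and "connected (carrier A)"
    and "immersion A L" and "lorentzian A L"
    and "minimal A L" and "flat A L" and "slant A L"
  shows "lagrangian A L \<and>
    (\<exists>a::real. a \<noteq> 0 \<and> congruent_to_parametrized A L (\<lambda>t. hopf (L_tilde a t)))"
proof -
  interpret flat_minimal_slant_surface A L using assms by unfold_locales
  obtain \<Phi> where \<Phi>: "b_unitary \<Phi>" "\<And>p. p \<in> carrier A \<Longrightarrow> model_chart_at A L \<Phi> p"
    using ex_global_unitary[OF assms(2)] by blast
  have "congruent_to_parametrized A L (\<lambda>t. hopf (L_tilde 1 t))"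
    unfolding congruent_to_parametrized_def L_tilde_1
  proof (rule exI[of _ "\<lambda>l. \<Phi> ` l"], intro conjI holomorphic_isometry_unitary \<Phi>(1) ballI)
    fix p assume "p \<in> carrier A"
    then show "\<exists>V \<psi>. p \<in> V \<and> V \<subseteq> carrier A \<and> smooth_atlas (insert (V, \<psi>) A) \<and> (\<forall>q\<in>V. L q = \<Phi> ` hopf (surf (\<psi> q)))"
      using \<Phi>(2) unfolding model_chart_at_def b_unitary_hopf[OF \<Phi>(1)] by blast
  qed
  then show ?thesis using lagrangian by (intro conjI exI[of _ 1]) auto
qed

end
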